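(* Let $B$ be an infinite Blaschke product with uniformly separated zeros $\{a_j\}_{j=1}^\infty$. For $n\in\mathbb{N}$ let $B_n(z)=\prod_{j=1}^n\frac{z-a_j}{1-\bar a_jz}$, $C_n=C_{B_n}$, and let $P_n$ be the orthogonal projection of $K^2_B$ onto $K^2_{B_n}$. Let $A$ be a bounded linear operator on $K^2_B$. The following are equivalent: (1) $A\in\mathcal{T}(B)$; (2) for every nonconstant Blaschke product $B_\sigma$ dividing $B$, the operator $A_\sigma=P_{B_\sigma}A|_{K^2_{B_\sigma}}$ is $C_{B_\sigma}$--symmetric; (3) for every $n\in\mathbb{N}$, the operator $A_n=P_nA|_{K^2_{B_n}}$ is $C_n$--symmetric.
   Context: $B(z)=e^{i\gamma}\prod_{j=1}^\infty\frac{\bar a_j}{|a_j|}\frac{a_j-z}{1-\bar a_jz}$, $\gamma\in\mathbb{R}$ (with $\bar a_j/|a_j|$ read as $-1$ if $a_j=0$), where the zeros are uniformly separated: there is $\delta>0$ with $\inf_n\prod_{j\ne n}\left|\frac{a_j-a_n}{1-\bar a_ja_n}\right|\ge\delta$ (in particular the $a_j$ are distinct). For inner $\theta$: $K^2_\theta=H^2\ominus\theta H^2$, $P_\theta$ the orthogonal projection onto it, $C_\theta f(z)=\theta(z)\overline{zf(z)}$ on $|z|=1$; $T$ is $C_\theta$--symmetric if $C_\theta TC_\theta=T^*$. An inner $\alpha$ divides $\theta$ if $\bar\alpha\theta$ is inner. For $\varphi\in L^2$, $A^\theta_\varphi f=P_\theta(\varphi f)$ on $\{f\in K^2_\theta:\varphi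 f\in L^2\}$, and $\mathcal{T}(\theta)$ is the set of bounded such operators (truncated Toeplitz operators). *)

theory Defs
  imports "HOL-Analysis.Analysis"
begin

text \<open>Functions on the unit circle are represented by their values on the
parameter t, where z = e^{it}, t ranges over [0, 2 pi], with normalised Lebesgue measure.
L^2 elements are functions up to a.e. equality.\<close>

abbreviation circ :: "real measure" where
  "circ \<equiv> lebesgue_on {0..2*pi}"

definition L2 :: "(real \<Rightarrow> complex) \<Rightarrow> bool" where
  "L2 f \<longleftrightarrow> f \<in> borel_measurable circ \<and> integrable circ (\<lambda>t. (cmod (f t))^2)"

definition aeq :: "(real \<Rightarrow> complex) \<Rightarrow> (real \<Rightarrow> complex) \<Rightarrow> bool" where
  "aeq f g \<longleftrightarrow> (AE t in circ. f t = g t)"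

definition l2inner :: "(real \<Rightarrow> complex) \<Rightarrow> (real \<Rightarrow> complex) \<Rightarrow> complex" where
  "l2inner f g = (LINT t|circ. f t * cnj (g t)) / of_real (2*pi)"

definition l2norm :: "(real \<Rightarrow> complex) \<Rightarrow> real" where
  "l2norm f = sqrt ((LINT t|circ. (cmod (f t))^2) / (2*pi))"

definition fcoeff :: "(real \<Rightarrow> complex) \<Rightarrow> int \<Rightarrow> complex" where
  "fcoeff f n = (LINT t|circ. f t * cis (- (of_int n * t))) / of_real (2*pi)"

definition H2 :: "(real \<Rightarrow> complex) set" where
  "H2 = {f. L2 f \<and> (\<forall>n<0. fcoeff f n = 0)}"

text \<open>Inner function, given by its boundary function: bounded analytic (negative
Fourier coefficients vanish) and unimodular a.e.\<close>
definition inner_fn :: "(real \<Rightarrow> complex) \<Rightarrow> bool" where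
  "inner_fn \<theta> \<longleftrightarrow> \<theta> \<in> borel_measurable circ \<and> (AE t in circ. cmod (\<theta> t) = 1)
      \<and> (\<forall>n<0. fcoeff \<theta> n = 0)"

definition divides_inner :: "(real \<Rightarrow> complex) \<Rightarrow> (real \<Rightarrow> complex) \<Rightarrow> bool" where
  "divides_inner \<alpha> \<theta> \<longleftrightarrow> inner_fn (\<lambda>t. cnj (\<alpha> t) * \<theta> t)"

definition Kspace :: "(real \<Rightarrow> complex) \<Rightarrow> (real \<Rightarrow> complex) set" where
  "Kspace \<theta> = {f \<in> H2. \<forall>g\<in>H2. l2inner f (\<lambda>t. \<theta> t * g t) = 0}"

text \<open>Orthogonal projection onto a (closed) subspace K (a representative).\<close>
definition proj :: "(real \<Rightarrow> complex) set \<Rightarrow> (real \<Rightarrow> complex) \<Rightarrow> (real \<Rightarrow> complex)" where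
  "proj K f = (SOME g. g \<in> K \<and> (\<forall>h\<in>K. l2inner (\<lambda>t. f t - g t) h = 0))"

definition Cconj :: "(real \<Rightarrow> complex) \<Rightarrow> (real \<Rightarrow> complex) \<Rightarrow> (real \<Rightarrow> complex)" where
  "Cconj \<theta> f = (\<lambda>t. \<theta> t * cnj (cis t * f t))"

definition bounded_op_on :: "(real \<Rightarrow> complex) set \<Rightarrow> ((real \<Rightarrow> complex) \<Rightarrow> (real \<Rightarrow> complex)) \<Rightarrow> bool" where
  "bounded_op_on K A \<longleftrightarrow> (\<forall>f\<in>K. A f \<in> K)
     \<and> (\<forall>f\<in>K. \<forall>g\<in>K. \<forall>c. aeq (A (\<lambda>t. f t + c * g t)) (\<lambda>t. A f t + c * A g t))
     \<and> (\<exists>M. \<forall>f\<in>K. l2norm (A f) \<le> M * l2norm f)"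

text \<open>T is C_theta-symmetric on K_theta: C T C = T^*, i.e.
  <C T C f, g> = <f, T g> for all f, g in K_theta.\<close>
definition C_symmetric :: "(real \<Rightarrow> complex) \<Rightarrow> ((real \<Rightarrow> complex) \<Rightarrow> (real \<Rightarrow> complex)) \<Rightarrow> bool" where
  "C_symmetric \<theta> T \<longleftrightarrow> (\<forall>f\<in>Kspace \<theta>. \<forall>g\<in>Kspace \<theta>.
      l2inner (Cconj \<theta> (T (Cconj \<theta> f))) g = l2inner f (T g))"

definition compress :: "(real \<Rightarrow> complex) set \<Rightarrow> ((real \<Rightarrow> complex) \<Rightarrow> (real \<Rightarrow> complex))
    \<Rightarrow> ((real \<Rightarrow> complex) \<Rightarrow> (real \<Rightarrow> complex))" where
  "compress K A = (\<lambda>f. proj K (A f))"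

text \<open>Truncated Toeplitz operators: A agrees with A_phi f = P_theta(phi f) on its
domain {f in K_theta. phi f in L^2}, for some symbol phi in L^2.\<close>
definition TTO :: "(real \<Rightarrow> complex) \<Rightarrow> ((real \<Rightarrow> complex) \<Rightarrow> (real \<Rightarrow> complex)) set" where
  "TTO \<theta> = {A. \<exists>\<phi>. L2 \<phi> \<and> (\<forall>f\<in>Kspace \<theta>. L2 (\<lambda>t. \<phi> t * f t) \<longrightarrow>
        aeq (A f) (proj (Kspace \<theta>) (\<lambda>t. \<phi> t * f t)))}"

definition bv :: "(complex \<Rightarrow> complex) \<Rightarrow> (real \<Rightarrow> complex)" where
  "bv F = (\<lambda>t. Lim (at_left (1::real)) (\<lambda>r. F (complex_of_real r * cis t)))"

definition blf :: "complex \<Rightarrow> complex \<Rightarrow> complex" where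
  "blf a z = (if a = 0 then -1 else cnj a / of_real (cmod a)) * ((a - z) / (1 - cnj a * z))"

definition blaschke :: "real \<Rightarrow> (nat \<Rightarrow> complex) \<Rightarrow> complex \<Rightarrow> complex" where
  "blaschke \<gamma> a = (\<lambda>z. cis \<gamma> * (\<Prod>j. blf (a j) z))"

definition is_blaschke :: "(complex \<Rightarrow> complex) \<Rightarrow> bool" where
  "is_blaschke \<beta> \<longleftrightarrow> (\<exists>\<gamma> b S. (\<forall>j\<in>S. cmod (b j) < 1)
     \<and> summable (\<lambda>j. if j \<in> S then 1 - cmod (b j) else 0)
     \<and> \<beta> = (\<lambda>z. cis \<gamma> * (\<Prod>j. if j \<in> S then blf (b j) z else 1)))"

definition nonconstant_disc :: "(complex \<Rightarrow> complex) \<Rightarrow> bool" where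
  "nonconstant_disc \<beta> \<longleftrightarrow> \<not> (\<exists>c. \<forall>z\<in>ball 0 1. \<beta> z = c)"

text \<open>Partial product B_n (zeros a 0, ..., a (n-1)), unnormalised.\<close>
definition Bpart :: "(nat \<Rightarrow> complex) \<Rightarrow> nat \<Rightarrow> complex \<Rightarrow> complex" where
  "Bpart a n = (\<lambda>z. \<Prod>j<n. (z - a j) / (1 - cnj (a j) * z))"

definition uniformly_separated :: "(nat \<Rightarrow> complex) \<Rightarrow> bool" where
  "uniformly_separated a \<longleftrightarrow> (\<exists>\<delta>>0. \<forall>n. \<exists>p.
     (\<lambda>j. if j = n then 1 else cmod ((a j - a n) / (1 - cnj (a j) * a n))) has_prod p \<and> \<delta> \<le> p)"

end

theory Submission
  imports Defs "HOL-Complex_Analysis.Complex_Analysis" "HOL-Library.Real_Mod"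
begin

text \<open>
  Membership in TTO implies the two symmetry conditions because
  \<open>\<langle>A\<^sub>\<phi> f, g\<rangle>\<close> is the integral of \<open>\<phi> f g\<^sup>*\<close>, which is invariant under
  \<open>(f, g) \<mapsto> (C g, C f)\<close>; bounded functions are dense in every model space.

  For the converse, the space \<open>K\<close> of \<open>B\<^sub>n\<close> consists of the quotients \<open>p / q\<^sub>n\<close> with \<open>deg p < n\<close>,
  where \<open>q\<^sub>n\<close> is the product of the \<open>1 - a\<^sub>j\<^sup>* z\<close>, and \<open>C\<^sub>n\<close> maps \<open>z\<^sup>l / q\<^sub>n\<close> to
  \<open>z\<^sup>m / q\<^sub>n\<close> with \<open>l + m = n - 1\<close>. Hence symmetry says that the matrix of \<open>A\<close> in this system is
  persymmetric, and persymmetry for all \<open>n\<close> forces these matrices to be Toeplitz, by induction on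
  \<open>n\<close>. Letting \<open>n\<close> tend to infinity, \<open>\<langle>A f, g\<rangle>\<close> is unchanged when \<open>f\<close> and \<open>g\<close>, both vanishing
  at the origin, are divided by \<open>z\<close>. By Sarason's argument this shift invariance produces a symbol.

  That the radial boundary values of a Blaschke product define an inner function needs a maximal
  inequality for Poisson integrals. Linearise the supremum over the radii by a measurable choice
  \<open>\<rho>(t)\<close>, giving an operator \<open>T\<close>; since the Poisson kernels satisfy \<open>P\<^sub>r\<^sub>s \<le> 8 (P\<^sub>r + P\<^sub>s)\<close>, the
  kernel of \<open>T T\<^sup>*\<close> is at most \<open>8\<close> times that of \<open>T + T\<^sup>*\<close>, so the norm of \<open>T\<close> is bounded independently of \<open>\<rho>\<close>.
\<close>

section \<open>Square-integrable functions on the circle\<close>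

text \<open>\<open>bv\<close> is a pointwise radial limit, while a Blaschke product on the circle is
  naturally an L2 limit of partial products. Identifying the two a.e. is Fatou's theorem, the only
  place where the maximal inequality enters; everything later uses L2 convergence alone. A symbol is
  merely square integrable, so the form of multiplication by it makes sense at once only for bounded
  vectors. The projections of z^m onto a model space are bounded and span a dense subspace;
  identities involving the symbol are proved for bounded vectors and then extended by continuity.
  Persymmetry at one size is far weaker than the Toeplitz property. The extra information is that
  consecutive sizes are linked by 1/q_n = (1 - conj(a_n) z)/q_{n+1}, so each matrix determines the
  smaller ones. In the limit, the partial products approach B only up to unimodular constants that
  need not converge. This is harmless: neither the model space nor the projections of z^m change
  when the inner function is multiplied by such a constant.\<close>

lemma finite_measure_circ: "finite_measure circ"
  by (rule finite_measure_lebesgue_on) auto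

lemma emeasure_circ: "emeasure circ (space circ) = ennreal (2*pi)"
  by (simp add: emeasure_restrict_space space_restrict_space)

lemma integrable_circ_const [simp]: "integrable circ (\<lambda>t. c :: 'a :: {banach, second_countable_topology})"
  using finite_measure.integrable_const[OF finite_measure_circ] .

lemma measurable_circ_borel: "f \<in> borel_measurable borel \<Longrightarrow> f \<in> borel_measurable circ"
  by (intro measurable_restrict_space1 measurable_completion) simp

lemma measurable_circ_continuous: "continuous_on UNIV f \<Longrightarrow> f \<in> borel_measurable circ"
  by (intro measurable_circ_borel borel_measurable_continuous_onI)

lemma L2_measurable: "L2 f \<Longrightarrow> f \<in> borel_measurable circ"
  by (simp add: L2_def)

lemma L2_sq_integrable: "L2 f \<Longrightarrow> integrable circ (\<lambda>t. (cmod (f t))\<^sup>2)"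
  by (simp add: L2_def)

lemma L2_I_bound:
  assumes "f \<in> borel_measurable circ" "integrable circ h" "AE t in circ. (cmod (f t))\<^sup>2 \<le> h t"
  shows "L2 f"
  unfolding L2_def
proof
  show "integrable circ (\<lambda>t. (cmod (f t))\<^sup>2)"
    by (rule Bochner_Integration.integrable_bound[OF assms(2)]) (use assms in auto)
qed fact

lemma L2_mult_integrable:
  assumes "L2 f" "L2 g" shows "integrable circ (\<lambda>t. f t * g t)"
proof (rule Bochner_Integration.integrable_bound)
  show "integrable circ (\<lambda>t. (cmod (f t))\<^sup>2 + (cmod (g t))\<^sup>2)"
    using assms by (intro Bochner_Integration.integrable_add L2_sq_integrable)
  show "(\<lambda>t. f t * g t) \<in> borel_measurable circ"
    using assms by (auto simp: L2_def)
  have "x * y \<le> x\<^sup>2 + y\<^sup>2" if "x \<ge> 0" "y \<ge> 0" for x y :: real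
    using sum_squares_bound[of x y] that zero_le_mult_iff[of x y] by linarith
  then show "AE t in circ. norm (f t * g t) \<le> norm ((cmod (f t))\<^sup>2 + (cmod (g t))\<^sup>2)"
    by (auto simp: norm_mult)
qed

lemma L2_add: assumes "L2 f" "L2 g" shows "L2 (\<lambda>t. f t + g t)"
proof (rule L2_I_bound)
  show "integrable circ (\<lambda>t. 2 * (cmod (f t))\<^sup>2 + 2 * (cmod (g t))\<^sup>2)"
    using assms by (intro Bochner_Integration.integrable_add integrable_mult_right L2_sq_integrable)
  show "(\<lambda>t. f t + g t) \<in> borel_measurable circ"
    using assms by (auto simp: L2_def)
  have "(cmod (x + y))\<^sup>2 \<le> 2 * (cmod x)\<^sup>2 + 2 * (cmod y)\<^sup>2" for x y
  proof -
    have "(cmod (x + y))\<^sup>2 \<le> (cmod x + cmod y)\<^sup>2"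
      by (intro power_mono norm_triangle_ineq) auto
    then show ?thesis
      using sum_squares_bound[of "cmod x" "cmod y"] by (simp add: power2_sum)
  qed
  then show "AE t in circ. (cmod (f t + g t))\<^sup>2 \<le> 2 * (cmod (f t))\<^sup>2 + 2 * (cmod (g t))\<^sup>2"
    by auto
qed

lemma L2_bdd_mult:
  assumes "h \<in> borel_measurable circ" "AE t in circ. cmod (h t) \<le> M" "L2 f"
  shows "L2 (\<lambda>t. h t * f t)"
proof (rule L2_I_bound)
  show "integrable circ (\<lambda>t. M\<^sup>2 * (cmod (f t))\<^sup>2)"
    using assms by (intro integrable_mult_right L2_sq_integrable)
  show "(\<lambda>t. h t * f t) \<in> borel_measurable circ"
    using assms by (auto simp: L2_def)
  show "AE t in circ. (cmod (h t * f t))\<^sup>2 \<le> M\<^sup>2 * (cmod (f t))\<^sup>2"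
    using assms(2) by eventually_elim (auto simp: norm_mult power_mult_distrib intro!: mult_right_mono power_mono)
qed

lemma L2_cmult: "L2 f \<Longrightarrow> L2 (\<lambda>t. c * f t)"
  by (rule L2_bdd_mult[where M = "cmod c"]) auto

lemma L2_uminus: "L2 f \<Longrightarrow> L2 (\<lambda>t. - f t)"
  using L2_cmult[of f "-1"] by simp

lemma L2_diff: "L2 f \<Longrightarrow> L2 g \<Longrightarrow> L2 (\<lambda>t. f t - g t)"
  using L2_add[OF _ L2_uminus, of f g] by simp

lemma L2_cnj: "L2 f \<Longrightarrow> L2 (\<lambda>t. cnj (f t))"
  by (auto simp: L2_def intro: measurable_compose[OF _ borel_measurable_continuous_onI] continuous_intros)

lemma L2_const: "L2 (\<lambda>t. c)"
  by (auto simp: L2_def)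

lemma L2_sum: "(\<And>i. i \<in> I \<Longrightarrow> L2 (f i)) \<Longrightarrow> L2 (\<lambda>t. \<Sum>i\<in>I. f i t)"
  by (induction I rule: infinite_finite_induct) (auto intro: L2_add L2_const)

lemma L2_bdd:
  assumes "h \<in> borel_measurable circ" "AE t in circ. cmod (h t) \<le> M"
  shows "L2 h"
  using L2_bdd_mult[OF assms L2_const[of 1]] by simp

text \<open>\<open>circ\<close> restricts the complete Lebesgue measure, so a change on a null set
  keeps measurability. Extension by zero moves the question to \<open>lebesgue\<close>.\<close>

lemma measurable_circ_aeq:
  assumes "f \<in> borel_measurable circ" "aeq f g" shows "g \<in> borel_measurable circ"
proof -
  have "(\<lambda>x. if x \<in> {0..2*pi} then g x else 0) \<in> borel_measurable lebesgue"
  proof (rule borel_measurable_AE)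
    show "(\<lambda>x. if x \<in> {0..2*pi} then f x else 0) \<in> borel_measurable lebesgue"
      using assms by (subst borel_measurable_if) auto
    have "AE t in lebesgue. t \<in> {0..2*pi} \<longrightarrow> f t = g t"
      using assms(2) unfolding aeq_def by (subst (asm) AE_restrict_space_iff) auto
    then show "AE x in lebesgue. (if x \<in> {0..2*pi} then f x else 0) = (if x \<in> {0..2*pi} then g x else 0)"
      by eventually_elim auto
  qed
  then show ?thesis
    by (subst (asm) borel_measurable_if) auto
qed

lemma L2_aeq: assumes "L2 f" "aeq f g" shows "L2 g"
proof (rule L2_I_bound)
  show "g \<in> borel_measurable circ"
    using assms measurable_circ_aeq L2_measurable by blast
  show "integrable circ (\<lambda>t. (cmod (f t))\<^sup>2)"
    using assms by (rule_tac L2_sq_integrable)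
  show "AE t in circ. (cmod (g t))\<^sup>2 \<le> (cmod (f t))\<^sup>2"
    using assms(2) unfolding aeq_def by eventually_elim auto
qed

lemma aeq_refl [simp]: "aeq f f"
  by (simp add: aeq_def)



section \<open>The inner product and the norm\<close>

lemma L2_inner_integrable: "L2 f \<Longrightarrow> L2 g \<Longrightarrow> integrable circ (\<lambda>t. f t * cnj (g t))"
  using L2_mult_integrable L2_cnj by blast

lemma l2inner_add_left:
  "L2 f \<Longrightarrow> L2 g \<Longrightarrow> L2 h \<Longrightarrow> l2inner (\<lambda>t. f t + g t) h = l2inner f h + l2inner g h"
  by (simp add: l2inner_def distrib_right add_divide_distrib L2_inner_integrable)

lemma l2inner_diff_left:
  "L2 f \<Longrightarrow> L2 g \<Longrightarrow> L2 h \<Longrightarrow> l2inner (\<lambda>t. f t - g t) h = l2inner f h - l2inner g h"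
  by (simp add: l2inner_def left_diff_distrib diff_divide_distrib L2_inner_integrable)

lemma l2inner_cmult_left: "l2inner (\<lambda>t. c * f t) h = c * l2inner f h"
  by (simp add: l2inner_def mult.assoc)

lemma l2inner_cnj: "cnj (l2inner f g) = l2inner g f"
proof -
  have "cnj (LINT t|circ. f t * cnj (g t)) = (LINT t|circ. cnj (f t * cnj (g t)))"
    by (rule Bochner_Integration.integral_cnj[symmetric])
  also have "\<dots> = (LINT t|circ. g t * cnj (f t))"
    by (intro Bochner_Integration.integral_cong) auto
  finally show ?thesis by (simp add: l2inner_def)
qed

lemma l2inner_add_right:
  "L2 f \<Longrightarrow> L2 g \<Longrightarrow> L2 h \<Longrightarrow> l2inner h (\<lambda>t. f t + g t) = l2inner h f + l2inner h g"
  by (subst (1 2 3) l2inner_cnj[symmetric]) (simp add: l2inner_add_left)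

lemma l2inner_diff_right:
  "L2 f \<Longrightarrow> L2 g \<Longrightarrow> L2 h \<Longrightarrow> l2inner h (\<lambda>t. f t - g t) = l2inner h f - l2inner h g"
  by (subst (1 2 3) l2inner_cnj[symmetric]) (simp add: l2inner_diff_left)

lemma l2inner_cmult_right: "l2inner h (\<lambda>t. c * f t) = cnj c * l2inner h f"
  by (subst (1 2) l2inner_cnj[symmetric]) (simp add: l2inner_cmult_left)

lemma l2inner_zero [simp]: "l2inner (\<lambda>t. 0) h = 0" "l2inner h (\<lambda>t. 0) = 0"
  by (auto simp: l2inner_def)

lemma l2inner_sum_left:
  "(\<And>i. i \<in> I \<Longrightarrow> L2 (f i)) \<Longrightarrow> L2 h \<Longrightarrow> l2inner (\<lambda>t. \<Sum>i\<in>I. f i t) h = (\<Sum>i\<in>I. l2inner (f i) h)"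
  by (induction I rule: infinite_finite_induct) (auto simp: l2inner_add_left L2_sum)

lemma l2inner_sum_right:
  "(\<And>i. i \<in> I \<Longrightarrow> L2 (f i)) \<Longrightarrow> L2 h \<Longrightarrow> l2inner h (\<lambda>t. \<Sum>i\<in>I. f i t) = (\<Sum>i\<in>I. l2inner h (f i))"
  by (induction I rule: infinite_finite_induct) (auto simp: l2inner_add_right L2_sum)

lemma l2inner_cong_AE:
  assumes "aeq f f'" "aeq g g'" "L2 f" "L2 g"
  shows "l2inner f g = l2inner f' g'"
proof -
  have "L2 f'" "L2 g'" using assms L2_aeq by blast+
  then show ?thesis
    unfolding l2inner_def
    by (intro arg_cong2[where f="(/)"] integral_cong_AE borel_measurable_integrable L2_inner_integrable assms refl)
       (use assms(1,2) in \<open>auto simp: aeq_def\<close>)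
qed

lemma l2inner_mult_swap: "l2inner (\<lambda>t. h t * f t) g = l2inner f (\<lambda>t. cnj (h t) * g t)"
  by (simp add: l2inner_def mult_ac)

lemma l2norm_sq: "(l2norm f)\<^sup>2 = (LINT t|circ. (cmod (f t))\<^sup>2) / (2*pi)"
  by (simp add: l2norm_def)

lemma l2norm_nonneg [simp]: "0 \<le> l2norm f"
  by (simp add: l2norm_def)

lemma l2inner_self: "l2inner f f = of_real ((l2norm f)\<^sup>2)"
proof -
  have "(LINT t|circ. f t * cnj (f t)) = (LINT t|circ. complex_of_real ((cmod (f t))\<^sup>2))"
    by (simp only: complex_norm_square)
  also have "\<dots> = of_real (LINT t|circ. (cmod (f t))\<^sup>2)"
    by (rule integral_complex_of_real)
  finally show ?thesis by (simp add: l2inner_def l2norm_sq)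
qed

lemma l2norm_eq_0_iff: "L2 f \<Longrightarrow> l2norm f = 0 \<longleftrightarrow> aeq f (\<lambda>t. 0)"
  by (simp add: l2norm_def aeq_def integral_nonneg_eq_0_iff_AE L2_sq_integrable)

lemma l2norm_cong_AE:
  assumes "aeq f g" "L2 f" shows "l2norm f = l2norm g"
proof -
  have "L2 g" using assms L2_aeq by blast
  then have "complex_of_real ((l2norm f)\<^sup>2) = of_real ((l2norm g)\<^sup>2)"
    using l2inner_cong_AE[OF assms(1) assms(1) assms(2) assms(2)] by (simp only: l2inner_self)
  then show ?thesis
    by (simp only: of_real_eq_iff) simp
qed

lemma l2norm_sq_expand:
  assumes "L2 f" "L2 g"
  shows "(l2norm (\<lambda>t. f t + g t))\<^sup>2 = (l2norm f)\<^sup>2 + 2 * Re (l2inner f g) + (l2norm g)\<^sup>2"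
proof -
  have "complex_of_real ((l2norm (\<lambda>t. f t + g t))\<^sup>2) = l2inner (\<lambda>t. f t + g t) (\<lambda>t. f t + g t)"
    by (simp add: l2inner_self)
  also have "\<dots> = l2inner f f + l2inner f g + cnj (l2inner f g) + l2inner g g"
    using assms by (simp add: l2inner_add_left l2inner_add_right L2_add l2inner_cnj)
  finally have "Re (complex_of_real ((l2norm (\<lambda>t. f t + g t))\<^sup>2)) = Re \<dots>" by simp
  then show ?thesis by (simp add: l2inner_self del: of_real_power)
qed

lemma l2norm_cmult: "l2norm (\<lambda>t. c * f t) = cmod c * l2norm f"
proof -
  have "(LINT t|circ. (cmod (c * f t))\<^sup>2) = (cmod c)\<^sup>2 * (LINT t|circ. (cmod (f t))\<^sup>2)"
    by (simp add: norm_mult power_mult_distrib)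
  then show ?thesis by (simp add: l2norm_def real_sqrt_mult real_sqrt_divide)
qed

lemma l2norm_uminus: "l2norm (\<lambda>t. - f t) = l2norm f"
  by (simp add: l2norm_def)

lemma l2norm_minus_commute: "l2norm (\<lambda>t. f t - g t) = l2norm (\<lambda>t. g t - f t)"
  by (simp add: l2norm_def norm_minus_commute)

lemma l2norm_cnj: "l2norm (\<lambda>t. cnj (f t)) = l2norm f"
  by (simp add: l2norm_def)

lemma l2norm_zero [simp]: "l2norm (\<lambda>t. 0) = 0"
  by (simp add: l2norm_def)

lemma l2_Cauchy_Schwarz:
  assumes "L2 f" "L2 g" shows "cmod (l2inner f g) \<le> l2norm f * l2norm g"
proof (cases "l2norm g = 0")
  case True
  then have "aeq g (\<lambda>t. 0)" using assms l2norm_eq_0_iff by blast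
  then have "l2inner f g = l2inner f (\<lambda>t. 0)"
    using assms by (intro l2inner_cong_AE) auto
  then show ?thesis by simp
next
  case False
  define N where "N = (l2norm g)\<^sup>2"
  have N: "N > 0" using False by (simp add: N_def)
  \<comment> \<open>The minimiser of the norm of f + c g.\<close>
  define c where "c = - l2inner f g / of_real N"
  have "0 \<le> (l2norm (\<lambda>t. f t + c * g t))\<^sup>2" by simp
  also have "\<dots> = (l2norm f)\<^sup>2 + 2 * Re (cnj c * l2inner f g) + (cmod c)\<^sup>2 * N"
    using assms by (simp add: l2norm_sq_expand L2_cmult l2norm_cmult l2inner_cmult_right power_mult_distrib N_def)
  also have "cnj c * l2inner f g = - of_real ((cmod (l2inner f g))\<^sup>2 / N)"
    unfolding of_real_divide complex_norm_square by (simp add: c_def)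
  also have "(cmod c)\<^sup>2 * N = (cmod (l2inner f g))\<^sup>2 / N"
    using N by (simp add: c_def norm_divide power_divide power2_eq_square)
  finally have "(cmod (l2inner f g))\<^sup>2 / N \<le> (l2norm f)\<^sup>2"
    by (simp add: Re_complex_of_real del: of_real_divide of_real_power)
  then have "(cmod (l2inner f g))\<^sup>2 \<le> (l2norm f * l2norm g)\<^sup>2"
    using N by (simp add: field_simps N_def)
  then show ?thesis
    by (rule power2_le_imp_le) simp
qed

lemma l2norm_triangle:
  assumes "L2 f" "L2 g" shows "l2norm (\<lambda>t. f t + g t) \<le> l2norm f + l2norm g"
proof (rule power2_le_imp_le)
  have "Re (l2inner f g) \<le> l2norm f * l2norm g"
    using l2_Cauchy_Schwarz[OF assms] complex_Re_le_cmod order_trans by blast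
  then show "(l2norm (\<lambda>t. f t + g t))\<^sup>2 \<le> (l2norm f + l2norm g)\<^sup>2"
    using assms by (simp add: l2norm_sq_expand power2_sum)
qed simp

lemma l2norm_triangle_diff:
  assumes "L2 f" "L2 g" "L2 h"
  shows "l2norm (\<lambda>t. f t - h t) \<le> l2norm (\<lambda>t. f t - g t) + l2norm (\<lambda>t. g t - h t)"
  using l2norm_triangle[of "\<lambda>t. f t - g t" "\<lambda>t. g t - h t"] assms by (simp add: L2_diff)

lemma l2norm_sum_le:
  "(\<And>i. i \<in> I \<Longrightarrow> L2 (f i)) \<Longrightarrow> l2norm (\<lambda>t. \<Sum>i\<in>I. f i t) \<le> (\<Sum>i\<in>I. l2norm (f i))"
proof (induction I rule: infinite_finite_induct)
  case (insert x F)
  then show ?case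
    using l2norm_triangle[of "f x" "\<lambda>t. \<Sum>i\<in>F. f i t"] by (force simp: L2_sum)
qed auto

lemma l2norm_unimodular_mult:
  assumes "AE t in circ. cmod (h t) = 1" "h \<in> borel_measurable circ" "L2 f"
  shows "l2norm (\<lambda>t. h t * f t) = l2norm f"
proof -
  have "(LINT t|circ. (cmod (h t * f t))\<^sup>2) = (LINT t|circ. (cmod (f t))\<^sup>2)"
  proof (intro integral_cong_AE)
    note [measurable] = assms(2) L2_measurable[OF assms(3)]
    show "(\<lambda>t. (cmod (h t * f t))\<^sup>2) \<in> borel_measurable circ" "(\<lambda>t. (cmod (f t))\<^sup>2) \<in> borel_measurable circ"
      by measurable
    show "AE t in circ. (cmod (h t * f t))\<^sup>2 = (cmod (f t))\<^sup>2"
      using assms(1) by eventually_elim (simp add: norm_mult)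
  qed
  then show ?thesis by (simp add: l2norm_def)
qed

section \<open>From norm convergence to a.e. convergence; completeness\<close>

lemma nn_integral_l2norm:
  assumes "L2 f" shows "(\<integral>\<^sup>+t. ennreal ((cmod (f t))\<^sup>2) \<partial>circ) = ennreal (2*pi*(l2norm f)\<^sup>2)"
  using assms by (simp add: nn_integral_eq_integral L2_sq_integrable l2norm_sq)

lemma tendsto_l2inner_left:
  assumes "\<And>n. L2 (X n)" "L2 f" "L2 g" "(\<lambda>n. l2norm (\<lambda>t. X n t - f t)) \<longlonglongrightarrow> 0"
  shows "(\<lambda>n. l2inner (X n) g) \<longlonglongrightarrow> l2inner f g"
proof -
  have "(\<lambda>n. l2inner (X n) g - l2inner f g) \<longlonglongrightarrow> 0"
  proof (rule Lim_null_comparison)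
    show "\<forall>\<^sub>F n in sequentially. norm (l2inner (X n) g - l2inner f g) \<le> l2norm (\<lambda>t. X n t - f t) * l2norm g"
      using l2_Cauchy_Schwarz[of "\<lambda>t. X _ t - f t" g] assms
      by (intro always_eventually) (simp add: L2_diff flip: l2inner_diff_left)
    show "(\<lambda>n. l2norm (\<lambda>t. X n t - f t) * l2norm g) \<longlonglongrightarrow> 0"
      using tendsto_mult_right[OF assms(4), of "l2norm g"] by simp
  qed
  then show ?thesis by (simp add: LIM_zero_iff)
qed

lemma tendsto_l2inner_right:
  assumes "\<And>n. L2 (X n)" "L2 f" "L2 g" "(\<lambda>n. l2norm (\<lambda>t. X n t - f t)) \<longlonglongrightarrow> 0"
  shows "(\<lambda>n. l2inner g (X n)) \<longlonglongrightarrow> l2inner g f"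
  using tendsto_cnj[OF tendsto_l2inner_left[OF assms]] by (simp add: l2inner_cnj)

text \<open>The sum has a finite integral, hence is finite a.e. This turns fast convergence in norm
  into convergence a.e., for functions and later for maximal functions.\<close>

lemma AE_summable_of_nn_integral:
  fixes h :: "nat \<Rightarrow> 'a \<Rightarrow> real"
  assumes [measurable]: "\<And>k. h k \<in> borel_measurable M" and nn: "\<And>k x. h k x \<ge> 0"
    and le: "\<And>k. (\<integral>\<^sup>+x. ennreal (h k x) \<partial>M) \<le> ennreal (c k)"
    and c: "summable c" "\<And>k. c k \<ge> 0"
  shows "AE x in M. summable (\<lambda>k. h k x)"
proof -
  have "(\<integral>\<^sup>+x. (\<Sum>k. ennreal (h k x)) \<partial>M) = (\<Sum>k. \<integral>\<^sup>+x. ennreal (h k x) \<partial>M)"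
    by (rule nn_integral_suminf) auto
  also have "\<dots> \<le> (\<Sum>k. ennreal (c k))"
    by (rule suminf_le) (auto simp: le)
  also have "\<dots> < \<infinity>"
    using c by (simp add: ennreal_suminf_neq_top less_top)
  finally have "AE x in M. (\<Sum>k. ennreal (h k x)) \<noteq> \<infinity>"
    by (intro nn_integral_PInf_AE) auto
  then show ?thesis
    by eventually_elim (auto intro: summable_suminf_not_top simp: nn)
qed

text \<open>Cauchy--Schwarz against the constant 1, which has norm 1 by the normalisation of the
  measure.\<close>

lemma l1_le_l2:
  assumes "L2 f" shows "(\<integral>\<^sup>+t. ennreal (cmod (f t)) \<partial>circ) \<le> ennreal (2*pi*l2norm f)"
proof -
  have "L2 (\<lambda>t. of_real (cmod (f t)))"
    using assms by (auto simp: L2_def)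
  then have i: "integrable circ (\<lambda>t. complex_of_real (cmod (f t)) * 1)"
    by (rule L2_mult_integrable[OF _ L2_const])
  then have i': "integrable circ (\<lambda>t. cmod (f t))"
    by (simp add: complex_of_real_integrable_eq)
  have "cmod (l2inner (\<lambda>t. of_real (cmod (f t))) (\<lambda>t. 1)) \<le> l2norm (\<lambda>t. of_real (cmod (f t))) * l2norm (\<lambda>t. 1)"
    by (intro l2_Cauchy_Schwarz L2_const) fact
  also have "l2norm (\<lambda>t. of_real (cmod (f t))) = l2norm f" by (simp add: l2norm_def)
  also have "l2norm (\<lambda>t. 1) = 1" by (simp add: l2norm_def measure_restrict_space)
  also have "l2inner (\<lambda>t. of_real (cmod (f t))) (\<lambda>t. 1) = of_real ((LINT t|circ. cmod (f t)) / (2*pi))"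
    by (simp add: l2inner_def integral_complex_of_real)
  finally have "(LINT t|circ. cmod (f t)) \<le> 2*pi*l2norm f"
    by (simp add: abs_divide field_simps del: of_real_divide)
  then show ?thesis
    using i' by (simp add: nn_integral_eq_integral ennreal_leI)
qed

lemma L2_fast_AE:
  assumes "\<And>k. L2 (X k)" "L2 f" "\<And>k::nat. l2norm (\<lambda>t. X k t - f t) \<le> (1/2)^k"
  shows "AE t in circ. (\<lambda>k. X k t) \<longlonglongrightarrow> f t"
proof -
  note [measurable] = assms(1,2)[THEN L2_measurable]
  have "AE t in circ. summable (\<lambda>k. cmod (X k t - f t))"
  proof (rule AE_summable_of_nn_integral)
    show "(\<lambda>t. cmod (X k t - f t)) \<in> borel_measurable circ" for k
      by measurable
    show "(\<integral>\<^sup>+t. ennreal (cmod (X k t - f t)) \<partial>circ) \<le> ennreal (2*pi*(1/2)^k)" for k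
      by (rule order_trans[OF l1_le_l2]) (use assms in \<open>auto intro!: L2_diff ennreal_leI\<close>)
    show "summable (\<lambda>k. 2*pi*(1/2::real)^k)"
      by (intro summable_mult summable_geometric) auto
  qed auto
  then show ?thesis
    by eventually_elim (auto dest!: summable_LIMSEQ_zero simp: tendsto_norm_zero_iff LIM_zero_iff)
qed

text \<open>A fast subsequence has summable increments, so it converges a.e.; Fatou's lemma then
  makes its pointwise limit the norm limit of the whole sequence.\<close>

lemma L2_complete:
  assumes X: "\<And>n. L2 (X n)"
    and Cau: "\<And>e. e > 0 \<Longrightarrow> \<exists>M. \<forall>m\<ge>M. \<forall>n\<ge>M. l2norm (\<lambda>t. X m t - X n t) < e"
  obtains f where "L2 f" "(\<lambda>n. l2norm (\<lambda>t. X n t - f t)) \<longlonglongrightarrow> 0"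
proof -
  note [measurable] = X[THEN L2_measurable]
  have "\<exists>M. \<forall>m\<ge>M. \<forall>n\<ge>M. l2norm (\<lambda>t. X m t - X n t) < (1/2)^k" for k :: nat
    by (rule Cau) auto
  then obtain M where M: "\<And>k m n. m \<ge> M k \<Longrightarrow> n \<ge> M k \<Longrightarrow> l2norm (\<lambda>t. X m t - X n t) < (1/2)^k"
    by metis
  \<comment> \<open>Summing makes \<open>r\<close> increasing and at least \<open>M k\<close>; the
    \<open>+ 1\<close> makes \<open>r k\<close> at least \<open>k\<close>, so that \<open>r\<close>
    tends to infinity.\<close>
  define r where "r = (\<lambda>k. \<Sum>i\<le>k. M i + 1)"
  have r: "r k \<ge> M k" "r (Suc k) \<ge> r k" "r k \<ge> k" for k
  proof -
    show "r k \<ge> M k" unfolding r_def using member_le_sum[of k "{..k}" "\<lambda>i. M i + 1"] by auto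
    show "r (Suc k) \<ge> r k" by (simp add: r_def)
    have "(\<Sum>i\<le>k. 1) \<le> r k" unfolding r_def by (rule sum_mono) auto
    then show "r k \<ge> k" by simp
  qed
  have "AE t in circ. summable (\<lambda>k. cmod (X (r (Suc k)) t - X (r k) t))"
  proof (rule AE_summable_of_nn_integral)
    show "(\<lambda>t. cmod (X (r (Suc k)) t - X (r k) t)) \<in> borel_measurable circ" for k
      by measurable
    have "l2norm (\<lambda>t. X (r (Suc k)) t - X (r k) t) \<le> (1/2)^k" for k
      using M[of k "r (Suc k)" "r k"] r(1,2)[of k] by simp
    then show "(\<integral>\<^sup>+t. ennreal (cmod (X (r (Suc k)) t - X (r k) t)) \<partial>circ) \<le> ennreal (2*pi*(1/2)^k)" for k
      by (intro order_trans[OF l1_le_l2]) (auto intro!: L2_diff ennreal_leI X)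
    show "summable (\<lambda>k. 2*pi*(1/2::real)^k)"
      by (intro summable_mult summable_geometric) auto
  qed auto
  then have conv: "AE t in circ. convergent (\<lambda>k. X (r k) t)"
  proof eventually_elim
    case (elim t)
    then have "summable (\<lambda>k. X (r (Suc k)) t - X (r k) t)"
      by (rule summable_norm_cancel)
    then have "convergent (\<lambda>n. \<Sum>k<n. X (r (Suc k)) t - X (r k) t)"
      by (simp add: summable_iff_convergent)
    then have "convergent (\<lambda>n. X (r n) t - X (r 0) t)"
      by (simp add: sum_lessThan_telescope[of "\<lambda>k. X (r k) t"])
    then show ?case
      using convergent_diff_const_right_iff by blast
  qed
  define f where "f = (\<lambda>t. lim (\<lambda>k. X (r k) t))"
  have fm[measurable]: "f \<in> borel_measurable circ"
    unfolding f_def by (rule borel_measurable_lim_metric) measurable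
  have lim: "AE t in circ. (\<lambda>k. X (r k) t) \<longlonglongrightarrow> f t"
    using conv unfolding f_def by eventually_elim (simp add: convergent_LIMSEQ_iff)
  \<comment> \<open>Fatou's lemma in the second index of the Cauchy estimate. It is stated with
    \<open>nn_integral\<close> because square integrability of the difference is only a consequence
    of it.\<close>
  have est: "(\<integral>\<^sup>+t. ennreal ((cmod (X n t - f t))\<^sup>2) \<partial>circ) \<le> ennreal (2*pi*((1/2)^j)\<^sup>2)" if "n \<ge> M j" for n j
  proof -
    have "(\<integral>\<^sup>+t. ennreal ((cmod (X n t - f t))\<^sup>2) \<partial>circ)
        = (\<integral>\<^sup>+t. liminf (\<lambda>k. ennreal ((cmod (X n t - X (r k) t))\<^sup>2)) \<partial>circ)"
    proof (intro nn_integral_cong_AE, use lim in eventually_elim)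
      case (elim t)
      have "(\<lambda>k. ennreal ((cmod (X n t - X (r k) t))\<^sup>2)) \<longlonglongrightarrow> ennreal ((cmod (X n t - f t))\<^sup>2)"
        by (intro tendsto_intros elim)
      then show ?case
        by (rule lim_imp_Liminf[OF sequentially_bot, symmetric])
    qed
    also have "\<dots> \<le> liminf (\<lambda>k. \<integral>\<^sup>+t. ennreal ((cmod (X n t - X (r k) t))\<^sup>2) \<partial>circ)"
      by (rule nn_integral_liminf) measurable
    also have "\<dots> \<le> ennreal (2*pi*((1/2)^j)\<^sup>2)"
    proof (rule Liminf_le)
      show "\<forall>\<^sub>F k in sequentially. (\<integral>\<^sup>+t. ennreal ((cmod (X n t - X (r k) t))\<^sup>2) \<partial>circ) \<le> ennreal (2*pi*((1/2)^j)\<^sup>2)"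
        using eventually_ge_at_top[of "M j"]
      proof eventually_elim
        case (elim k)
        then have "l2norm (\<lambda>t. X n t - X (r k) t) < (1/2)^j"
          using M that r(3)[of k] by (meson order_trans)
        then show ?case
          using X by (subst nn_integral_l2norm) (auto intro!: L2_diff ennreal_leI mult_left_mono power_mono)
      qed
    qed simp
    finally show ?thesis .
  qed
  have df: "L2 (\<lambda>t. X n t - f t)" if "n \<ge> M j" for n j
    unfolding L2_def
  proof (intro conjI integrableI_bounded)
    show m: "(\<lambda>t. X n t - f t) \<in> borel_measurable circ" by measurable
    then show "(\<lambda>t. (cmod (X n t - f t))\<^sup>2) \<in> borel_measurable circ" by auto
    show "(\<integral>\<^sup>+ t. ennreal (norm ((cmod (X n t - f t))\<^sup>2)) \<partial>circ) < \<infinity>"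
      using est[OF that] by (simp add: order_le_less_trans)
  qed
  have "L2 f"
    using L2_diff[OF X[of "M 0"] df[of 0 "M 0"]] by simp
  moreover have "(\<lambda>n. l2norm (\<lambda>t. X n t - f t)) \<longlonglongrightarrow> 0"
  proof (rule LIMSEQ_I)
    fix e :: real assume "e > 0"
    then obtain j where j: "(1/2::real)^j < e"
      using real_arch_pow_inv[of e "1/2"] by auto
    have "l2norm (\<lambda>t. X n t - f t) < e" if "n \<ge> M j" for n
    proof -
      have "2*pi*(l2norm (\<lambda>t. X n t - f t))\<^sup>2 \<le> 2*pi*((1/2)^j)\<^sup>2"
        using est[OF that] df[OF that] by (simp add: nn_integral_l2norm)
      then have "(l2norm (\<lambda>t. X n t - f t))\<^sup>2 \<le> ((1/2)^j)\<^sup>2" by simp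
      then have "l2norm (\<lambda>t. X n t - f t) \<le> (1/2)^j"
        by (rule power2_le_imp_le) auto
      with j show ?thesis by simp
    qed
    then show "\<exists>no. \<forall>n\<ge>no. norm (l2norm (\<lambda>t. X n t - f t) - 0) < e" by auto
  qed
  ultimately show ?thesis using that by blast
qed

section \<open>Fourier series\<close>

definition zpow :: "int \<Rightarrow> real \<Rightarrow> complex" where
  "zpow n t = cis (of_int n * t)"

lemma zpow_0 [simp]: "zpow 0 t = 1"
  by (simp add: zpow_def)

lemma norm_zpow [simp]: "cmod (zpow n t) = 1"
  by (simp add: zpow_def)


lemma zpow_add: "zpow (m + n) t = zpow m t * zpow n t"
  by (simp add: zpow_def cis_mult algebra_simps)

lemma zpow_diff: "zpow (m - n) t = zpow m t * cnj (zpow n t)"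
  by (simp add: zpow_def cis_mult cis_cnj algebra_simps)

lemma cnj_zpow: "cnj (zpow n t) = zpow (- n) t"
  by (simp add: zpow_def cis_cnj)

lemma zpow_mult_cnj [simp]: "zpow n t * cnj (zpow n t) = 1" "cnj (zpow n t) * zpow n t = 1"
  by (simp_all add: cnj_zpow flip: zpow_add)

lemma zpow_of_nat: "zpow (int n) t = cis t ^ n"
  by (simp add: zpow_def Complex.DeMoivre)

lemma zpow_1: "zpow 1 t = cis t"
  by (simp add: zpow_def)

lemma measurable_zpow [measurable]: "zpow n \<in> borel_measurable circ"
  unfolding zpow_def[abs_def]
  by (intro measurable_circ_continuous continuous_intros)

lemma L2_zpow [simp]: "L2 (zpow n)"
  by (rule L2_bdd[where M=1]) auto

lemma L2_zpow_mult: "L2 f \<Longrightarrow> L2 (\<lambda>t. zpow n t * f t)"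
  by (rule L2_bdd_mult[where M=1]) auto

lemma fcoeff_eq_inner: "fcoeff f n = l2inner f (zpow n)"
  by (simp add: fcoeff_def l2inner_def cnj_zpow) (simp add: zpow_def)

lemma integral_zpow: "(LINT t|circ. zpow n t) = (if n = 0 then of_real (2*pi) else 0)"
proof (cases "n = 0")
  case True
  then show ?thesis
    by (simp add: measure_restrict_space scaleR_conv_of_real)
next
  case False
  have int: "integrable circ (zpow n)"
    using L2_mult_integrable[OF L2_zpow[of n] L2_const[of 1]] by simp
  define F where "F = (\<lambda>t. zpow n t / (\<i> * of_int n))"
  have "(zpow n has_integral (F (2*pi) - F 0)) {0..2*pi}"
  proof (rule fundamental_theorem_of_calculus)
    fix t :: real
    have "((\<lambda>t. exp (\<i> * of_int n * of_real t)) has_vector_derivative (\<i> * of_int n * exp (\<i> * of_int n * of_real t))) (at t within {0..2*pi})"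
      by (rule has_vector_derivative_real_field) (auto intro!: derivative_eq_intros)
    then have "((\<lambda>t. exp (\<i> * of_int n * of_real t) / (\<i> * of_int n)) has_vector_derivative (\<i> * of_int n * exp (\<i> * of_int n * of_real t)) / (\<i> * of_int n)) (at t within {0..2*pi})"
      by (rule has_vector_derivative_divide)
    moreover have "zpow n t = exp (\<i> * of_int n * of_real t)" for t
      by (simp add: zpow_def cis_conv_exp mult_ac)
    ultimately show "(F has_vector_derivative zpow n t) (at t within {0..2*pi})"
      using False by (simp add: F_def[abs_def])
  qed auto
  moreover have "F (2*pi) = F 0"
  proof -
    have "cis (of_int n * (2*pi)) = 1" unfolding cis_eq_1_iff by blast
    then show ?thesis by (simp add: F_def zpow_def)
  qed
  ultimately have "integral {0..2*pi} (zpow n) = 0"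
    by (auto simp: integral_unique)
  then show ?thesis
    using False int by (simp add: lebesgue_integral_eq_integral)
qed

lemma l2inner_zpow: "l2inner (zpow m) (zpow n) = (if m = n then 1 else 0)"
  by (simp add: l2inner_def integral_zpow flip: zpow_diff)

lemma fcoeff_zpow: "fcoeff (zpow m) n = (if m = n then 1 else 0)"
  by (simp add: fcoeff_eq_inner l2inner_zpow)

lemma fcoeff_add: "L2 f \<Longrightarrow> L2 g \<Longrightarrow> fcoeff (\<lambda>t. f t + g t) n = fcoeff f n + fcoeff g n"
  by (simp add: fcoeff_eq_inner l2inner_add_left)

lemma fcoeff_diff: "L2 f \<Longrightarrow> L2 g \<Longrightarrow> fcoeff (\<lambda>t. f t - g t) n = fcoeff f n - fcoeff g n"
  by (simp add: fcoeff_eq_inner l2inner_diff_left)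

lemma fcoeff_cmult: "fcoeff (\<lambda>t. c * f t) n = c * fcoeff f n"
  by (simp add: fcoeff_eq_inner l2inner_cmult_left)

lemma fcoeff_sum: "(\<And>i. i \<in> I \<Longrightarrow> L2 (f i)) \<Longrightarrow> fcoeff (\<lambda>t. \<Sum>i\<in>I. f i t) n = (\<Sum>i\<in>I. fcoeff (f i) n)"
  by (simp add: fcoeff_eq_inner l2inner_sum_left)

lemma fcoeff_zpow_mult: "fcoeff (\<lambda>t. zpow m t * f t) n = fcoeff f (n - m)"
  by (simp add: fcoeff_eq_inner l2inner_mult_swap cnj_zpow flip: zpow_add)

lemma fcoeff_cnj: "fcoeff (\<lambda>t. cnj (f t)) n = cnj (fcoeff f (- n))"
  by (simp add: fcoeff_eq_inner l2inner_cnj) (simp add: l2inner_def cnj_zpow mult.commute)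

lemma fcoeff_cong_AE: "aeq f g \<Longrightarrow> L2 f \<Longrightarrow> fcoeff f n = fcoeff g n"
  by (simp add: fcoeff_eq_inner l2inner_cong_AE[of f g "zpow n" "zpow n"])

lemma l2norm_zpow [simp]: "l2norm (zpow n) = 1"
proof -
  have "complex_of_real ((l2norm (zpow n))\<^sup>2) = 1"
    unfolding l2inner_self[symmetric] by (simp add: l2inner_zpow)
  then have "(l2norm (zpow n))\<^sup>2 = 1" by (simp only: of_real_eq_1_iff)
  then show ?thesis by (simp add: power2_eq_1_iff) (metis l2norm_nonneg zero_le_one neg_0_le_iff_le not_one_le_zero)
qed

lemma l2norm_zpow_mult: "L2 f \<Longrightarrow> l2norm (\<lambda>t. zpow n t * f t) = l2norm f"
  by (rule l2norm_unimodular_mult) auto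

lemma cmod_fcoeff_le: "L2 f \<Longrightarrow> cmod (fcoeff f n) \<le> l2norm f"
  using l2_Cauchy_Schwarz[of f "zpow n"] by (simp add: fcoeff_eq_inner)

lemma l2norm_trig_sum:
  assumes "finite F" shows "(l2norm (\<lambda>t. \<Sum>k\<in>F. c k * zpow k t))\<^sup>2 = (\<Sum>k\<in>F. (cmod (c k))\<^sup>2)"
proof -
  have "complex_of_real ((l2norm (\<lambda>t. \<Sum>k\<in>F. c k * zpow k t))\<^sup>2)
      = l2inner (\<lambda>t. \<Sum>k\<in>F. c k * zpow k t) (\<lambda>t. \<Sum>k\<in>F. c k * zpow k t)"
    by (simp only: l2inner_self)
  also have "\<dots> = (\<Sum>k\<in>F. \<Sum>l\<in>F. c k * cnj (c l) * (if k = l then 1 else 0))"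
    by (simp add: l2inner_sum_left l2inner_sum_right l2inner_cmult_left l2inner_cmult_right L2_cmult L2_sum
      l2inner_zpow sum_distrib_left mult.assoc)
  also have "\<dots> = (\<Sum>k\<in>F. c k * cnj (c k))"
    using assms by (simp add: sum.delta' if_distrib cong: if_cong)
  also have "\<dots> = of_real (\<Sum>k\<in>F. (cmod (c k))\<^sup>2)"
    by (simp only: of_real_sum complex_norm_square)
  finally show ?thesis by (simp only: of_real_eq_iff)
qed

lemma fcoeff_trig_sum:
  assumes "finite F" shows "fcoeff (\<lambda>t. \<Sum>k\<in>F. c k * zpow k t) n = (if n \<in> F then c n else 0)"
proof -
  have "fcoeff (\<lambda>t. \<Sum>k\<in>F. c k * zpow k t) n = (\<Sum>k\<in>F. c k * (if k = n then 1 else 0))"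
    by (simp add: fcoeff_sum L2_cmult fcoeff_cmult fcoeff_zpow)
  then show ?thesis using assms by (simp add: if_distrib sum.delta cong: if_cong)
qed

text \<open>Pythagoras, since the remainder has no coefficients on \<open>F\<close>. The exact
  defect, not only Bessel's inequality, is used to see that the backward shift is a
  contraction.\<close>

lemma Bessel_decomp:
  assumes "L2 f" "finite F"
  shows "(l2norm f)\<^sup>2 = (l2norm (\<lambda>t. f t - (\<Sum>k\<in>F. fcoeff f k * zpow k t)))\<^sup>2 + (\<Sum>k\<in>F. (cmod (fcoeff f k))\<^sup>2)"
proof -
  let ?s = "\<lambda>t. \<Sum>k\<in>F. fcoeff f k * zpow k t"
  have L: "L2 ?s" by (intro L2_sum L2_cmult L2_zpow)
  have "l2inner (\<lambda>t. f t - ?s t) ?s = (\<Sum>k\<in>F. cnj (fcoeff f k) * fcoeff (\<lambda>t. f t - ?s t) k)"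
    using assms L by (simp add: l2inner_sum_right L2_cmult L2_diff l2inner_cmult_right fcoeff_eq_inner)
  also have "\<dots> = 0"
    using assms L by (intro sum.neutral) (auto simp: fcoeff_diff fcoeff_trig_sum)
  finally have "(l2norm (\<lambda>t. (f t - ?s t) + ?s t))\<^sup>2 = (l2norm (\<lambda>t. f t - ?s t))\<^sup>2 + (l2norm ?s)\<^sup>2"
    using assms L by (subst l2norm_sq_expand) (auto intro: L2_diff)
  then show ?thesis
    using assms by (simp add: l2norm_trig_sum)
qed

lemma Bessel: "L2 f \<Longrightarrow> finite F \<Longrightarrow> (\<Sum>k\<in>F. (cmod (fcoeff f k))\<^sup>2) \<le> (l2norm f)\<^sup>2"
  using Bessel_decomp[of f F] by simp

section \<open>Completeness of the trigonometric system\<close>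

inductive trig :: "(real \<Rightarrow> complex) \<Rightarrow> bool" where
  trig_zpow: "trig (zpow k)"
| trig_cmult: "trig f \<Longrightarrow> trig (\<lambda>t. c * f t)"
| trig_add: "trig f \<Longrightarrow> trig g \<Longrightarrow> trig (\<lambda>t. f t + g t)"

lemma trig_mult_zpow: "trig f \<Longrightarrow> trig (\<lambda>t. zpow k t * f t)"
proof (induction rule: trig.induct)
  case (trig_zpow l)
  then show ?case using trig.trig_zpow[of "k + l"] by (simp add: zpow_add[abs_def])
next
  case (trig_cmult f c)
  then show ?case using trig.trig_cmult[OF trig_cmult.IH, of c] by (simp add: mult_ac)
next
  case (trig_add f g)
  then show ?case using trig.trig_add[OF trig_add.IH] by (simp add: distrib_left)
qed

lemma trig_mult: "trig f \<Longrightarrow> trig g \<Longrightarrow> trig (\<lambda>t. f t * g t)"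
proof (induction rule: trig.induct)
  case (trig_zpow l)
  then show ?case by (rule trig_mult_zpow)
next
  case (trig_cmult f c)
  then show ?case using trig.trig_cmult[of "\<lambda>t. f t * g t" c] by (simp add: mult_ac)
next
  case (trig_add f1 f2)
  then show ?case using trig.trig_add[of "\<lambda>t. f1 t * g t" "\<lambda>t. f2 t * g t"] by (simp add: distrib_right)
qed

lemma trig_L2: "trig f \<Longrightarrow> L2 f"
  by (induction rule: trig.induct) (auto intro: L2_cmult L2_add)

lemma trig_inner_zero: "trig p \<Longrightarrow> L2 u \<Longrightarrow> (\<And>n. fcoeff u n = 0) \<Longrightarrow> l2inner u p = 0"
  by (induction rule: trig.induct)
    (auto simp: fcoeff_eq_inner l2inner_cmult_right l2inner_add_right trig_L2)

text \<open>On the circle, \<open>Re\<close> and \<open>Im\<close> are (z + 1/z)/2 and (z -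
  1/z)/(2i). They lie in the algebra of trigonometric polynomials and separate points, so the real
  Stone--Weierstrass theorem applies.\<close>

lemma circle_Weierstrass:
  assumes "continuous_on (sphere 0 1) (G :: complex \<Rightarrow> real)" "e > 0"
  obtains p where "trig p" "\<And>t. cmod (of_real (G (cis t)) - p t) < e"
proof -
  define P where "P f \<longleftrightarrow> continuous_on (sphere 0 1) f \<and> trig (\<lambda>t. complex_of_real (f (cis t)))" for f :: "complex \<Rightarrow> real"
  have const: "trig (\<lambda>t. c)" for c
    using trig_cmult[OF trig_zpow[of 0], of c] by simp
  have ReP: "P Re"
  proof -
    have "trig (\<lambda>t. (1/2) * (zpow 1 t + zpow (-1) t))"
      by (intro trig.intros)
    moreover have "(1/2) * (zpow 1 t + zpow (-1) t) = complex_of_real (Re (cis t))" for t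
      by (simp add: zpow_def complex_eq_iff)
    ultimately show ?thesis by (simp add: P_def continuous_intros)
  qed
  have ImP: "P Im"
  proof -
    have "trig (\<lambda>t. (-\<i>/2) * (zpow 1 t + (-1) * zpow (-1) t))"
      by (intro trig.intros)
    moreover have "(-\<i>/2) * (zpow 1 t + (-1) * zpow (-1) t) = complex_of_real (Im (cis t))" for t
      by (simp add: zpow_def complex_eq_iff)
    ultimately show ?thesis by (simp add: P_def continuous_intros)
  qed
  have "\<exists>g. P g \<and> (\<forall>x\<in>sphere 0 1. \<bar>G x - g x\<bar> < e)"
  proof (rule Stone_Weierstrass_HOL)
    show "P (\<lambda>x. c)" for c by (simp add: P_def const)
    show "P f \<Longrightarrow> continuous_on (sphere 0 1) f" for f by (simp add: P_def)
    show "P f \<and> P g \<Longrightarrow> P (\<lambda>x. f x + g x)" for f g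
      by (auto simp: P_def intro: continuous_intros trig_add)
    show "P f \<and> P g \<Longrightarrow> P (\<lambda>x. f x * g x)" for f g
      by (auto simp: P_def intro: continuous_intros trig_mult)
    show "\<exists>f. P f \<and> f x \<noteq> f y" if "x \<in> sphere 0 1 \<and> y \<in> sphere 0 1 \<and> x \<noteq> y" for x y
      using that ReP ImP complex_eq_iff by blast
  qed (use assms in auto)
  then obtain g where g: "P g" "\<And>x. cmod x = 1 \<Longrightarrow> \<bar>G x - g x\<bar> < e" by auto
  show ?thesis
  proof (rule that)
    show "trig (\<lambda>t. complex_of_real (g (cis t)))" using g(1) by (simp add: P_def)
    show "cmod (of_real (G (cis t)) - complex_of_real (g (cis t))) < e" for t
      using g(2)[of "cis t"] by (simp flip: of_real_diff)
  qed
qed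

lemma measurable_comp_cis:
  assumes "continuous_on (sphere 0 1) (G :: complex \<Rightarrow> 'a :: topological_space)"
  shows "(\<lambda>t. G (cis t)) \<in> borel_measurable circ"
  by (intro measurable_circ_continuous continuous_on_compose2[OF assms] continuous_intros) auto

lemma l2inner_continuous_zero:
  assumes u: "L2 u" "\<And>n. fcoeff u n = 0" and G: "continuous_on (sphere 0 1) (G :: complex \<Rightarrow> real)"
  shows "l2inner u (\<lambda>t. of_real (G (cis t))) = 0"
proof (rule ccontr)
  let ?G = "\<lambda>t. complex_of_real (G (cis t))"
  obtain B where B: "\<And>z. z \<in> sphere 0 1 \<Longrightarrow> norm (G z) \<le> B"
    using compact_imp_bounded[OF compact_continuous_image[OF G compact_sphere]]
    unfolding bounded_iff by blast
  have LG: "L2 ?G"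
    by (rule L2_bdd[where M=B])
       (use B measurable_compose[OF measurable_comp_cis[OF G] borel_measurable_continuous_onI[of complex_of_real]]
         in \<open>auto intro!: continuous_intros\<close>)
  assume "l2inner u ?G \<noteq> 0"
  then have pos: "cmod (l2inner u ?G) > 0" by simp
  \<comment> \<open>Chosen so that Cauchy--Schwarz bounds the pairing by less than half of itself;
    the \<open>+ 1\<close> keeps the denominator positive.\<close>
  define e where "e = cmod (l2inner u ?G) / (2 * (l2norm u + 1))"
  have e: "e > 0" using pos unfolding e_def by (intro divide_pos_pos) (auto intro: add_nonneg_pos)
  obtain p where p: "trig p" "\<And>t. cmod (?G t - p t) < e"
    using circle_Weierstrass[OF G e] by blast
  have L: "L2 (\<lambda>t. ?G t - p t)" by (intro L2_diff LG trig_L2[OF p(1)])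
  have "(l2norm (\<lambda>t. ?G t - p t))\<^sup>2 \<le> e\<^sup>2"
  proof -
    have "(LINT t|circ. (cmod (?G t - p t))\<^sup>2) \<le> (LINT t|circ. e\<^sup>2)"
      using L p(2) by (intro integral_mono L2_sq_integrable integrable_circ_const power_mono) (auto intro: less_imp_le)
    also have "\<dots> = 2*pi*e\<^sup>2" by (simp add: measure_restrict_space)
    finally show ?thesis by (simp add: l2norm_sq field_simps)
  qed
  then have le: "l2norm (\<lambda>t. ?G t - p t) \<le> e"
    by (rule power2_le_imp_le) (use e in linarith)
  have "l2inner u ?G = l2inner u (\<lambda>t. ?G t - p t)"
    using l2inner_diff_right[OF LG trig_L2[OF p(1)] u(1)] trig_inner_zero[OF p(1) u] by simp
  then have "cmod (l2inner u ?G) \<le> l2norm u * e"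
    using l2_Cauchy_Schwarz[OF u(1) L] le by (metis l2norm_nonneg mult_left_mono order_trans)
  also have "\<dots> < (l2norm u + 1) * e" using e by (simp add: distrib_right)
  also have "\<dots> = cmod (l2inner u ?G) / 2"
  proof -
    have "l2norm u + 1 \<noteq> 0" using l2norm_nonneg[of u] by linarith
    then show ?thesis unfolding e_def by (simp add: divide_simps del: distrib_left_numeral)
  qed
  finally show False using pos by simp
qed

text \<open>The indicator of \<open>K\<close> is a limit of continuous functions on the circle. The
  end points are excluded because \<open>cis\<close> sends both to 1; on the open interval it is
  injective, so points outside \<open>K\<close> stay outside the image of \<open>K\<close>.\<close>

lemma integral_compact_zero:
  assumes u: "L2 u" "\<And>n. fcoeff u n = 0" and K: "compact K" "K \<subseteq> {0<..<2*pi}"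
  shows "(LINT t|circ. u t * indicator K t) = 0"
proof (cases "K = {}")
  case False
  define C where "C = cis ` K"
  have C: "closed C" "C \<noteq> {}"
    using K False unfolding C_def by (auto intro!: compact_imp_closed compact_continuous_image continuous_intros)
  \<comment> \<open>Equal to 1 on the closed set \<open>C\<close>, and eventually 0 at each point
    off \<open>C\<close>.\<close>
  define G where "G = (\<lambda>m z. max 0 (1 - real m * infdist z C))"
  have "(\<lambda>m. LINT t|circ. u t * of_real (G m (cis t))) \<longlonglongrightarrow> (LINT t|circ. u t * indicator K t)"
  proof (rule integral_dominated_convergence)
    have [measurable]: "u \<in> borel_measurable circ"
      using u by (intro L2_measurable)
    have Km: "K \<in> sets lebesgue" using K(1) by (simp add: borel_compact lmeasurable_compact fmeasurableD)
    then have "K \<in> sets circ"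
      using K(2) by (subst sets_restrict_space_iff) auto
    then show "(\<lambda>t. u t * indicator K t) \<in> borel_measurable circ" by measurable
    have cG: "continuous_on (sphere 0 1) (\<lambda>z. complex_of_real (G m z))" for m
      unfolding G_def by (intro continuous_intros)
    then show "(\<lambda>t. u t * of_real (G m (cis t))) \<in> borel_measurable circ" for m
      using measurable_comp_cis[OF cG[of m]] by measurable
    show "integrable circ (\<lambda>t. cmod (u t))"
      using integrable_norm[OF L2_mult_integrable[OF u(1) L2_const[of 1]]] by simp
    show "AE t in circ. cmod (u t * of_real (G m (cis t))) \<le> cmod (u t)" for m
      by (auto simp: norm_mult G_def infdist_nonneg intro!: mult_left_le)
    have ae: "AE t in circ. t \<noteq> 0 \<and> t \<noteq> 2*pi"
    proof -
      have "AE t in lebesgue. t \<notin> {0, 2*pi}"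
        by (intro AE_not_in) (simp add: negligible_finite flip: negligible_iff_null_sets)
      then have "AE t in lebesgue. t \<in> {0..2*pi} \<longrightarrow> t \<noteq> 0 \<and> t \<noteq> 2*pi"
        by eventually_elim auto
      then show ?thesis by (subst AE_restrict_space_iff) auto
    qed
    then show "AE t in circ. (\<lambda>m. u t * of_real (G m (cis t))) \<longlonglongrightarrow> u t * indicator K t"
      using AE_space
    proof eventually_elim
      case (elim t)
      then have t: "t \<in> {0<..<2*pi}" by (auto simp: space_restrict_space)
      have "(\<lambda>m. G m (cis t)) \<longlonglongrightarrow> indicator K t"
      proof (cases "t \<in> K")
        case True
        then have "infdist (cis t) C = 0" by (simp add: C_def)
        then show ?thesis using True by (simp add: G_def)
      next
        case False
        have "cis t \<notin> C"
        proof
          assume "cis t \<in> C"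
          then obtain s where s: "s \<in> K" "cis t = cis s" unfolding C_def by auto
          then have "cis (t - s) = 1" by (simp flip: cis_divide)
          then obtain n :: int where n: "t - s = of_int n * (2 * pi)"
            unfolding cis_eq_1_iff by blast
          have "\<bar>t - s\<bar> < 2 * pi" using t s(1) K(2) by (auto simp: abs_less_iff)
          then have "\<bar>real_of_int n\<bar> < 1" unfolding n by (simp add: abs_mult)
          then have "n = 0" by linarith
          then show False using n s False by auto
        qed
        then have pos: "infdist (cis t) C > 0"
          using C in_closed_iff_infdist_zero infdist_nonneg by (metis less_le)
        have "eventually (\<lambda>m. G m (cis t) = 0) sequentially"
        proof -
          obtain N where N: "1 / infdist (cis t) C < real N" using reals_Archimedean2 by blast
          show ?thesis
            using eventually_ge_at_top[of N]
          proof eventually_elim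
            case (elim m)
            then have "1 / infdist (cis t) C \<le> real m" using N by linarith
            then show ?case using pos by (simp add: G_def field_simps)
          qed
        qed
        then show ?thesis using False by (simp add: tendsto_eventually)
      qed
      then have "(\<lambda>m. complex_of_real (G m (cis t))) \<longlonglongrightarrow> complex_of_real (indicator K t)"
        by (rule tendsto_of_real)
      then show ?case
        by (intro tendsto_mult tendsto_const) (simp add: of_real_indicator)
    qed
  qed
  moreover have "(LINT t|circ. u t * of_real (G m (cis t))) = 0" for m
  proof -
    have "continuous_on (sphere 0 1) (G m)"
      unfolding G_def by (intro continuous_intros)
    from l2inner_continuous_zero[OF u this] show ?thesis
      by (simp add: l2inner_def)
  qed
  ultimately show ?thesis
    by (simp add: LIMSEQ_const_iff)
qed simp

text \<open>By inner regularity, a compact subset \<open>T\<close> fills the set where the real part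
  is positive up to measure \<open>e\<close>. The integral of \<open>u\<close> over \<open>T\<close>
  vanishes while its real part is positive there, so \<open>T\<close> is null and the whole set has
  measure at most \<open>e\<close>.\<close>

lemma fcoeff_zero_AE_Re:
  assumes u: "L2 u" "\<And>n. fcoeff u n = 0"
  shows "AE t in circ. Re (u t) \<le> 0"
proof -
  have um [measurable]: "u \<in> borel_measurable circ" using u by (intro L2_measurable)
  define E where "E = {t \<in> {0<..<2*pi}. Re (u t) > 0}"
  have E: "E \<in> sets lebesgue"
  proof -
    have "{t \<in> space circ. Re (u t) > 0} \<in> sets circ" by measurable
    then have "{t \<in> space circ. Re (u t) > 0} \<in> sets lebesgue"
      by (subst (asm) sets_restrict_space_iff) auto
    then have "{0<..<2*pi} \<inter> {t \<in> space circ. Re (u t) > 0} \<in> sets lebesgue" by auto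
    moreover have "E = {0<..<2*pi} \<inter> {t \<in> space circ. Re (u t) > 0}"
      by (auto simp: E_def space_restrict_space)
    ultimately show ?thesis by metis
  qed
  have small: "emeasure lebesgue E \<le> ennreal e" if e: "e > 0" for e
  proof -
    obtain T where T: "closed T" "T \<subseteq> E" "E - T \<in> lmeasurable" "emeasure lebesgue (E - T) < ennreal e"
      by (rule sets_lebesgue_inner_closed[OF E e])
    have T': "T \<subseteq> {0<..<2*pi}" using T(2) by (auto simp: E_def)
    have "T \<subseteq> {0..2*pi}" using T' by force
    then have "bounded T" by (rule bounded_subset[OF bounded_closed_interval])
    with T(1) have "compact T" by (simp add: compact_eq_bounded_closed)
    from integral_compact_zero[OF u this T'] have z: "(LINT t|circ. u t * indicator T t) = 0" .
    have Tm: "T \<in> sets lebesgue" using \<open>closed T\<close> by (simp add: borel_closed)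
    have Tc [measurable]: "T \<in> sets circ"
      using Tm T' by (subst sets_restrict_space_iff) auto
    have int: "integrable circ (\<lambda>t. u t * indicator T t)"
    proof (rule L2_mult_integrable[OF u(1)], rule L2_bdd[where M = 1])
      show "indicator T \<in> borel_measurable circ" by measurable
    qed (auto simp: indicator_def)
    have "(LINT t|circ. Re (u t * indicator T t)) = 0"
      using z int by (metis integral_Re zero_complex.sel(1))
    moreover have "0 \<le> Re (u t * indicator T t)" for t
      using T(2) by (auto simp: indicator_def E_def)
    ultimately have "AE t in circ. Re (u t * indicator T t) = 0"
      using integral_nonneg_eq_0_iff_AE[OF integrable_Re[OF int]] by simp
    then have "AE t in circ. t \<notin> T"
      by eventually_elim (use T(2) in \<open>auto simp: indicator_def E_def split: if_splits\<close>)
    then have "AE t in lebesgue. t \<notin> T"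
      using T' by (subst (asm) AE_restrict_space_iff) (auto elim!: eventually_mono)
    then have "emeasure lebesgue T = 0"
      using AE_iff_null_sets[OF Tm] null_setsD1 by blast
    have "(E - T) \<union> T = E" using T(2) by blast
    then have "emeasure lebesgue E \<le> emeasure lebesgue (E - T) + emeasure lebesgue T"
      using emeasure_subadditive[of "E - T" lebesgue T] sets.Diff[OF E Tm] Tm by metis
    then have "emeasure lebesgue E \<le> emeasure lebesgue (E - T)"
      unfolding \<open>emeasure lebesgue T = 0\<close> by (metis add_0_right)
    then show ?thesis using T(4) by (metis order_trans less_imp_le)
  qed
  have "emeasure lebesgue E \<le> 0"
  proof (rule ennreal_le_epsilon)
    fix e :: real assume "0 < e"
    from small[OF this] show "emeasure lebesgue E \<le> 0 + ennreal e" by (simp only: add_0)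
  qed
  then have "emeasure lebesgue E = 0" by (simp only: le_zero_eq)
  then have "AE t in lebesgue. t \<notin> E"
    using AE_iff_null_sets[OF E] null_setsI[OF _ E] by blast
  moreover have "AE t in lebesgue. t \<notin> {0, 2*pi}"
    by (intro AE_not_in) (simp add: negligible_finite flip: negligible_iff_null_sets)
  ultimately have "AE t in lebesgue. t \<in> {0..2*pi} \<longrightarrow> Re (u t) \<le> 0"
    by eventually_elim (auto simp: E_def)
  then show ?thesis by (subst AE_restrict_space_iff) auto
qed

lemma fcoeff_zero_imp_zero:
  assumes u: "L2 u" "\<And>n. fcoeff u n = 0"
  shows "aeq u (\<lambda>t. 0)"
proof -
  \<comment> \<open>The hypothesis survives multiplication by constants, so the one-sided bound
    holds in the four directions 1, -1, i, -i, which together force u = 0.\<close>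
  have "AE t in circ. Re (c * u t) \<le> 0" for c
    by (rule fcoeff_zero_AE_Re) (use u in \<open>auto simp: L2_cmult fcoeff_cmult\<close>)
  from this[of 1] this[of "-1"] this[of \<i>] this[of "-\<i>"] show ?thesis
    unfolding aeq_def by eventually_elim (auto simp: complex_eq_iff)
qed

lemma fcoeff_eq_imp_aeq:
  assumes "L2 f" "L2 g" "\<And>n. fcoeff f n = fcoeff g n" shows "aeq f g"
proof -
  have "aeq (\<lambda>t. f t - g t) (\<lambda>t. 0)"
    by (rule fcoeff_zero_imp_zero) (use assms in \<open>auto simp: L2_diff fcoeff_diff\<close>)
  then show ?thesis unfolding aeq_def by eventually_elim auto
qed

text \<open>The squared distance of two symmetric partial sums is a difference of the bounded
  increasing sums \<open>S\<close>, so they form a Cauchy sequence. The Riesz projection and the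
  representing vectors of functionals are built from this.\<close>

lemma Riesz_Fischer:
  assumes c: "\<And>F. finite F \<Longrightarrow> (\<Sum>k\<in>F. (cmod (c k))\<^sup>2) \<le> M"
  obtains g where "L2 g" "\<And>n. fcoeff g n = c n"
    "(\<lambda>N. l2norm (\<lambda>t. (\<Sum>k\<in>{-int N..int N}. c k * zpow k t) - g t)) \<longlonglongrightarrow> 0"
proof -
  define X where "X = (\<lambda>N t. \<Sum>k\<in>{-int N..int N}. c k * zpow k t)"
  define S where "S = (\<lambda>N. \<Sum>k\<in>{-int N..int N}. (cmod (c k))\<^sup>2)"
  have X: "L2 (X N)" for N unfolding X_def by (intro L2_sum L2_cmult L2_zpow)
  have S: "incseq S"
    unfolding S_def by (intro monoI sum_mono2) auto
  have "convergent S"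
  proof (rule Bseq_mono_convergent)
    show "Bseq S"
      by (rule BseqI'[where K=M]) (use c in \<open>auto simp: S_def sum_nonneg\<close>)
  qed (use S in \<open>auto simp: incseq_def\<close>)
  then have Cau: "Cauchy S" by (simp add: Cauchy_convergent_iff)
  have dist: "(l2norm (\<lambda>t. X m t - X n t))\<^sup>2 = S m - S n" if "n \<le> m" for m n
  proof -
    have sub: "{-int n..int n} \<subseteq> {-int m..int m}" using that by auto
    have "X m t - X n t = (\<Sum>k\<in>{-int m..int m} - {-int n..int n}. c k * zpow k t)" for t
      unfolding X_def using sub by (simp add: sum_diff)
    then have "(l2norm (\<lambda>t. X m t - X n t))\<^sup>2 = (\<Sum>k\<in>{-int m..int m} - {-int n..int n}. (cmod (c k))\<^sup>2)"
      by (simp add: l2norm_trig_sum)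
    also have "\<dots> = S m - S n"
      unfolding S_def using sub by (simp add: sum_diff)
    finally show ?thesis .
  qed
  have dist': "(l2norm (\<lambda>t. X m t - X n t))\<^sup>2 = \<bar>S m - S n\<bar>" for m n
  proof (cases "n \<le> m")
    case True
    then show ?thesis using dist[OF True] S by (auto simp: incseq_def)
  next
    case False
    then show ?thesis using dist[of m n] S l2norm_minus_commute[of "X m" "X n"] by (auto simp: incseq_def)
  qed
  obtain g where g: "L2 g" "(\<lambda>N. l2norm (\<lambda>t. X N t - g t)) \<longlonglongrightarrow> 0"
  proof (rule L2_complete[OF X])
    fix e :: real assume "e > 0"
    then obtain N where N: "\<And>m n. m \<ge> N \<Longrightarrow> n \<ge> N \<Longrightarrow> dist (S m) (S n) < e\<^sup>2"
      using Cau unfolding Cauchy_def by (metis zero_less_power)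
    have "l2norm (\<lambda>t. X m t - X n t) < e" if "m \<ge> N" "n \<ge> N" for m n
    proof (rule power2_less_imp_less)
      show "(l2norm (\<lambda>t. X m t - X n t))\<^sup>2 < e\<^sup>2"
        using N[OF that] unfolding dist' dist_real_def .
    qed (use \<open>e > 0\<close> in linarith)
    then show "\<exists>M. \<forall>m\<ge>M. \<forall>n\<ge>M. l2norm (\<lambda>t. X m t - X n t) < e" by blast
  qed blast
  have "fcoeff g n = c n" for n
  proof (rule LIMSEQ_unique)
    show "(\<lambda>N. fcoeff (X N) n) \<longlonglongrightarrow> fcoeff g n"
      unfolding fcoeff_eq_inner by (intro tendsto_l2inner_left X g L2_zpow)
    have "\<forall>\<^sub>F N in sequentially. fcoeff (X N) n = c n"
      using eventually_ge_at_top[of "nat \<bar>n\<bar>"]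
      by eventually_elim (auto simp: X_def fcoeff_trig_sum)
    then show "(\<lambda>N. fcoeff (X N) n) \<longlonglongrightarrow> c n" by (rule tendsto_eventually)
  qed
  with g that show ?thesis unfolding X_def by blast
qed

text \<open>The series converges to some function by \<open>Riesz_Fischer\<close>; that function has
  the coefficients of f, hence equals f by uniqueness.\<close>

lemma fourier_L2_tendsto:
  assumes "L2 f"
  shows "(\<lambda>N. l2norm (\<lambda>t. (\<Sum>k\<in>{-int N..int N}. fcoeff f k * zpow k t) - f t)) \<longlonglongrightarrow> 0"
proof -
  obtain g where g: "L2 g" "\<And>n. fcoeff g n = fcoeff f n"
    "(\<lambda>N. l2norm (\<lambda>t. (\<Sum>k\<in>{-int N..int N}. fcoeff f k * zpow k t) - g t)) \<longlonglongrightarrow> 0"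
    by (rule Riesz_Fischer[OF Bessel[OF assms]]) blast+
  have ae: "aeq g f" using fcoeff_eq_imp_aeq g assms by blast
  have "l2norm (\<lambda>t. (\<Sum>k\<in>{-int N..int N}. fcoeff f k * zpow k t) - g t)
      = l2norm (\<lambda>t. (\<Sum>k\<in>{-int N..int N}. fcoeff f k * zpow k t) - f t)" for N
    by (rule l2norm_cong_AE) (use ae g in \<open>auto simp: aeq_def intro!: L2_diff L2_sum L2_cmult elim!: eventually_mono\<close>)
  with g(3) show ?thesis by simp
qed

lemma l2inner_disjoint_coeffs:
  assumes "L2 f" "L2 g" "\<And>n. fcoeff f n = 0 \<or> fcoeff g n = 0"
  shows "l2inner f g = 0"
proof -
  let ?X = "\<lambda>N t. \<Sum>k\<in>{-int N..int N}. fcoeff f k * zpow k t"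
  have "(\<lambda>N. l2inner (?X N) g) \<longlonglongrightarrow> l2inner f g"
    by (intro tendsto_l2inner_left fourier_L2_tendsto assms L2_sum L2_cmult L2_zpow)
  moreover have "l2inner (?X N) g = 0" for N
  proof -
    have "l2inner (?X N) g = (\<Sum>k\<in>{-int N..int N}. fcoeff f k * cnj (fcoeff g k))"
      using assms by (simp add: l2inner_sum_left L2_cmult l2inner_cmult_left fcoeff_eq_inner l2inner_cnj)
    also have "\<dots> = 0" using assms(3) by (intro sum.neutral) auto
    finally show ?thesis .
  qed
  ultimately show ?thesis by (simp add: LIMSEQ_const_iff)
qed

section \<open>The Hardy space\<close>

lemma H2_L2: "f \<in> H2 \<Longrightarrow> L2 f"
  by (simp add: H2_def)

lemma H2_add: "f \<in> H2 \<Longrightarrow> g \<in> H2 \<Longrightarrow> (\<lambda>t. f t + g t) \<in> H2"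
  by (simp add: H2_def L2_add fcoeff_add)

lemma H2_diff: "f \<in> H2 \<Longrightarrow> g \<in> H2 \<Longrightarrow> (\<lambda>t. f t - g t) \<in> H2"
  by (simp add: H2_def L2_diff fcoeff_diff)

lemma H2_cmult: "f \<in> H2 \<Longrightarrow> (\<lambda>t. c * f t) \<in> H2"
  by (simp add: H2_def L2_cmult fcoeff_cmult)

lemma H2_zero: "(\<lambda>t. 0) \<in> H2"
  using H2_cmult[of "zpow 0" 0] by (simp add: H2_def L2_const fcoeff_eq_inner)

lemma H2_sum: "(\<And>i. i \<in> I \<Longrightarrow> f i \<in> H2) \<Longrightarrow> (\<lambda>t. \<Sum>i\<in>I. f i t) \<in> H2"
  by (induction I rule: infinite_finite_induct) (auto intro: H2_add H2_zero)

lemma H2_zpow: "n \<ge> 0 \<Longrightarrow> zpow n \<in> H2"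
  by (simp add: H2_def fcoeff_zpow)

lemma H2_zpow_mult: "n \<ge> 0 \<Longrightarrow> f \<in> H2 \<Longrightarrow> (\<lambda>t. zpow n t * f t) \<in> H2"
  by (simp add: H2_def L2_zpow_mult fcoeff_zpow_mult)

lemma H2_inner_zero:
  assumes "f \<in> H2" "L2 g" "\<And>n. n \<ge> 0 \<Longrightarrow> fcoeff g n = 0"
  shows "l2inner f g = 0" "l2inner g f = 0"
proof -
  show "l2inner f g = 0"
    by (rule l2inner_disjoint_coeffs) (use assms in \<open>auto simp: H2_def not_less\<close>, meson not_le)
  then show "l2inner g f = 0" by (metis l2inner_cnj complex_cnj_zero)
qed

definition hsum :: "(real \<Rightarrow> complex) \<Rightarrow> nat \<Rightarrow> real \<Rightarrow> complex" where
  "hsum f N t = (\<Sum>k<N. fcoeff f (int k) * zpow (int k) t)"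

lemma H2_hsum: "hsum f N \<in> H2"
  unfolding hsum_def[abs_def] by (intro H2_sum H2_cmult H2_zpow) auto

lemma hsum_L2_tendsto:
  assumes "f \<in> H2"
  shows "(\<lambda>N. l2norm (\<lambda>t. hsum f N t - f t)) \<longlonglongrightarrow> 0"
proof -
  have "(\<Sum>k\<in>{-int N..int N}. fcoeff f k * zpow k t) = hsum f (Suc N) t" for N t
  proof -
    have "(\<Sum>k\<in>{-int N..int N}. fcoeff f k * zpow k t) = (\<Sum>k\<in>int ` {..<Suc N}. fcoeff f k * zpow k t)"
    proof (rule sum.mono_neutral_right)
      show "\<forall>i\<in>{-int N..int N} - int ` {..<Suc N}. fcoeff f i * zpow i t = 0"
      proof
        fix i assume i: "i \<in> {-int N..int N} - int ` {..<Suc N}"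
        have "i < 0"
        proof (rule ccontr)
          assume "\<not> i < 0"
          then have "i = int (nat i)" "nat i < Suc N" using i by auto
          then show False using i by blast
        qed
        then show "fcoeff f i * zpow i t = 0" using assms by (simp add: H2_def)
      qed
    qed auto
    also have "\<dots> = hsum f (Suc N) t"
      unfolding hsum_def by (subst sum.reindex) auto
    finally show ?thesis .
  qed
  then have "(\<lambda>N. l2norm (\<lambda>t. hsum f (Suc N) t - f t)) \<longlonglongrightarrow> 0"
    using fourier_L2_tendsto[OF H2_L2[OF assms]] by simp
  then show ?thesis by (rule LIMSEQ_imp_Suc)
qed

text \<open>Drop the negative coefficients and rebuild the function by \<open>Riesz_Fischer\<close>;
  what was removed is orthogonal to \<open>H2\<close>.\<close>

lemma Riesz_projection:
  assumes "L2 f"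
  obtains g where "g \<in> H2" "\<And>h. h \<in> H2 \<Longrightarrow> l2inner g h = l2inner f h"
proof -
  have *: "(\<Sum>k\<in>F. (cmod (if k < 0 then 0 else fcoeff f k))\<^sup>2) \<le> (l2norm f)\<^sup>2" if "finite F" for F
    by (rule order_trans[OF sum_mono Bessel[OF assms that]]) auto
  obtain g where g: "L2 g" "\<And>n. fcoeff g n = (if n < 0 then 0 else fcoeff f n)"
    by (rule Riesz_Fischer[OF *]) blast+
  have "l2inner g h = l2inner f h" if "h \<in> H2" for h
  proof -
    have "l2inner (\<lambda>t. g t - f t) h = 0"
      using that g assms by (intro H2_inner_zero) (auto simp: L2_diff fcoeff_diff)
    then show ?thesis using that g assms by (simp add: l2inner_diff_left H2_L2)
  qed
  moreover have "g \<in> H2" using g by (simp add: H2_def)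
  ultimately show ?thesis using that by blast
qed

section \<open>The radial maximal inequality\<close>

definition poisson :: "real \<Rightarrow> real \<Rightarrow> real" where
  "poisson r x = (1 - r\<^sup>2) / (1 - 2 * r * cos x + r\<^sup>2)"

lemma cmod_one_minus_cis: "(cmod (1 - of_real r * cis x))\<^sup>2 = 1 - 2 * r * cos x + r\<^sup>2"
proof -
  have "(cmod (1 - of_real r * cis x))\<^sup>2 = (1 - r * cos x)\<^sup>2 + (r * sin x)\<^sup>2"
    by (simp add: cmod_power2)
  also have "\<dots> = 1 - 2 * r * cos x + r\<^sup>2 * ((cos x)\<^sup>2 + (sin x)\<^sup>2)"
    by algebra
  finally show ?thesis by simp
qed

lemma poisson_eq: "poisson r x = (1 - r\<^sup>2) / (cmod (1 - of_real r * cis x))\<^sup>2"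
  by (simp add: poisson_def cmod_one_minus_cis)

lemma cmod_one_minus_ge:
  assumes "0 \<le> r" shows "1 - r \<le> cmod (1 - of_real r * cis x)"
  using norm_triangle_ineq2[of 1 "of_real r * cis x"] assms by (simp add: norm_mult)

lemma one_minus_nz: assumes "0 \<le> r" "r < 1" shows "1 - complex_of_real r * cis x \<noteq> 0"
  using cmod_one_minus_ge[OF assms(1), of x] assms by auto

lemma poisson_nonneg: "0 \<le> r \<Longrightarrow> r < 1 \<Longrightarrow> 0 \<le> poisson r x"
  unfolding poisson_eq by (intro divide_nonneg_nonneg) (auto simp: power_le_one)

lemma poisson_minus: "poisson r (- x) = poisson r x"
  by (simp add: poisson_def)

lemma poisson_commute: "poisson r (s - t) = poisson r (t - s)"
  using poisson_minus[of r "t - s"] by simp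

lemma poisson_le:
  assumes "0 \<le> r" "r \<le> R" "R < 1" shows "poisson r x \<le> 1 / (1 - R)\<^sup>2"
  unfolding poisson_eq
proof (rule frac_le)
  have "1 - R \<le> cmod (1 - of_real r * cis x)"
    using cmod_one_minus_ge[OF assms(1), of x] assms by linarith
  then show "(1 - R)\<^sup>2 \<le> (cmod (1 - of_real r * cis x))\<^sup>2"
    using assms by (intro power_mono) auto
qed (use assms in auto)

text \<open>Passing from rs to r moves the denominator by r - rs, at most 1 - rs and so at most
  \<open>a\<close>: hence \<open>b\<close> is at most 2 \<open>a\<close>, which costs a factor 4. As
  rs is at least r^2, the numerator is at most 1 - r^4, hence at most 2 (1 - r^2). Together this is
  the 8.\<close>

lemma poisson_mult_le_aux:
  assumes "0 \<le> r" "r \<le> s" "s < 1" shows "poisson (r * s) x \<le> 8 * poisson r x"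
proof -
  define a where "a = cmod (1 - of_real (r * s) * cis x)"
  define b where "b = cmod (1 - of_real r * cis x)"
  have rs: "0 \<le> r * s" "r * s \<le> r" "r * s < 1" "r\<^sup>2 \<le> r * s"
    using assms mult_left_mono[of s 1 r] mult_left_mono[of r s r] by (auto simp: power2_eq_square)
  have a: "1 - r * s \<le> a" unfolding a_def by (rule cmod_one_minus_ge) (use rs in auto)
  have "1 - of_real r * cis x = (1 - of_real (r * s) * cis x) - of_real (r - r * s) * cis x"
    by (simp add: algebra_simps)
  then have "b \<le> a + cmod (of_real (r - r * s) * cis x)"
    unfolding a_def b_def by (metis norm_triangle_ineq4)
  also have "cmod (of_real (r - r * s) * cis x) = r - r * s"
    using rs by (simp add: norm_mult del: of_real_diff of_real_mult)
  finally have b: "b \<le> 2 * a" using a assms rs by linarith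
  have bpos: "b > 0" unfolding b_def using one_minus_nz[of r x] assms by simp
  have num: "1 - (r * s)\<^sup>2 \<le> 2 * (1 - r\<^sup>2)"
  proof -
    have r2: "r\<^sup>2 \<le> 1" using assms by (auto simp: power_le_one)
    have "(r\<^sup>2)\<^sup>2 \<le> (r * s)\<^sup>2" using rs by (intro power_mono) auto
    then have "1 - (r * s)\<^sup>2 \<le> 1 - (r\<^sup>2)\<^sup>2" by simp
    also have "\<dots> = (1 + r\<^sup>2) * (1 - r\<^sup>2)" by (simp add: power2_eq_square algebra_simps)
    also have "\<dots> \<le> 2 * (1 - r\<^sup>2)" using r2 by (intro mult_right_mono) auto
    finally show ?thesis .
  qed
  have b2: "b\<^sup>2 \<le> 4 * a\<^sup>2" using power_mono[OF b, of 2] bpos by (simp add: power_mult_distrib)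
  have apos: "a > 0" using a rs by linarith
  have "poisson (r * s) x = (1 - (r * s)\<^sup>2) / a\<^sup>2" by (simp add: poisson_eq a_def)
  also have "\<dots> \<le> (2 * (1 - r\<^sup>2)) / a\<^sup>2" using num apos by (intro divide_right_mono) auto
  also have "\<dots> \<le> (2 * (1 - r\<^sup>2)) / (b\<^sup>2 / 4)"
    using b2 bpos apos assms by (intro divide_left_mono mult_pos_pos) (auto simp: power_le_one)
  also have "\<dots> = 8 * poisson r x" by (simp add: poisson_eq b_def)
  finally show ?thesis .
qed

lemma poisson_mult_le:
  assumes "0 \<le> r" "r < 1" "0 \<le> s" "s < 1"
  shows "poisson (r * s) x \<le> 8 * (poisson r x + poisson s x)"
proof (cases "r \<le> s")
  case True
  then show ?thesis using poisson_mult_le_aux[OF assms(1) True assms(4), of x] poisson_nonneg[OF assms(3,4), of x] by simp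
next
  case False
  then show ?thesis using poisson_mult_le_aux[of s r x] poisson_nonneg[OF assms(1,2), of x] assms by (simp add: mult.commute)
qed

text \<open>Splits the kernel into an analytic part, its conjugate and a constant. Each part is a
  geometric series, which is how all integrals against the kernel are evaluated.\<close>

lemma poisson_szego:
  assumes "0 \<le> r" "r < 1"
  shows "complex_of_real (poisson r x) = 1 / (1 - of_real r * cis x) + cnj (1 / (1 - of_real r * cis x)) - 1"
proof -
  define w where "w = complex_of_real r * cis x"
  have nz: "1 - w \<noteq> 0" "1 - cnj w \<noteq> 0"
    using one_minus_nz[OF assms, of x] unfolding w_def[symmetric]
    by (auto simp: complex_eq_iff)
  have ww: "w * cnj w = of_real (r\<^sup>2)"
    using complex_norm_square[of w] assms by (simp add: w_def norm_mult power2_eq_square)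
  have "complex_of_real (poisson r x) = (1 - w * cnj w) / ((1 - w) * (1 - cnj w))"
    unfolding poisson_eq w_def[symmetric] of_real_divide complex_norm_square ww by simp
  also have "\<dots> = 1 / (1 - w) + 1 / (1 - cnj w) - 1"
  proof -
    have "(1 - (1 - x) * (1 - y)) / (x * y) = 1 / x + 1 / y - 1" if "x \<noteq> 0" "y \<noteq> 0" for x y :: complex
      using that by (simp add: field_simps)
    from this[OF nz] show ?thesis by simp
  qed
  finally show ?thesis by (simp add: w_def)
qed

lemma continuous_szego:
  assumes "0 \<le> r" "r < 1"
  shows "continuous_on UNIV (\<lambda>s. 1 / (1 - complex_of_real r * cis (t - s)))"
  by (intro continuous_intros) (use one_minus_nz[OF assms] in auto)

lemma cmod_szego_le:
  assumes "0 \<le> r" "r < 1" shows "cmod (1 / (1 - complex_of_real r * cis x)) \<le> 1 / (1 - r)"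
  unfolding norm_divide using cmod_one_minus_ge[OF assms(1), of x] assms
  by (intro frac_le) auto

text \<open>Cauchy's formula on the boundary, by integrating the geometric series term by term. For
  a general L2 function only the nonnegative frequencies survive.\<close>

lemma szego_integral:
  assumes f: "L2 f" and r: "0 \<le> r" "r < 1"
  shows "(\<lambda>n. fcoeff f (int n) * (of_real r * cis t) ^ n) sums
    ((LINT s|circ. f s * (1 / (1 - of_real r * cis (t - s)))) / of_real (2*pi))"
proof -
  define w where "w = (\<lambda>s. complex_of_real r * cis (t - s))"
  have w: "cmod (w s) = r" for s using r by (simp add: w_def norm_mult)
  have If: "integrable circ (\<lambda>s. cmod (f s))"
    using integrable_norm[OF L2_mult_integrable[OF f L2_const[of 1]]] by simp
  have wn: "f s * w s ^ n = (of_real r * cis t) ^ n * (f s * cnj (zpow (int n) s))" for n s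
  proof -
    have "w s = of_real r * cis t * cnj (cis s)" by (simp add: w_def cis_cnj cis_mult)
    then show ?thesis by (simp add: zpow_of_nat power_mult_distrib mult_ac)
  qed
  have int: "integrable circ (\<lambda>s. f s * w s ^ n)" for n
    unfolding wn by (intro integrable_mult_right L2_inner_integrable f L2_zpow)
  have nrm: "norm (f s * w s ^ n) = r ^ n * cmod (f s)" for s n
    by (simp add: norm_mult norm_power w)
  have "(\<lambda>n. LINT s|circ. f s * w s ^ n) sums (LINT s|circ. (\<Sum>n. f s * w s ^ n))"
  proof (rule sums_integral[OF int])
    show "AE s in circ. summable (\<lambda>n. norm (f s * w s ^ n))"
      unfolding nrm using r by (auto intro!: summable_mult2 summable_geometric)
    show "summable (\<lambda>n. LINT s|circ. norm (f s * w s ^ n))"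
      unfolding nrm using r by (auto intro!: summable_mult2 summable_geometric)
  qed
  moreover have "(\<Sum>n. f s * w s ^ n) = f s * (1 / (1 - w s))" for s
    using sums_unique[OF sums_mult[OF geometric_sums[of "w s"], of "f s"]] w[of s] r by simp
  moreover have "(LINT s|circ. f s * w s ^ n) / of_real (2*pi) = fcoeff f (int n) * (of_real r * cis t) ^ n" for n
    unfolding wn by (simp add: fcoeff_eq_inner l2inner_def)
  ultimately show ?thesis
    unfolding w_def using sums_divide[of _ _ "complex_of_real (2*pi)"] by fastforce
qed

definition disc_value :: "(real \<Rightarrow> complex) \<Rightarrow> complex \<Rightarrow> complex" where
  "disc_value f z = (\<Sum>n. fcoeff f (int n) * z ^ n)"

text \<open>In the split of \<open>poisson_szego\<close> the conjugated half sees
  \<open>cnj f\<close>, whose only nonnegative frequency is the constant one; the term - 1 cancels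
  precisely that constant.\<close>

lemma poisson_integral_H2:
  assumes f: "f \<in> H2" and r: "0 \<le> r" "r < 1"
  shows "(LINT s|circ. of_real (poisson r (t - s)) * f s) / of_real (2*pi) = disc_value f (of_real r * cis t)"
proof -
  let ?k = "\<lambda>s. 1 / (1 - complex_of_real r * cis (t - s))"
  have L: "L2 f" using f by (rule H2_L2)
  have k: "L2 ?k"
    by (rule L2_bdd[OF measurable_circ_continuous[OF continuous_szego[OF r]]])
       (use cmod_szego_le[OF r] in auto)
  have "(LINT s|circ. of_real (poisson r (t - s)) * f s)
     = (LINT s|circ. f s * ?k s + f s * cnj (?k s) - f s)"
    unfolding poisson_szego[OF r] by (simp add: algebra_simps)
  also have "\<dots> = (LINT s|circ. f s * ?k s) + (LINT s|circ. f s * cnj (?k s)) - (LINT s|circ. f s)"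
    using L2_mult_integrable[OF L k] L2_inner_integrable[OF L k] L2_mult_integrable[OF L L2_const[of 1]]
    by (subst Bochner_Integration.integral_diff, simp, simp, subst Bochner_Integration.integral_add) auto
  also have "(LINT s|circ. f s * cnj (?k s)) = cnj (LINT s|circ. cnj (f s) * ?k s)"
    by (subst Bochner_Integration.integral_cnj[symmetric]) simp
  finally have eq: "(LINT s|circ. of_real (poisson r (t - s)) * f s) / of_real (2*pi)
    = (LINT s|circ. f s * ?k s) / of_real (2*pi) + cnj ((LINT s|circ. cnj (f s) * ?k s) / of_real (2*pi)) - fcoeff f 0"
    by (simp add: add_divide_distrib diff_divide_distrib fcoeff_def)
  have "(LINT s|circ. f s * ?k s) / of_real (2*pi) = disc_value f (of_real r * cis t)"
    unfolding disc_value_def by (rule sums_unique[OF szego_integral[OF L r]])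
  moreover have "(LINT s|circ. cnj (f s) * ?k s) / of_real (2*pi) = cnj (fcoeff f 0)"
  proof -
    have "fcoeff (\<lambda>t. cnj (f t)) (int n) * (of_real r * cis t) ^ n = (if n = 0 then cnj (fcoeff f 0) else 0)" for n
      using f by (auto simp: fcoeff_cnj H2_def)
    then have "(\<lambda>n. if n = 0 then cnj (fcoeff f 0) else 0) sums ((LINT s|circ. cnj (f s) * ?k s) / of_real (2*pi))"
      using szego_integral[OF L2_cnj[OF L] r, of t] by simp
    moreover have "(\<lambda>n. if n = (0::nat) then cnj (fcoeff f 0) else 0) sums cnj (fcoeff f 0)"
      using sums_single[of 0 "\<lambda>_. cnj (fcoeff f 0)"] by simp
    ultimately show ?thesis using sums_unique2 by blast
  qed
  ultimately show ?thesis unfolding eq by simp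
qed

lemma zpow_0_fun: "zpow 0 = (\<lambda>t. 1)"
  by (simp add: fun_eq_iff)

lemma disc_value_const: "disc_value (\<lambda>t. 1) z = 1"
proof -
  have "fcoeff (\<lambda>t. 1) (int n) = (if n = 0 then 1 else 0)" for n
    using fcoeff_zpow[of 0 "int n"] by (auto simp: zpow_0_fun)
  then have "(\<lambda>n. fcoeff (\<lambda>t. 1) (int n) * z ^ n) = (\<lambda>n. if n = 0 then 1 else 0)" by auto
  then show ?thesis unfolding disc_value_def
    using sums_unique[OF sums_single[of 0 "\<lambda>_. 1::complex"]] by simp
qed

lemma fcoeff_szego:
  assumes r: "0 \<le> r" "r < 1"
  shows "fcoeff (\<lambda>u. 1 / (1 - complex_of_real r * cis (u - v))) n = (if n \<ge> 0 then (of_real r * cis (- v)) ^ nat n else 0)"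
proof -
  let ?k = "\<lambda>s. 1 / (1 - complex_of_real r * cis (v - s))"
  have k: "1 / (1 - complex_of_real r * cis (u - v)) = cnj (?k u)" for u
    by (simp add: cis_cnj)
  have s: "(\<lambda>k. fcoeff (zpow n) (int k) * (of_real r * cis v) ^ k) sums ((LINT s|circ. zpow n s * ?k s) / of_real (2*pi))"
    by (rule szego_integral[OF L2_zpow r])
  have e: "fcoeff (\<lambda>u. 1 / (1 - complex_of_real r * cis (u - v))) n = cnj ((LINT s|circ. zpow n s * ?k s) / of_real (2*pi))"
    unfolding k fcoeff_eq_inner l2inner_def complex_cnj_divide
    by (subst Bochner_Integration.integral_cnj[symmetric]) (simp add: mult.commute)
  show ?thesis
  proof (cases "n \<ge> 0")
    case True
    then have "(\<lambda>k. fcoeff (zpow n) (int k) * (of_real r * cis v) ^ k) = (\<lambda>k. if k = nat n then (of_real r * cis v) ^ k else 0)"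
      by (auto simp: fcoeff_zpow)
    then have "(\<lambda>k. if k = nat n then (of_real r * cis v) ^ k else 0) sums ((LINT s|circ. zpow n s * ?k s) / of_real (2*pi))"
      using s by simp
    then have "(LINT s|circ. zpow n s * ?k s) / of_real (2*pi) = (of_real r * cis v) ^ nat n"
      using sums_single[of "nat n" "\<lambda>k. (of_real r * cis v) ^ k"] sums_unique2 by blast
    then show ?thesis using True unfolding e by (simp add: cis_cnj)
  next
    case False
    then have "(\<lambda>k. fcoeff (zpow n) (int k) * (of_real r * cis v) ^ k) = (\<lambda>k. 0)"
      by (auto simp: fcoeff_zpow)
    then have "(LINT s|circ. zpow n s * ?k s) / of_real (2*pi) = 0"
      using s sums_unique2[OF _ sums_zero] by fastforce
    then show ?thesis using False unfolding e by simp
  qed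
qed

text \<open>The Poisson integral of radius r multiplies the n-th coefficient by r^n, so it takes the
  Szego kernel of radius s to that of radius rs. The conjugated part follows since the Poisson
  kernel is real.\<close>

lemma poisson_semigroup:
  assumes r: "0 \<le> r" "r < 1" and s: "0 \<le> s" "s < 1"
  shows "(LINT u|circ. poisson r (t - u) * poisson s (v - u)) = 2 * pi * poisson (r * s) (t - v)"
proof -
  let ?k = "\<lambda>u. 1 / (1 - complex_of_real s * cis (u - v))"
  have rs: "0 \<le> r * s" "r * s < 1"
    using r s mult_strict_mono[of r 1 s 1] by auto
  have kc: "continuous_on UNIV ?k"
    by (intro continuous_intros) (use one_minus_nz[OF s] in auto)
  have k: "?k \<in> H2"
    unfolding H2_def using fcoeff_szego[OF s, of v]
      L2_bdd[OF measurable_circ_continuous[OF kc], of "1 / (1 - s)"] cmod_szego_le[OF s] by auto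
  have kL: "L2 ?k" using k by (rule H2_L2)
  have pc: "continuous_on UNIV (\<lambda>u. complex_of_real (poisson r (t - u)))"
    unfolding poisson_szego[OF r] by (intro continuous_intros) (use one_minus_nz[OF r] in auto)
  have pL: "L2 (\<lambda>u. complex_of_real (poisson r (t - u)))"
    by (rule L2_bdd[OF measurable_circ_continuous[OF pc], of "1 / (1 - r)\<^sup>2"])
       (use poisson_le[OF r(1) order_refl r(2)] poisson_nonneg[OF r] in auto)
  have "disc_value ?k (of_real r * cis t) = (\<Sum>n. (of_real (r * s) * cis (t - v)) ^ n)"
  proof -
    have e: "of_real (r * s) * cis (t - v) = (of_real s * cis (- v)) * (of_real r * cis t)"
      using cis_mult[of "-v" t] by (simp add: mult_ac)
    show ?thesis
      unfolding disc_value_def fcoeff_szego[OF s] e by (simp add: power_mult_distrib)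
  qed
  also have "\<dots> = 1 / (1 - of_real (r * s) * cis (t - v))"
    by (rule suminf_geometric) (use rs in \<open>simp add: norm_mult\<close>)
  finally have h: "(LINT u|circ. of_real (poisson r (t - u)) * ?k u) = of_real (2*pi) * (1 / (1 - of_real (r * s) * cis (t - v)))"
    using poisson_integral_H2[OF k r, of t] by (simp add: field_simps)
  have one: "(LINT u|circ. complex_of_real (poisson r (t - u))) = of_real (2*pi)"
    using poisson_integral_H2[of "\<lambda>t. 1" r t] H2_zpow[of 0] r by (simp add: disc_value_const zpow_def[abs_def])
  have "complex_of_real (LINT u|circ. poisson r (t - u) * poisson s (v - u))
      = (LINT u|circ. complex_of_real (poisson r (t - u) * poisson s (v - u)))"
    by (rule integral_complex_of_real[symmetric])
  also have "\<dots> = (LINT u|circ. of_real (poisson r (t - u)) * ?k u + cnj (of_real (poisson r (t - u)) * ?k u) - of_real (poisson r (t - u)))"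
    by (intro Bochner_Integration.integral_cong refl)
       (simp only: of_real_mult poisson_commute[of s v] poisson_szego[OF s], simp add: algebra_simps)
  also have "\<dots> = (LINT u|circ. of_real (poisson r (t - u)) * ?k u) + cnj (LINT u|circ. of_real (poisson r (t - u)) * ?k u) - (LINT u|circ. of_real (poisson r (t - u)))"
    using L2_mult_integrable[OF pL kL] integrable_cnj[OF L2_mult_integrable[OF pL kL]] L2_mult_integrable[OF pL L2_const[of 1]]
    by (subst Bochner_Integration.integral_diff, simp, simp, subst Bochner_Integration.integral_add)
       (auto simp flip: Bochner_Integration.integral_cnj)
  also have "\<dots> = of_real (2*pi) * of_real (poisson (r * s) (t - v))"
    unfolding h one poisson_szego[OF rs] by (simp add: algebra_simps)
  finally show ?thesis
    by (simp only: of_real_mult[symmetric] of_real_eq_iff)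
qed

section \<open>The linearised maximal operator\<close>

lemma poisson_measurable [measurable (raw)]:
  assumes [measurable]: "f \<in> borel_measurable M" "g \<in> borel_measurable M"
  shows "(\<lambda>x. poisson (f x) (g x)) \<in> borel_measurable M"
proof -
  have [measurable]: "(\<lambda>x. cos (g x)) \<in> borel_measurable M"
    by (rule measurable_compose[OF assms(2) borel_measurable_continuous_onI]) (intro continuous_intros)
  show ?thesis unfolding poisson_def by measurable
qed

lemma measurable_ident_circ [measurable]: "(\<lambda>t. t) \<in> borel_measurable circ"
  by (rule measurable_circ_borel) auto

lemma sigma_finite_circ: "sigma_finite_measure circ"
proof -
  interpret finite_measure circ by (rule finite_measure_circ)
  show ?thesis ..
qed

lemma pair_sigma_finite_circ: "pair_sigma_finite circ circ"
  using sigma_finite_circ by (simp add: pair_sigma_finite_def)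

text \<open>For a fixed choice \<rho> of radii this is linear in \<open>u\<close>. Values in
  \<open>ennreal\<close> let Tonelli's theorem exchange integrals with no integrability
  conditions.\<close>

definition lin_maximal :: "(real \<Rightarrow> real) \<Rightarrow> (real \<Rightarrow> ennreal) \<Rightarrow> real \<Rightarrow> ennreal" where
  "lin_maximal \<rho> u t = (\<integral>\<^sup>+s. ennreal (poisson (\<rho> t) (t - s) / (2*pi)) * u s \<partial>circ)"

lemma lin_maximal_measurable [measurable]:
  assumes [measurable]: "\<rho> \<in> borel_measurable circ" "u \<in> borel_measurable circ"
  shows "lin_maximal \<rho> u \<in> borel_measurable circ"
proof -
  interpret sigma_finite_measure circ by (rule sigma_finite_circ)
  show ?thesis unfolding lin_maximal_def[abs_def] by measurable
qed

text \<open>\<open>C\<close> bounds the square of the operator norm.\<close>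

definition lin_maximal_bound :: "(real \<Rightarrow> real) \<Rightarrow> real \<Rightarrow> bool" where
  "lin_maximal_bound \<rho> C \<longleftrightarrow> (\<forall>u\<in>borel_measurable circ. (\<integral>\<^sup>+t. (lin_maximal \<rho> u t)\<^sup>2 \<partial>circ) \<le> ennreal C * (\<integral>\<^sup>+t. (u t)\<^sup>2 \<partial>circ))"

lemma lin_maximal_bound_mono: "lin_maximal_bound \<rho> C \<Longrightarrow> C \<le> D \<Longrightarrow> lin_maximal_bound \<rho> D"
  unfolding lin_maximal_bound_def by (meson ennreal_leI mult_right_mono order_trans zero_le)

text \<open>This bound degenerates as R tends to 1, but it is finite, and only finiteness matters:
  the self-improving step needs some bound to start from.\<close>

lemma lin_maximal_bound_apriori:
  assumes [measurable]: "\<rho> \<in> borel_measurable circ" and \<rho>: "\<And>t. 0 \<le> \<rho> t" "\<And>t. \<rho> t \<le> R" "R < 1"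
  obtains C where "C \<ge> 1" "lin_maximal_bound \<rho> C"
proof -
  define c where "c = 1 / (1 - R)\<^sup>2"
  have c: "c \<ge> 0" by (simp add: c_def)
  have "lin_maximal_bound \<rho> (c\<^sup>2 * (2*pi)\<^sup>2)"
    unfolding lin_maximal_bound_def
  proof
    fix u :: "real \<Rightarrow> ennreal" assume [measurable]: "u \<in> borel_measurable circ"
    have T: "lin_maximal \<rho> u t \<le> ennreal c * (\<integral>\<^sup>+s. u s \<partial>circ)" for t
    proof -
      have "lin_maximal \<rho> u t \<le> (\<integral>\<^sup>+s. ennreal c * u s \<partial>circ)"
        unfolding lin_maximal_def
      proof (intro nn_integral_mono mult_right_mono ennreal_leI)
        fix s
        have "poisson (\<rho> t) (t - s) / (2*pi) \<le> poisson (\<rho> t) (t - s) / 1"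
          using poisson_nonneg[of "\<rho> t" "t - s"] \<rho> pi_gt3 by (intro divide_left_mono) (auto intro: le_less_trans)
        also have "\<dots> \<le> c" using poisson_le[of "\<rho> t" R "t - s"] \<rho> by (simp add: c_def)
        finally show "poisson (\<rho> t) (t - s) / (2*pi) \<le> c" .
      qed auto
      then show ?thesis by (simp add: nn_integral_cmult)
    qed
    have CS: "(\<integral>\<^sup>+s. u s \<partial>circ)\<^sup>2 \<le> ennreal (2*pi) * (\<integral>\<^sup>+s. (u s)\<^sup>2 \<partial>circ)"
    proof -
      have "(\<integral>\<^sup>+s. u s * 1 \<partial>circ)\<^sup>2 \<le> (\<integral>\<^sup>+s. (u s)\<^sup>2 \<partial>circ) * (\<integral>\<^sup>+s. 1\<^sup>2 \<partial>circ)"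
        by (rule Cauchy_Schwarz_nn_integral) measurable
      also have "(\<integral>\<^sup>+s. 1\<^sup>2 \<partial>circ) = ennreal (2*pi)"
        using emeasure_circ by (simp only: power_one nn_integral_const mult_1)
      finally show ?thesis by (simp only: mult_1_right mult.commute[of _ "ennreal (2*pi)"])
    qed
    have "(\<integral>\<^sup>+t. (lin_maximal \<rho> u t)\<^sup>2 \<partial>circ) \<le> (\<integral>\<^sup>+t. ennreal (c\<^sup>2) * (ennreal (2*pi) * (\<integral>\<^sup>+s. (u s)\<^sup>2 \<partial>circ)) \<partial>circ)"
    proof (intro nn_integral_mono)
      fix t
      have "(lin_maximal \<rho> u t)\<^sup>2 \<le> (ennreal c * (\<integral>\<^sup>+s. u s \<partial>circ))\<^sup>2"
        by (intro power_mono T) auto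
      also have "\<dots> = ennreal (c\<^sup>2) * (\<integral>\<^sup>+s. u s \<partial>circ)\<^sup>2"
        using c by (simp add: power_mult_distrib ennreal_power)
      also have "\<dots> \<le> ennreal (c\<^sup>2) * (ennreal (2*pi) * (\<integral>\<^sup>+s. (u s)\<^sup>2 \<partial>circ))"
        by (intro mult_left_mono CS) auto
      finally show "(lin_maximal \<rho> u t)\<^sup>2 \<le> ennreal (c\<^sup>2) * (ennreal (2*pi) * (\<integral>\<^sup>+s. (u s)\<^sup>2 \<partial>circ))" .
    qed
    also have "\<dots> = ennreal (c\<^sup>2 * (2*pi)\<^sup>2) * (\<integral>\<^sup>+s. (u s)\<^sup>2 \<partial>circ)"
      unfolding nn_integral_const emeasure_circ power2_eq_square[of "2*pi"]
      by (simp add: ennreal_mult mult_ac)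
    finally show "(\<integral>\<^sup>+t. (lin_maximal \<rho> u t)\<^sup>2 \<partial>circ) \<le> ennreal (c\<^sup>2 * (2*pi)\<^sup>2) * (\<integral>\<^sup>+t. (u t)\<^sup>2 \<partial>circ)" .
  qed
  then show ?thesis
    using that[of "max 1 (c\<^sup>2 * (2*pi)\<^sup>2)"] lin_maximal_bound_mono by auto
qed

text \<open>With r and r' the radii chosen at t and t', the left side is the kernel of the operator
  times its adjoint. The semigroup law collapses it to radius r r', and
  \<open>poisson_mult_le\<close> splits that into the kernels of the operator and of its
  adjoint.\<close>

lemma poisson_kernel_composition:
  assumes "0 \<le> r" "r < 1" "0 \<le> r'" "r' < 1"
  shows "(\<integral>\<^sup>+s. ennreal (poisson r (t - s) / (2*pi)) * ennreal (poisson r' (t' - s) / (2*pi)) \<partial>circ)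
    \<le> 8 * (ennreal (poisson r (t - t') / (2*pi)) + ennreal (poisson r' (t' - t) / (2*pi)))"
proof -
  have nn: "0 \<le> poisson r x" "0 \<le> poisson r' x" for x using assms poisson_nonneg by auto
  have int: "integrable circ (\<lambda>s. poisson r (t - s) * poisson r' (t' - s))"
  proof (rule Bochner_Integration.integrable_bound)
    show "integrable circ (\<lambda>s. 1 / (1 - r)\<^sup>2 * (1 / (1 - r')\<^sup>2))" by simp
    show "(\<lambda>s. poisson r (t - s) * poisson r' (t' - s)) \<in> borel_measurable circ" by measurable
    show "AE s in circ. norm (poisson r (t - s) * poisson r' (t' - s)) \<le> norm (1 / (1 - r)\<^sup>2 * (1 / (1 - r')\<^sup>2))"
      using nn poisson_le[OF assms(1) order_refl assms(2)] poisson_le[OF assms(3) order_refl assms(4)]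
      by (auto simp: abs_mult simp del: times_divide_eq_left times_divide_eq_right intro!: mult_mono)
  qed
  have "(\<integral>\<^sup>+s. ennreal (poisson r (t - s) / (2*pi)) * ennreal (poisson r' (t' - s) / (2*pi)) \<partial>circ)
     = (\<integral>\<^sup>+s. ennreal ((poisson r (t - s) * poisson r' (t' - s)) / (2*pi)\<^sup>2) \<partial>circ)"
    using nn by (intro nn_integral_cong) (simp add: power2_eq_square flip: ennreal_mult)
  also have "\<dots> = ennreal (LINT s|circ. (poisson r (t - s) * poisson r' (t' - s)) / (2*pi)\<^sup>2)"
    using int nn by (intro nn_integral_eq_integral) auto
  also have "(LINT s|circ. (poisson r (t - s) * poisson r' (t' - s)) / (2*pi)\<^sup>2) = poisson (r * r') (t - t') / (2*pi)"
    using poisson_semigroup[OF assms, of t t'] by (simp add: power2_eq_square)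
  also have "\<dots> \<le> 8 * (poisson r (t - t') / (2*pi) + poisson r' (t' - t) / (2*pi))"
    using poisson_mult_le[OF assms, of "t - t'"] poisson_commute[of r' t' t]
    by (simp add: field_simps)
  finally have "(\<integral>\<^sup>+s. ennreal (poisson r (t - s) / (2*pi)) * ennreal (poisson r' (t' - s) / (2*pi)) \<partial>circ)
    \<le> ennreal (8 * (poisson r (t - t') / (2*pi) + poisson r' (t' - t) / (2*pi)))"
    by (simp only: ennreal_leI)
  also have "ennreal (8 * (x + y)) = 8 * (ennreal x + ennreal y)" if "x \<ge> 0" "y \<ge> 0" for x y
    using that by (subst ennreal_mult) auto
  finally show ?thesis using nn by (simp only: divide_nonneg_nonneg mult_nonneg_nonneg pi_ge_zero zero_le_numeral)
qed

text \<open>With \<open>V = T u\<close>, Cauchy--Schwarz gives \<open>\<parallel>V\<parallel>\<^sup>4 \<le> \<parallel>u\<parallel>\<^sup>2 \<parallel>T\<^sup>* V\<parallel>\<^sup>2\<close>, and the bound on the kernel of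
  \<open>T T\<^sup>*\<close> gives \<open>\<parallel>T\<^sup>* V\<parallel>\<^sup>2 \<le> 16 \<langle>T V, V\<rangle>\<close>. So a bound \<open>C\<close> on \<open>\<parallel>T\<parallel>\<^sup>2\<close> improves itself to \<open>16 \<surd>C\<close>.\<close>

lemma lin_maximal_bound_step:
  assumes \<rho>m [measurable]: "\<rho> \<in> borel_measurable circ" and \<rho>: "\<And>t. 0 \<le> \<rho> t" "\<And>t. \<rho> t < 1"
    and C: "C \<ge> 1" "lin_maximal_bound \<rho> C"
  shows "lin_maximal_bound \<rho> (16 * sqrt C)"
  unfolding lin_maximal_bound_def
proof
  interpret pair_sigma_finite circ circ by (rule pair_sigma_finite_circ)
  fix u :: "real \<Rightarrow> ennreal" assume [measurable]: "u \<in> borel_measurable circ"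
  define U where "U = (\<integral>\<^sup>+t. (u t)\<^sup>2 \<partial>circ)"
  define V where "V = lin_maximal \<rho> u"
  have [measurable]: "V \<in> borel_measurable circ" unfolding V_def by measurable
  define I where "I = (\<integral>\<^sup>+t. (V t)\<^sup>2 \<partial>circ)"
  define K where "K = (\<lambda>t s. ennreal (poisson (\<rho> t) (t - s) / (2*pi)))"
  have [measurable]: "(\<lambda>(t,s). K t s) \<in> borel_measurable (circ \<Otimes>\<^sub>M circ)"
    unfolding K_def by measurable
  have [measurable]: "K t \<in> borel_measurable circ" "(\<lambda>s. K s t) \<in> borel_measurable circ" for t
    unfolding K_def by measurable
  have TK: "lin_maximal \<rho> g t = (\<integral>\<^sup>+s. K t s * g s \<partial>circ)" for g t
    by (simp add: lin_maximal_def K_def)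
  show "(\<integral>\<^sup>+t. (lin_maximal \<rho> u t)\<^sup>2 \<partial>circ) \<le> ennreal (16 * sqrt C) * (\<integral>\<^sup>+t. (u t)\<^sup>2 \<partial>circ)"
  proof (cases "U = top")
    case True
    have "ennreal (16 * sqrt C) * top = top" using C by (simp add: ennreal_mult_top)
    with True show ?thesis by (simp add: U_def)
  next
    case Ufin: False
    have IC: "I \<le> ennreal C * U"
      using C(2) unfolding lin_maximal_bound_def I_def U_def V_def by auto
    have Ifin: "I \<noteq> top"
      using IC Ufin by (metis ennreal_mult_eq_top_iff ennreal_neq_top neq_top_trans)
    define W where "W = (\<lambda>s. \<integral>\<^sup>+t. K t s * V t \<partial>circ)"
    have [measurable]: "W \<in> borel_measurable circ" unfolding W_def by measurable
    have "I = (\<integral>\<^sup>+t. \<integral>\<^sup>+s. V t * (K t s * u s) \<partial>circ \<partial>circ)"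
      unfolding I_def by (intro nn_integral_cong, subst nn_integral_cmult)
        (auto simp: power2_eq_square V_def TK)
    also have "\<dots> = (\<integral>\<^sup>+s. \<integral>\<^sup>+t. V t * (K t s * u s) \<partial>circ \<partial>circ)"
      by (rule Fubini'[symmetric]) measurable
    also have "\<dots> = (\<integral>\<^sup>+s. u s * W s \<partial>circ)"
      unfolding W_def by (intro nn_integral_cong, subst nn_integral_cmult[symmetric], measurable, intro nn_integral_cong, simp only: mult_ac)
    finally have IW: "I\<^sup>2 \<le> U * (\<integral>\<^sup>+s. (W s)\<^sup>2 \<partial>circ)"
      unfolding U_def using Cauchy_Schwarz_nn_integral[of u circ W] by simp
    define Y where "Y = (\<integral>\<^sup>+t. V t * lin_maximal \<rho> V t \<partial>circ)"
    have Yeq: "Y = (\<integral>\<^sup>+t. \<integral>\<^sup>+t'. V t * V t' * K t t' \<partial>circ \<partial>circ)"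
      unfolding Y_def TK by (intro nn_integral_cong, subst nn_integral_cmult[symmetric], measurable, intro nn_integral_cong, simp only: mult_ac)
    \<comment> \<open>Exchanging t and t' transposes the kernel, so the operator and its adjoint
      contribute equally; hence 8 + 8 = 16 below.\<close>
    have Yeq': "Y = (\<integral>\<^sup>+t. \<integral>\<^sup>+t'. V t * V t' * K t' t \<partial>circ \<partial>circ)"
      unfolding Yeq by (subst Fubini', measurable, intro nn_integral_cong, simp only: mult_ac)
    have "(\<integral>\<^sup>+s. (W s)\<^sup>2 \<partial>circ) = (\<integral>\<^sup>+s. \<integral>\<^sup>+t. \<integral>\<^sup>+t'. K t s * V t * (K t' s * V t') \<partial>circ \<partial>circ \<partial>circ)"
      unfolding power2_eq_square
    proof (intro nn_integral_cong)
      fix s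
      have "W s * W s = (\<integral>\<^sup>+t. K t s * V t * W s \<partial>circ)"
        by (subst nn_integral_multc) (auto simp: W_def)
      also have "\<dots> = (\<integral>\<^sup>+t. \<integral>\<^sup>+t'. K t s * V t * (K t' s * V t') \<partial>circ \<partial>circ)"
        by (intro nn_integral_cong, subst nn_integral_cmult) (auto simp: W_def)
      finally show "W s * W s = (\<integral>\<^sup>+t. \<integral>\<^sup>+t'. K t s * V t * (K t' s * V t') \<partial>circ \<partial>circ)" .
    qed
    also have "\<dots> = (\<integral>\<^sup>+t. \<integral>\<^sup>+s. \<integral>\<^sup>+t'. K t s * V t * (K t' s * V t') \<partial>circ \<partial>circ \<partial>circ)"
      by (rule Fubini'[symmetric]) measurable
    also have "\<dots> = (\<integral>\<^sup>+t. \<integral>\<^sup>+t'. \<integral>\<^sup>+s. K t s * V t * (K t' s * V t') \<partial>circ \<partial>circ \<partial>circ)"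
      by (intro nn_integral_cong Fubini'[symmetric]) measurable
    also have "\<dots> = (\<integral>\<^sup>+t. \<integral>\<^sup>+t'. V t * V t' * (\<integral>\<^sup>+s. K t s * K t' s \<partial>circ) \<partial>circ \<partial>circ)"
      by (intro nn_integral_cong, subst nn_integral_cmult[symmetric], measurable, intro nn_integral_cong, simp only: mult_ac)
    also have "\<dots> \<le> (\<integral>\<^sup>+t. \<integral>\<^sup>+t'. V t * V t' * (8 * (K t t' + K t' t)) \<partial>circ \<partial>circ)"
      unfolding K_def by (intro nn_integral_mono mult_left_mono poisson_kernel_composition \<rho>) auto
    also have "\<dots> = (\<integral>\<^sup>+t. \<integral>\<^sup>+t'. 8 * (V t * V t' * K t t') + 8 * (V t * V t' * K t' t) \<partial>circ \<partial>circ)"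
      by (intro nn_integral_cong) (simp add: algebra_simps)
    also have "\<dots> = (\<integral>\<^sup>+t. 8 * (\<integral>\<^sup>+t'. V t * V t' * K t t' \<partial>circ) + 8 * (\<integral>\<^sup>+t'. V t * V t' * K t' t \<partial>circ) \<partial>circ)"
      by (intro nn_integral_cong) (simp add: nn_integral_add nn_integral_cmult)
    also have "\<dots> = 8 * Y + 8 * Y"
      by (subst nn_integral_add) (simp_all add: nn_integral_cmult flip: Yeq Yeq')
    finally have WY: "(\<integral>\<^sup>+s. (W s)\<^sup>2 \<partial>circ) \<le> 16 * Y" by (simp add: mult_2[symmetric] flip: distrib_right)
    have YI: "Y\<^sup>2 \<le> I * (ennreal C * I)"
    proof -
      have "Y\<^sup>2 \<le> I * (\<integral>\<^sup>+t. (lin_maximal \<rho> V t)\<^sup>2 \<partial>circ)"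
        unfolding Y_def I_def by (rule Cauchy_Schwarz_nn_integral) measurable
      also have "\<dots> \<le> I * (ennreal C * I)"
        using C(2) unfolding lin_maximal_bound_def I_def by (intro mult_left_mono) auto
      finally show ?thesis .
    qed
    obtain i where i: "I = ennreal i" "i \<ge> 0" using Ifin by (cases I) auto
    obtain x where x: "U = ennreal x" "x \<ge> 0" using Ufin by (cases U) auto
    have "Y\<^sup>2 \<noteq> top" using YI i C by (metis ennreal_mult_eq_top_iff ennreal_neq_top neq_top_trans)
    then obtain y where y: "Y = ennreal y" "y \<ge> 0" by (cases Y) auto
    have "y\<^sup>2 \<le> C * i\<^sup>2"
      using YI C i y by (simp add: ennreal_power power2_eq_square mult_ac flip: ennreal_mult)
    then have "y\<^sup>2 \<le> (sqrt C * i)\<^sup>2"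
      using C(1) by (simp add: power_mult_distrib)
    then have "y \<le> sqrt C * i"
      by (rule power2_le_imp_le) (use i(2) C(1) in simp)
    moreover have "i\<^sup>2 \<le> x * (16 * y)"
    proof -
      have "I\<^sup>2 \<le> U * (16 * Y)" using IW WY by (meson mult_left_mono order_trans zero_le)
      then have "ennreal (i\<^sup>2) \<le> ennreal (x * (16 * y))"
        using i x y by (simp add: ennreal_power ennreal_mult)
      then show ?thesis using x y by (subst (asm) ennreal_le_iff) auto
    qed
    ultimately have "i\<^sup>2 \<le> x * (16 * (sqrt C * i))"
      using x by (meson mult_left_mono order_trans zero_le_numeral)
    \<comment> \<open>Cancelling \<open>i\<close> requires \<open>I\<close> to be finite, which is
      what the bound \<open>C\<close> supplied.\<close>
    then have "i \<le> 16 * sqrt C * x"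
      using i x C by (cases "i = 0") (auto simp: power2_eq_square mult_ac)
    then show ?thesis
      using i x C unfolding I_def[symmetric] U_def[symmetric] V_def[symmetric]
      by (simp add: ennreal_leI flip: ennreal_mult)
  qed
qed

text \<open>From 1024 = 32^2 on, 16 sqrt(D) is at most D/2. Each step therefore halves the bound
  until it falls to 1024, whatever the initial bound was.\<close>

lemma lin_maximal_bound_1024:
  assumes [measurable]: "\<rho> \<in> borel_measurable circ" and \<rho>: "\<And>t. 0 \<le> \<rho> t" "\<And>t. \<rho> t \<le> R" "R < 1"
  shows "lin_maximal_bound \<rho> 1024"
proof -
  have \<rho>1: "\<rho> t < 1" for t using \<rho>(2)[of t] \<rho>(3) by linarith
  obtain C where C: "C \<ge> 1" "lin_maximal_bound \<rho> C" using lin_maximal_bound_apriori assms by blast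
  have *: "lin_maximal_bound \<rho> (max (C / 2^k) 1024)" for k
  proof (induction k)
    case 0
    then show ?case using C lin_maximal_bound_mono[of \<rho> C] by auto
  next
    case (Suc k)
    define D where "D = max (C / 2^k) 1024"
    have D: "D \<ge> 1024" by (simp add: D_def)
    have "32 = sqrt 1024" by (simp add: real_sqrt_unique)
    then have s: "32 \<le> sqrt D" using D by (metis real_sqrt_le_iff)
    have "16 * sqrt D = 32 * sqrt D / 2" by simp
    also have "\<dots> \<le> sqrt D * sqrt D / 2" using s D by (intro divide_right_mono mult_right_mono) auto
    also have "\<dots> = D / 2" using D by auto
    also have "\<dots> \<le> max (C / 2^Suc k) 1024" by (auto simp: D_def max_def)
    finally have "16 * sqrt D \<le> max (C / 2^Suc k) 1024" .
    moreover have "lin_maximal_bound \<rho> (16 * sqrt D)"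
      using lin_maximal_bound_step[of \<rho> D] \<rho>(1) \<rho>1 D Suc unfolding D_def by auto
    ultimately show ?case by (rule lin_maximal_bound_mono[rotated])
  qed
  obtain k :: nat where "C < 2 ^ k" using real_arch_pow[of 2 C] by auto
  then have "C / 2 ^ k < 1" by (simp add: divide_simps)
  then have "C / 2 ^ k \<le> 1024" by linarith
  then show ?thesis using *[of k] by (simp add: max_absorb2)
qed

section \<open>The maximal function and radial limits\<close>

lemma disc_value_summable:
  assumes "L2 f" "cmod z < 1" shows "summable (\<lambda>n. fcoeff f (int n) * z ^ n)"
proof (rule summable_comparison_test')
  show "summable (\<lambda>n. l2norm f * cmod z ^ n)"
    using assms by (intro summable_mult summable_geometric) auto
  show "norm (fcoeff f (int n) * z ^ n) \<le> l2norm f * cmod z ^ n" if "n \<ge> 0" for n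
    using cmod_fcoeff_le[OF assms(1)] by (simp add: norm_mult norm_power mult_right_mono)
qed

lemma disc_value_diff:
  assumes "L2 f" "L2 g" "cmod z < 1" shows "disc_value (\<lambda>t. f t - g t) z = disc_value f z - disc_value g z"
  unfolding disc_value_def using suminf_diff[OF disc_value_summable[OF assms(1,3)] disc_value_summable[OF assms(2,3)]]
  by (simp add: fcoeff_diff assms left_diff_distrib)

lemma isCont_disc_value:
  assumes "L2 f" "cmod z < 1" shows "isCont (disc_value f) z"
proof -
  define K where "K = complex_of_real ((1 + cmod z) / 2)"
  have K: "cmod K = (1 + cmod z) / 2" unfolding K_def norm_of_real by simp
  have "isCont (\<lambda>x. \<Sum>n. fcoeff f (int n) * x ^ n) z"
    by (rule isCont_powser[OF disc_value_summable[OF assms(1)], of K]) (use K assms(2) in auto)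
  then show ?thesis by (simp add: disc_value_def[abs_def])
qed

lemma disc_value_le_lin_maximal:
  assumes f: "f \<in> H2" and r: "0 \<le> r" "r < 1"
  shows "ennreal (cmod (disc_value f (of_real r * cis t))) \<le> lin_maximal (\<lambda>_. r) (\<lambda>s. ennreal (cmod (f s))) t"
proof -
  have m [measurable]: "f \<in> borel_measurable circ" using f by (intro L2_measurable H2_L2)
  have L: "L2 (\<lambda>s. of_real (poisson r (t - s) / (2*pi)) * f s)"
  proof (rule L2_bdd_mult[OF _ _ H2_L2[OF f]])
    show "(\<lambda>s. complex_of_real (poisson r (t - s) / (2*pi))) \<in> borel_measurable circ" by measurable
    have "cmod (complex_of_real (poisson r (t - s) / (2*pi))) \<le> (1 / (1 - r)\<^sup>2) / (2*pi)" for s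
    proof -
      have "\<bar>poisson r (t - s) / (2*pi)\<bar> = poisson r (t - s) / (2*pi)"
        using poisson_nonneg[OF r, of "t - s"] by simp
      also have "\<dots> \<le> (1 / (1 - r)\<^sup>2) / (2*pi)"
        by (intro divide_right_mono poisson_le r order_refl) simp
      finally show ?thesis unfolding norm_of_real .
    qed
    then show "AE s in circ. cmod (complex_of_real (poisson r (t - s) / (2*pi))) \<le> (1 / (1 - r)\<^sup>2) / (2*pi)" by auto
  qed
  have "disc_value f (of_real r * cis t) = (LINT s|circ. of_real (poisson r (t - s) / (2*pi)) * f s)"
    unfolding poisson_integral_H2[OF f r, symmetric] by simp
  also have "ennreal (cmod \<dots>) \<le> (\<integral>\<^sup>+s. ennreal (cmod (of_real (poisson r (t - s) / (2*pi)) * f s)) \<partial>circ)"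
    by (rule integral_norm_bound_ennreal) (use L2_mult_integrable[OF L L2_const[of 1]] in simp)
  also have "\<dots> = lin_maximal (\<lambda>_. r) (\<lambda>s. ennreal (cmod (f s))) t"
    unfolding lin_maximal_def using poisson_nonneg[OF r]
    by (intro nn_integral_cong) (simp add: norm_mult abs_divide del: of_real_divide flip: ennreal_mult)
  finally show ?thesis .
qed

text \<open>For finitely many radii a measurable best choice \<rho> exists by comparison, so the
  linearised operator computes the maximum. The bound does not depend on the number of radii, and
  monotone convergence passes to all of them.\<close>

lemma radial_maximal_seq:
  fixes r :: "nat \<Rightarrow> real"
  assumes f: "f \<in> H2" and r: "\<And>i. 0 \<le> r i" "\<And>i. r i < 1"
  obtains G where "G \<in> borel_measurable circ" "(\<integral>\<^sup>+t. G t \<partial>circ) \<le> ennreal (2048 * pi * (l2norm f)\<^sup>2)"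
    "\<And>t i. ennreal ((cmod (disc_value f (of_real (r i) * cis t)))\<^sup>2) \<le> G t"
proof -
  define u where "u = (\<lambda>s. ennreal (cmod (f s)))"
  have [measurable]: "f \<in> borel_measurable circ" using f by (intro L2_measurable H2_L2)
  have [measurable]: "u \<in> borel_measurable circ" unfolding u_def by measurable
  \<comment> \<open>Keeps the current radius unless the new one gives a larger Poisson integral, so
    that \<open>b N\<close> is a running maximum.\<close>
  define \<rho> where "\<rho> = rec_nat (\<lambda>_. r 0) (\<lambda>N \<rho>. \<lambda>t. if lin_maximal \<rho> u t < lin_maximal (\<lambda>_. r (Suc N)) u t then r (Suc N) else \<rho> t)"
  have \<rho>0: "\<rho> 0 = (\<lambda>_. r 0)" by (simp add: \<rho>_def)
  have \<rho>S: "\<rho> (Suc N) = (\<lambda>t. if lin_maximal (\<rho> N) u t < lin_maximal (\<lambda>_. r (Suc N)) u t then r (Suc N) else \<rho> N t)" for N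
    unfolding \<rho>_def by simp
  have \<rho>m [measurable]: "\<rho> N \<in> borel_measurable circ" for N
    by (induction N) (auto simp: \<rho>0 \<rho>S)
  have \<rho>r: "\<exists>i\<le>N. \<rho> N t = r i" for N t
    by (induction N) (auto simp: \<rho>0 \<rho>S intro: le_SucI)
  define b where "b = (\<lambda>N t. lin_maximal (\<rho> N) u t)"
  have [measurable]: "b N \<in> borel_measurable circ" for N unfolding b_def by measurable
  have pt: "lin_maximal \<rho>' u t = lin_maximal (\<lambda>_. \<rho>' t) u t" for \<rho>' t by (simp add: lin_maximal_def)
  have bS: "b (Suc N) t = max (b N t) (lin_maximal (\<lambda>_. r (Suc N)) u t)" for N t
    unfolding b_def by (subst pt, simp add: \<rho>S, subst (3) pt) (auto simp: max_def pt[of "\<rho> N"])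
  have binc: "incseq b"
    by (rule incseq_SucI) (simp add: le_fun_def bS)
  have bge: "lin_maximal (\<lambda>_. r i) u t \<le> b N t" if "i \<le> N" for i N t
    using that
  proof (induction N)
    case 0 then show ?case by (simp add: b_def \<rho>0)
  next
    case (Suc N) then show ?case by (cases "i = Suc N") (simp_all add: bS le_max_iff_disj)
  qed
  have bb: "(\<integral>\<^sup>+t. (b N t)\<^sup>2 \<partial>circ) \<le> ennreal (2048 * pi * (l2norm f)\<^sup>2)" for N
  proof -
    \<comment> \<open>Finitely many radii stay below a common R < 1, as the a priori bound
      requires.\<close>
    define R where "R = Max (r ` {..N})"
    have "lin_maximal_bound (\<rho> N) 1024"
    proof (rule lin_maximal_bound_1024)
      show "0 \<le> \<rho> N t" for t using \<rho>r[of N t] r by auto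
      show "\<rho> N t \<le> R" for t using \<rho>r[of N t] unfolding R_def by auto
      show "R < 1" unfolding R_def using r by (subst Max_less_iff) auto
    qed measurable
    then have "(\<integral>\<^sup>+t. (b N t)\<^sup>2 \<partial>circ) \<le> ennreal 1024 * (\<integral>\<^sup>+t. (u t)\<^sup>2 \<partial>circ)"
      unfolding lin_maximal_bound_def b_def by auto
    also have "(\<integral>\<^sup>+t. (u t)\<^sup>2 \<partial>circ) = ennreal (2*pi*(l2norm f)\<^sup>2)"
      unfolding u_def nn_integral_l2norm[OF H2_L2[OF f], symmetric] by (simp add: ennreal_power)
    \<comment> \<open>The constant 2048 pi is 1024 times the total mass 2 pi.\<close>
    also have "ennreal 1024 * ennreal (2*pi*(l2norm f)\<^sup>2) = ennreal (2048 * pi * (l2norm f)\<^sup>2)"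
      by (subst ennreal_mult'[symmetric]) (simp_all add: mult.assoc)
    finally show ?thesis .
  qed
  show ?thesis
  proof (rule that[of "\<lambda>t. SUP N. (b N t)\<^sup>2"])
    show "(\<lambda>t. SUP N. (b N t)\<^sup>2) \<in> borel_measurable circ" by measurable
    have "incseq (\<lambda>N t. (b N t)\<^sup>2)"
      using binc by (auto simp: incseq_def le_fun_def intro!: power_mono)
    then have "(\<integral>\<^sup>+t. (SUP N. (b N t)\<^sup>2) \<partial>circ) = (SUP N. \<integral>\<^sup>+t. (b N t)\<^sup>2 \<partial>circ)"
      by (intro nn_integral_monotone_convergence_SUP) measurable
    also have "\<dots> \<le> ennreal (2048 * pi * (l2norm f)\<^sup>2)" using bb by (intro SUP_least)
    finally show "(\<integral>\<^sup>+t. (SUP N. (b N t)\<^sup>2) \<partial>circ) \<le> ennreal (2048 * pi * (l2norm f)\<^sup>2)" .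
    show "ennreal ((cmod (disc_value f (of_real (r i) * cis t)))\<^sup>2) \<le> (SUP N. (b N t)\<^sup>2)" for t i
    proof -
      have "ennreal (cmod (disc_value f (of_real (r i) * cis t))) \<le> b i t"
        using disc_value_le_lin_maximal[OF f r, of i t] bge[of i i t] unfolding u_def by (meson order_refl order_trans)
      then have "(ennreal (cmod (disc_value f (of_real (r i) * cis t))))\<^sup>2 \<le> (b i t)\<^sup>2"
        by (intro power_mono) auto
      also have "\<dots> \<le> (SUP N. (b N t)\<^sup>2)" by (rule SUP_upper) auto
      finally show ?thesis by (simp add: ennreal_power)
    qed
  qed
qed

text \<open>Rational radii form a sequence, and \<open>disc_value f\<close> is continuous in the
  disc, so their bound holds for every radius.\<close>

lemma radial_maximal:
  assumes f: "f \<in> H2"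
  obtains G where "G \<in> borel_measurable circ" "(\<integral>\<^sup>+t. G t \<partial>circ) \<le> ennreal (2048 * pi * (l2norm f)\<^sup>2)"
    "\<And>t r. 0 \<le> r \<Longrightarrow> r < 1 \<Longrightarrow> ennreal ((cmod (disc_value f (of_real r * cis t)))\<^sup>2) \<le> G t"
proof -
  define Q where "Q = \<rat> \<inter> {0..<1::real}"
  have Q: "countable Q" "Q \<noteq> {}"
    unfolding Q_def using countable_rat by (auto intro: countable_Int1)
  define r where "r = from_nat_into Q"
  have rQ: "r i \<in> Q" for i unfolding r_def using Q by (rule_tac from_nat_into)
  have rs: "\<exists>i. r i = q" if "q \<in> Q" for q
    unfolding r_def using that Q(1) by (metis from_nat_into_surj)
  obtain G where G: "G \<in> borel_measurable circ" "(\<integral>\<^sup>+t. G t \<partial>circ) \<le> ennreal (2048 * pi * (l2norm f)\<^sup>2)"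
    "\<And>t i. ennreal ((cmod (disc_value f (of_real (r i) * cis t)))\<^sup>2) \<le> G t"
    by (rule radial_maximal_seq[OF f, of r]) (use rQ in \<open>auto simp: Q_def\<close>)
  have "ennreal ((cmod (disc_value f (of_real x * cis t)))\<^sup>2) \<le> G t" if x: "0 \<le> x" "x < 1" for x t
  proof -
    define q where "q = (\<lambda>k. of_int \<lfloor>real (Suc k) * x\<rfloor> / real (Suc k))"
    have qle: "q k \<le> x" "x - 1 / real (Suc k) \<le> q k" "0 \<le> q k" for k
    proof -
      have "of_int \<lfloor>real (Suc k) * x\<rfloor> \<le> real (Suc k) * x" by (rule of_int_floor_le)
      then show "q k \<le> x" unfolding q_def by (simp add: field_simps)
      have "real (Suc k) * x - 1 \<le> of_int \<lfloor>real (Suc k) * x\<rfloor>" by linarith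
      then have "(real (Suc k) * x - 1) / real (Suc k) \<le> q k"
        unfolding q_def by (rule divide_right_mono) simp
      then show "x - 1 / real (Suc k) \<le> q k" by (simp add: diff_divide_distrib del: of_nat_Suc)
      show "0 \<le> q k" unfolding q_def using x by simp
    qed
    have qQ: "q k \<in> Q" for k
    proof -
      have "q k \<in> \<rat>" unfolding q_def by (intro Rats_divide) auto
      moreover have "q k < 1" using qle(1)[of k] x by linarith
      ultimately show ?thesis using qle(3)[of k] by (simp add: Q_def)
    qed
    have "q \<longlonglongrightarrow> x"
    proof (rule real_tendsto_sandwich)
      show "(\<lambda>k. x - 1 / real (Suc k)) \<longlonglongrightarrow> x"
        using tendsto_diff[OF tendsto_const[of x] LIMSEQ_inverse_real_of_nat] by (simp add: inverse_eq_divide)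
    qed (use qle in auto)
    then have "(\<lambda>k. of_real (q k) * cis t) \<longlonglongrightarrow> of_real x * cis t"
      by (intro tendsto_intros)
    then have "(\<lambda>k. disc_value f (of_real (q k) * cis t)) \<longlonglongrightarrow> disc_value f (of_real x * cis t)"
      by (rule isCont_tendsto_compose[OF isCont_disc_value[OF H2_L2[OF f]], rotated]) (use x in \<open>simp add: norm_mult\<close>)
    then have lim: "(\<lambda>k. ennreal ((cmod (disc_value f (of_real (q k) * cis t)))\<^sup>2)) \<longlonglongrightarrow> ennreal ((cmod (disc_value f (of_real x * cis t)))\<^sup>2)"
      by (intro tendsto_ennrealI tendsto_power tendsto_norm)
    have le: "ennreal ((cmod (disc_value f (of_real (q k) * cis t)))\<^sup>2) \<le> G t" for k
      using rs[OF qQ[of k]] G(3) by metis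
    show ?thesis
      by (rule LIMSEQ_le_const2[OF lim]) (use le in blast)
  qed
  with G(1,2) that show ?thesis by blast
qed

text \<open>A three-epsilon argument. Along a fast subsequence the maximal functions of the errors
  are summable a.e., so they tend to 0 a.e. and control the error uniformly in the radius; the
  approximants themselves have radial limits by assumption.\<close>

lemma Fatou_radial:
  assumes f: "f \<in> H2" and X: "\<And>k. X k \<in> H2"
    and conv: "(\<lambda>k. l2norm (\<lambda>t. X k t - f t)) \<longlonglongrightarrow> 0"
    and rad: "\<And>k t. ((\<lambda>r. disc_value (X k) (of_real r * cis t)) \<longlongrightarrow> X k t) (at_left 1)"
  shows "AE t in circ. ((\<lambda>r. disc_value f (of_real r * cis t)) \<longlongrightarrow> f t) (at_left 1)"
proof -
  have "\<exists>m. l2norm (\<lambda>t. X m t - f t) \<le> (1/2)^k" for k :: nat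
  proof -
    have "eventually (\<lambda>m. l2norm (\<lambda>t. X m t - f t) < (1/2)^k) sequentially"
      by (rule order_tendstoD(2)[OF conv]) simp
    then show ?thesis by (auto simp: eventually_sequentially intro: less_imp_le)
  qed
  then obtain m where m: "\<And>k::nat. l2norm (\<lambda>t. X (m k) t - f t) \<le> (1/2)^k" by metis
  define Y where "Y = (\<lambda>k. X (m k))"
  have Y: "Y k \<in> H2" for k using X by (simp add: Y_def)
  have aeY: "AE t in circ. (\<lambda>k. Y k t) \<longlonglongrightarrow> f t"
    by (rule L2_fast_AE) (use Y f m in \<open>auto simp: H2_L2 Y_def\<close>)
  have "\<exists>G. G \<in> borel_measurable circ \<and> (\<integral>\<^sup>+t. G t \<partial>circ) \<le> ennreal (2048 * pi * (1/2)^k) \<and>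
    (\<forall>t r. 0 \<le> r \<longrightarrow> r < 1 \<longrightarrow> ennreal ((cmod (disc_value (\<lambda>t. Y k t - f t) (of_real r * cis t)))\<^sup>2) \<le> G t)" for k
  proof -
    obtain G where G: "G \<in> borel_measurable circ" "(\<integral>\<^sup>+t. G t \<partial>circ) \<le> ennreal (2048 * pi * (l2norm (\<lambda>t. Y k t - f t))\<^sup>2)"
      "\<And>t r. 0 \<le> r \<Longrightarrow> r < 1 \<Longrightarrow> ennreal ((cmod (disc_value (\<lambda>t. Y k t - f t) (of_real r * cis t)))\<^sup>2) \<le> G t"
      by (rule radial_maximal[OF H2_diff[OF Y[of k] f]]) blast
    have "(l2norm (\<lambda>t. Y k t - f t))\<^sup>2 \<le> ((1/2)^k)\<^sup>2"
      using m[of k] unfolding Y_def by (intro power_mono) auto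
    also have "\<dots> \<le> (1/2)^k"
      unfolding power2_eq_square by (intro mult_left_le) (auto simp: power_le_one)
    finally have "ennreal (2048 * pi * (l2norm (\<lambda>t. Y k t - f t))\<^sup>2) \<le> ennreal (2048 * pi * (1/2)^k)"
      by (intro ennreal_leI mult_left_mono) auto
    with G show ?thesis by (meson order_trans)
  qed
  from choice[OF allI[OF this]] obtain G where G: "\<forall>k. G k \<in> borel_measurable circ \<and>
      (\<integral>\<^sup>+t. G k t \<partial>circ) \<le> ennreal (2048 * pi * (1/2)^k) \<and>
      (\<forall>t r. 0 \<le> r \<longrightarrow> r < 1 \<longrightarrow> ennreal ((cmod (disc_value (\<lambda>t. Y k t - f t) (of_real r * cis t)))\<^sup>2) \<le> G k t)"
    by (rule exE)
  have Gm: "G k \<in> borel_measurable circ"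
    and Gi: "(\<integral>\<^sup>+t. G k t \<partial>circ) \<le> ennreal (2048 * pi * (1/2)^k)" for k
    using G by auto
  have Gb: "ennreal ((cmod (disc_value (\<lambda>t. Y k t - f t) (of_real r * cis t)))\<^sup>2) \<le> G k t"
    if "0 \<le> r" "r < 1" for k t r
    using G that by blast
  have fin: "AE t in circ. \<forall>k. G k t \<noteq> \<infinity>"
    unfolding AE_all_countable
  proof
    fix k
    have "(\<integral>\<^sup>+t. G k t \<partial>circ) \<noteq> \<infinity>" using Gi[of k] by (metis ennreal_neq_top infinity_ennreal_def neq_top_trans)
    then show "AE t in circ. G k t \<noteq> \<infinity>" by (rule nn_integral_PInf_AE[OF Gm])
  qed
  have "AE t in circ. summable (\<lambda>k. enn2real (G k t))"
  proof (rule AE_summable_of_nn_integral)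
    show "(\<lambda>t. enn2real (G k t)) \<in> borel_measurable circ" for k using Gm by measurable
    show "(\<integral>\<^sup>+t. ennreal (enn2real (G k t)) \<partial>circ) \<le> ennreal (2048 * pi * (1/2)^k)" for k
      by (rule order_trans[OF nn_integral_mono Gi]) (auto simp: ennreal_enn2real_if)
    show "summable (\<lambda>k. 2048 * pi * (1/2::real)^k)"
      by (intro summable_mult summable_geometric) auto
  qed auto
  with fin aeY show ?thesis
  proof eventually_elim
    case (elim t)
    have G0: "(\<lambda>k. enn2real (G k t)) \<longlonglongrightarrow> 0" using elim(3) by (rule summable_LIMSEQ_zero)
    show ?case
    proof (rule tendstoI)
      fix e :: real assume e: "e > 0"
      have "eventually (\<lambda>k. enn2real (G k t) < (e/3)\<^sup>2) sequentially"
        by (rule order_tendstoD(2)[OF G0]) (use e in simp)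
      moreover have "eventually (\<lambda>k. dist (Y k t) (f t) < e/3) sequentially"
        by (rule tendstoD[OF elim(2)]) (use e in simp)
      ultimately have "eventually (\<lambda>k. enn2real (G k t) < (e/3)\<^sup>2 \<and> dist (Y k t) (f t) < e/3) sequentially"
        by (rule eventually_conj)
      then obtain k where k: "enn2real (G k t) < (e/3)\<^sup>2" "dist (Y k t) (f t) < e/3"
        by (auto simp: eventually_sequentially)
      have "eventually (\<lambda>r. dist (disc_value (Y k) (of_real r * cis t)) (Y k t) < e/3) (at_left 1)"
        using tendstoD[OF rad[of "m k" t], of "e/3"] e by (simp add: Y_def)
      moreover have "eventually (\<lambda>r::real. r \<in> {0<..<1}) (at_left 1)"
        by (rule eventually_at_left_real) simp
      ultimately show "eventually (\<lambda>r. dist (disc_value f (of_real r * cis t)) (f t) < e) (at_left 1)"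
      proof eventually_elim
        case (elim r)
        have z: "cmod (of_real r * cis t) < 1" using elim(2) by (simp add: norm_mult)
        have "ennreal ((cmod (disc_value (\<lambda>t. Y k t - f t) (of_real r * cis t)))\<^sup>2) \<le> G k t"
          using Gb elim(2) by auto
        then have "(cmod (disc_value (\<lambda>t. Y k t - f t) (of_real r * cis t)))\<^sup>2 \<le> enn2real (G k t)"
          using \<open>\<forall>k. G k t \<noteq> \<infinity>\<close> by (metis enn2real_mono enn2real_ennreal infinity_ennreal_def less_top zero_le_power2)
        then have "(cmod (disc_value (\<lambda>t. Y k t - f t) (of_real r * cis t)))\<^sup>2 < (e/3)\<^sup>2"
          using k(1) by linarith
        then have "cmod (disc_value (\<lambda>t. Y k t - f t) (of_real r * cis t)) < e/3"
          by (rule power2_less_imp_less) (use e in simp)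
        then have "dist (disc_value (Y k) (of_real r * cis t)) (disc_value f (of_real r * cis t)) < e/3"
          using disc_value_diff[OF H2_L2[OF Y] H2_L2[OF f] z] by (simp add: dist_norm)
        then show ?case
          using elim(1) k(2) dist_triangle_third[of "disc_value f (of_real r * cis t)" "disc_value (Y k) (of_real r * cis t)" e "Y k t" "f t"]
          by (simp add: dist_commute)
      qed
    qed
  qed
qed

section \<open>Boundary values of Blaschke products\<close>

text \<open>The radius beyond 1 makes the Taylor series converge absolutely on the circle, so
  coefficients and boundary values can be read off it.\<close>

definition hol_closed_disc :: "(complex \<Rightarrow> complex) \<Rightarrow> bool" where
  "hol_closed_disc F \<longleftrightarrow> (\<exists>R>1. F holomorphic_on ball 0 R)"

lemma hol_closed_disc_const: "hol_closed_disc (\<lambda>z. c)"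
  unfolding hol_closed_disc_def by (intro exI[of _ 2]) auto

lemma hol_closed_disc_mult:
  assumes "hol_closed_disc F" "hol_closed_disc G" shows "hol_closed_disc (\<lambda>z. F z * G z)"
proof -
  obtain R1 R2 where R: "R1 > 1" "F holomorphic_on ball 0 R1" "R2 > 1" "G holomorphic_on ball 0 R2"
    using assms unfolding hol_closed_disc_def by blast
  have "F holomorphic_on ball 0 (min R1 R2)" "G holomorphic_on ball 0 (min R1 R2)"
    by (rule holomorphic_on_subset[OF R(2)] holomorphic_on_subset[OF R(4)], auto)+
  then show ?thesis
    unfolding hol_closed_disc_def using R(1,3) by (intro exI[of _ "min R1 R2"]) (auto intro: holomorphic_intros)
qed

lemma hol_closed_disc_prod:
  "(\<And>i. i \<in> I \<Longrightarrow> hol_closed_disc (F i)) \<Longrightarrow> hol_closed_disc (\<lambda>z. \<Prod>i\<in>I. F i z)"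
  by (induction I rule: infinite_finite_induct) (auto intro: hol_closed_disc_const hol_closed_disc_mult)

lemma hol_closed_disc_power_series:
  assumes "hol_closed_disc F"
  obtains c where "summable (\<lambda>n. cmod (c n))" "\<And>z. cmod z \<le> 1 \<Longrightarrow> (\<lambda>n. c n * z ^ n) sums F z"
proof -
  obtain R where R: "R > 1" "F holomorphic_on ball 0 R" using assms unfolding hol_closed_disc_def by blast
  define c where "c = (\<lambda>n. (deriv ^^ n) F 0 / fact n)"
  have s: "(\<lambda>n. c n * z ^ n) sums F z" if "cmod z < R" for z
    using holomorphic_power_series[OF R(2), of z] that by (simp add: c_def)
  have "summable (\<lambda>n. norm (c n * 1 ^ n))"
  proof (rule powser_insidea)
    \<comment> \<open>A point strictly between 1 and R: convergence there forces absolute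
      convergence at 1.\<close>
    have "cmod (of_real ((1 + R) / 2)) < R" using R unfolding norm_of_real by simp
    then show "summable (\<lambda>n. c n * of_real ((1 + R) / 2) ^ n)" using s sums_summable by blast
    show "norm (1::complex) < norm (complex_of_real ((1 + R) / 2))" using R unfolding norm_of_real by simp
  qed
  then show ?thesis using that[of c] s R(1) by auto
qed

lemma power_series_fcoeff:
  assumes c: "summable (\<lambda>n. cmod (c n))" and F: "\<And>z. cmod z \<le> 1 \<Longrightarrow> (\<lambda>n. c n * z ^ n) sums F z"
    and m: "(\<lambda>t. F (cis t)) \<in> borel_measurable circ"
  shows "L2 (\<lambda>t. F (cis t))" "fcoeff (\<lambda>t. F (cis t)) k = (if k \<ge> 0 then c (nat k) else 0)"
proof -
  have "cmod (F (cis t)) \<le> (\<Sum>n. cmod (c n))" for t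
  proof -
    have "F (cis t) = (\<Sum>n. c n * cis t ^ n)" using sums_unique[OF F[of "cis t"]] by simp
    also have "cmod \<dots> \<le> (\<Sum>n. cmod (c n * cis t ^ n))"
      using c by (intro summable_norm) (simp add: norm_mult norm_power)
    finally show ?thesis by (simp add: norm_mult norm_power)
  qed
  then show "L2 (\<lambda>t. F (cis t))" by (intro L2_bdd[OF m]) auto
  have nrm: "norm (c n * (zpow (int n) t * cnj (zpow k t))) = cmod (c n)" for n t
    by (simp add: norm_mult)
  have "(\<lambda>n. LINT t|circ. c n * (zpow (int n) t * cnj (zpow k t))) sums (LINT t|circ. (\<Sum>n. c n * (zpow (int n) t * cnj (zpow k t))))"
  proof (rule sums_integral)
    show "integrable circ (\<lambda>t. c n * (zpow (int n) t * cnj (zpow k t)))" for n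
      by (intro integrable_mult_right L2_inner_integrable L2_zpow)
    show "AE t in circ. summable (\<lambda>n. norm (c n * (zpow (int n) t * cnj (zpow k t))))"
      unfolding nrm using c by simp
    have "summable (\<lambda>n. cmod (c n) * measure circ (space circ))" using c by (rule summable_mult2)
    then show "summable (\<lambda>n. LINT t|circ. norm (c n * (zpow (int n) t * cnj (zpow k t))))"
      unfolding nrm by (simp add: mult.commute)
  qed
  moreover have "(\<Sum>n. c n * (zpow (int n) t * cnj (zpow k t))) = F (cis t) * cnj (zpow k t)" for t
    using sums_unique[OF sums_mult2[OF F[of "cis t"], of "cnj (zpow k t)"]] by (simp add: zpow_of_nat mult.assoc)
  ultimately have "(\<lambda>n. (LINT t|circ. c n * (zpow (int n) t * cnj (zpow k t))) / of_real (2*pi)) sums fcoeff (\<lambda>t. F (cis t)) k"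
    unfolding fcoeff_eq_inner l2inner_def by (intro sums_divide) simp
  moreover have "(LINT t|circ. c n * (zpow (int n) t * cnj (zpow k t))) / of_real (2*pi) = (if int n = k then c n else 0)" for n
  proof -
    have "(LINT t|circ. c n * (zpow (int n) t * cnj (zpow k t))) / of_real (2*pi) = c n * l2inner (zpow (int n)) (zpow k)"
      by (simp only: l2inner_def integral_mult_right_zero times_divide_eq_right)
    then show ?thesis by (simp add: l2inner_zpow)
  qed
  ultimately have s: "(\<lambda>n. if int n = k then c n else 0) sums fcoeff (\<lambda>t. F (cis t)) k" by simp
  show "fcoeff (\<lambda>t. F (cis t)) k = (if k \<ge> 0 then c (nat k) else 0)"
  proof (cases "k \<ge> 0")
    case True
    then have "(int n = k) = (n = nat k)" for n by auto
    then have "(\<lambda>n. if n = nat k then c n else 0) sums fcoeff (\<lambda>t. F (cis t)) k" using s by simp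
    from sums_unique2[OF this sums_single] show ?thesis using True by simp
  next
    case False
    then have "(int n = k) = False" for n by auto
    then have "(\<lambda>n. 0) sums fcoeff (\<lambda>t. F (cis t)) k" using s by simp
    from sums_unique2[OF this sums_zero] show ?thesis using False by simp
  qed
qed

lemma hol_closed_disc_isCont:
  assumes "hol_closed_disc F" "cmod z \<le> 1" shows "isCont F z"
proof -
  obtain R where R: "R > 1" "F holomorphic_on ball 0 R" using assms unfolding hol_closed_disc_def by blast
  then show ?thesis
    using holomorphic_on_imp_continuous_on[OF R(2)] assms(2) by (auto simp: continuous_on_eq_continuous_at)
qed

lemma hol_closed_disc_boundary:
  assumes "hol_closed_disc F"
  shows "(\<lambda>t. F (cis t)) \<in> H2" "cmod z < 1 \<Longrightarrow> disc_value (\<lambda>t. F (cis t)) z = F z"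
    "fcoeff (\<lambda>t. F (cis t)) 0 = F 0"
    "((\<lambda>r. F (of_real r * cis t)) \<longlongrightarrow> F (cis t)) (at_left 1)"
proof -
  obtain c where c: "summable (\<lambda>n. cmod (c n))" "\<And>z. cmod z \<le> 1 \<Longrightarrow> (\<lambda>n. c n * z ^ n) sums F z"
    by (rule hol_closed_disc_power_series[OF assms]) blast
  have "continuous_on (sphere 0 1) F"
    using hol_closed_disc_isCont[OF assms] by (auto intro!: continuous_at_imp_continuous_on)
  then have m: "(\<lambda>t. F (cis t)) \<in> borel_measurable circ" by (rule measurable_comp_cis)
  note fc = power_series_fcoeff[OF c m]
  show "(\<lambda>t. F (cis t)) \<in> H2" using fc by (simp add: H2_def)
  show "disc_value (\<lambda>t. F (cis t)) z = F z" if "cmod z < 1"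
  proof -
    have "fcoeff (\<lambda>t. F (cis t)) (int n) = c n" for n using fc(2)[of "int n"] by simp
    then show ?thesis unfolding disc_value_def using sums_unique[OF c(2)[of z]] that by simp
  qed
  have "F 0 = c 0" using sums_unique2[OF c(2)[of 0] powser_sums_zero] by simp
  then show "fcoeff (\<lambda>t. F (cis t)) 0 = F 0" by (simp add: fc)
  have "((\<lambda>r. complex_of_real r * cis t) \<longlongrightarrow> of_real 1 * cis t) (at_left 1)"
    by (intro tendsto_intros)
  then have "((\<lambda>r. complex_of_real r * cis t) \<longlongrightarrow> cis t) (at_left 1)" by simp
  then show "((\<lambda>r. F (of_real r * cis t)) \<longlongrightarrow> F (cis t)) (at_left 1)"
    by (rule isCont_tendsto_compose[OF hol_closed_disc_isCont[OF assms], rotated]) simp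
qed

lemma bv_hol_closed_disc: assumes "hol_closed_disc F" shows "bv F t = F (cis t)"
  unfolding bv_def by (rule tendsto_Lim[OF _ hol_closed_disc_boundary(4)[OF assms]]) simp

section \<open>Moebius maps and Blaschke factors\<close>

lemma one_minus_mult_nz: assumes "cmod a < 1" "cmod z \<le> 1" shows "1 - cnj a * z \<noteq> 0"
proof
  assume "1 - cnj a * z = 0"
  then have "cmod (cnj a * z) = 1" by (metis eq_iff_diff_eq_0 norm_one)
  moreover have "cmod (cnj a * z) < 1"
    using assms mult_mono[of "cmod a" "cmod a" "cmod z" 1] by (simp add: norm_mult)
  ultimately show False by simp
qed

lemma hol_closed_disc_moebius:
  assumes "cmod a < 1" shows "hol_closed_disc (\<lambda>z. (z - a) / (1 - cnj a * z))"
proof (cases "a = 0")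
  case True
  then show ?thesis unfolding hol_closed_disc_def by (intro exI[of _ 2]) (auto intro!: holomorphic_intros)
next
  case False
  have "1 - cnj a * z \<noteq> 0" if "cmod z < 1 / cmod a" for z
  proof
    assume "1 - cnj a * z = 0"
    then have "cmod (cnj a * z) = 1" by (metis eq_iff_diff_eq_0 norm_one)
    then show False using that False by (simp add: norm_mult field_simps)
  qed
  then show ?thesis unfolding hol_closed_disc_def using False assms
    by (intro exI[of _ "1 / cmod a"]) (auto intro!: holomorphic_intros)
qed

text \<open>The constant relating \<open>blf a\<close> to the quotient with z - a on top, whence the
  sign. At a = 0 the convention in \<open>blf\<close> gives z, so the constant is 1.\<close>

definition blf_unit :: "complex \<Rightarrow> complex" where
  "blf_unit a = (if a = 0 then 1 else - cnj a / of_real (cmod a))"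

lemma norm_blf_unit: "cmod (blf_unit a) = 1"
  by (simp add: blf_unit_def norm_divide)

lemma blf_blf_unit: "blf a z = blf_unit a * ((z - a) / (1 - cnj a * z))"
  by (simp add: blf_def blf_unit_def) (simp add: field_simps)

lemma hol_closed_disc_blf: "cmod a < 1 \<Longrightarrow> hol_closed_disc (blf a)"
  unfolding blf_blf_unit[abs_def] by (intro hol_closed_disc_mult hol_closed_disc_const hol_closed_disc_moebius)

text \<open>On the circle, 1 - conj(a) z = z (conj(z) - conj(a)), which has the modulus of z -
  a.\<close>

lemma norm_moebius: assumes "cmod a < 1" shows "cmod ((cis t - a) / (1 - cnj a * cis t)) = 1"
proof -
  have "cmod (1 - cnj a * cis t) = cmod (cis t) * cmod (cnj (cis t) - cnj a)"
    unfolding norm_mult[symmetric]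
    by (simp add: right_diff_distrib mult.commute flip: complex_norm_square)
  also have "\<dots> = cmod (cis t - a)"
    by (simp flip: complex_cnj_diff)
  finally show ?thesis
    using one_minus_mult_nz[OF assms, of "cis t"] by (metis divide_self norm_divide norm_cis norm_eq_zero order_refl)
qed

lemma norm_blf: "cmod a < 1 \<Longrightarrow> cmod (blf a (cis t)) = 1"
  unfolding blf_blf_unit norm_mult norm_moebius norm_blf_unit by simp

text \<open>This is what the normalisation buys: the value at the origin is nonnegative, so the
  distance of a product of factors from 1 can be read off its mean value.\<close>

lemma blf_0: "blf a 0 = of_real (cmod a)"
proof (cases "a = 0")
  case False
  have "cnj a * a = of_real (cmod a) * of_real (cmod a)"
    using complex_norm_square[of a] by (simp add: power2_eq_square mult.commute)
  then show ?thesis using False by (simp add: blf_def)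
qed (simp add: blf_def)

text \<open>For nonzero a the difference is -(1 - |a|)(1 + conj(a) z/|a|) / (1 - conj(a) z), by
  conj(a) a = |a|^2. Summability of 1 - |a_j| thus gives absolute convergence of the product inside
  the disc.\<close>

lemma blf_minus_1:
  assumes a: "cmod a < 1" and z: "cmod z < 1"
  shows "cmod (blf a z - 1) \<le> (1 - cmod a) * (2 / (1 - cmod z))"
proof (cases "a = 0")
  case True
  have "cmod (z - 1) \<le> cmod z + 1" using norm_triangle_ineq4[of z 1] by simp
  also have "\<dots> \<le> 2" using z by simp
  also have "2 \<le> 2 / (1 - cmod z)" using z by (simp add: field_simps)
  finally show ?thesis using True by (simp add: blf_def)
next
  case False
  define m where "m = complex_of_real (cmod a)"
  have m: "m \<noteq> 0" using False by (simp add: m_def)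
  have aa: "cnj a * a = m * m"
    using complex_norm_square[of a] by (simp add: m_def power2_eq_square mult.commute)
  have nz: "1 - cnj a * z \<noteq> 0" using one_minus_mult_nz[OF a] z by simp
  have "cnj a / m * (a - z) - (1 - cnj a * z) = - ((1 - m) * (1 + cnj a * z / m))"
    using m aa by (simp add: field_simps)
  then have "blf a z - 1 = - ((1 - m) * (1 + cnj a * z / m)) / (1 - cnj a * z)"
  proof -
    assume E: "cnj a / m * (a - z) - (1 - cnj a * z) = - ((1 - m) * (1 + cnj a * z / m))"
    have "blf a z - 1 = (cnj a / m * (a - z) - (1 - cnj a * z)) / (1 - cnj a * z)"
    proof -
      have "blf a z = cnj a / m * (a - z) / (1 - cnj a * z)" using False by (simp add: blf_def m_def)
      moreover have "(1 - cnj a * z) / (1 - cnj a * z) = 1" using nz by (rule divide_self)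
      ultimately show ?thesis by (simp only: diff_divide_distrib[of _ "1 - cnj a * z"])
    qed
    then show ?thesis unfolding E .
  qed
  then have "cmod (blf a z - 1) = cmod (1 - m) * cmod (1 + cnj a * z / m) / cmod (1 - cnj a * z)"
    by (simp add: norm_divide norm_mult)
  also have "cmod (1 - m) = 1 - cmod a"
  proof -
    have "1 - m = of_real (1 - cmod a)" by (simp add: m_def)
    then have "cmod (1 - m) = \<bar>1 - cmod a\<bar>" by (simp only: norm_of_real)
    then show ?thesis using a by simp
  qed
  also have "(1 - cmod a) * cmod (1 + cnj a * z / m) / cmod (1 - cnj a * z) \<le> (1 - cmod a) * 2 / (1 - cmod z)"
  proof (rule frac_le)
    have "cmod (cnj a * z / m) \<le> 1" using z False by (simp add: norm_mult norm_divide m_def)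
    then have "cmod (1 + cnj a * z / m) \<le> 2" using norm_triangle_ineq[of 1 "cnj a * z / m"] by simp
    then show "(1 - cmod a) * cmod (1 + cnj a * z / m) \<le> (1 - cmod a) * 2" using a by (intro mult_left_mono) auto
    have "cmod (cnj a * z) \<le> cmod z" using a by (simp add: norm_mult mult_left_le_one_le)
    then show "1 - cmod z \<le> cmod (1 - cnj a * z)" using norm_triangle_ineq2[of 1 "cnj a * z"] by simp
  qed (use a z in auto)
  finally show ?thesis by simp
qed

text \<open>Evaluation at a point of the disc is L2-bounded: each coefficient is at most the norm,
  and a geometric series remains.\<close>

lemma disc_value_tendsto:
  assumes "\<And>n. L2 (Y n)" "L2 f" "(\<lambda>n. l2norm (\<lambda>t. Y n t - f t)) \<longlonglongrightarrow> 0" "cmod z < 1"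
  shows "(\<lambda>n. disc_value (Y n) z) \<longlonglongrightarrow> disc_value f z"
proof -
  have le: "cmod (disc_value (Y n) z - disc_value f z) \<le> l2norm (\<lambda>t. Y n t - f t) * (1 / (1 - cmod z))" for n
  proof -
    let ?d = "\<lambda>t. Y n t - f t"
    have d: "L2 ?d" using assms by (intro L2_diff)
    have g: "(\<lambda>k. l2norm ?d * cmod z ^ k) sums (l2norm ?d * (1 / (1 - cmod z)))"
      by (intro sums_mult geometric_sums) (use assms in simp)
    have "cmod (disc_value ?d z) \<le> (\<Sum>k. l2norm ?d * cmod z ^ k)"
      unfolding disc_value_def
      by (rule norm_suminf_le[OF _ sums_summable[OF g]])
         (use cmod_fcoeff_le[OF d] in \<open>simp add: norm_mult norm_power mult_right_mono\<close>)
    then show ?thesis unfolding sums_unique[OF g, symmetric] disc_value_diff[OF assms(1,2,4)] .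
  qed
  have lim: "(\<lambda>n. l2norm (\<lambda>t. Y n t - f t) * (1 / (1 - cmod z))) \<longlonglongrightarrow> 0"
    using tendsto_mult_right[OF assms(3), of "1 / (1 - cmod z)"] by simp
  have "(\<lambda>n. disc_value (Y n) z - disc_value f z) \<longlonglongrightarrow> 0"
    by (rule Lim_null_comparison[OF always_eventually[OF allI] lim]) (rule le)
  then show ?thesis by (simp add: LIM_zero_iff)
qed

lemma L2_tendsto_subseq_AE:
  assumes "\<And>n. L2 (Y n)" "L2 f" "(\<lambda>n. l2norm (\<lambda>t. Y n t - f t)) \<longlonglongrightarrow> 0"
  obtains m where "AE t in circ. (\<lambda>k. Y (m k) t) \<longlonglongrightarrow> f t"
proof -
  have "\<exists>m. l2norm (\<lambda>t. Y m t - f t) \<le> (1/2)^k" for k :: nat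
  proof -
    have "eventually (\<lambda>m. l2norm (\<lambda>t. Y m t - f t) < (1/2)^k) sequentially"
      by (rule order_tendstoD(2)[OF assms(3)]) simp
    then show ?thesis by (auto simp: eventually_sequentially intro: less_imp_le)
  qed
  then obtain m where m: "\<And>k::nat. l2norm (\<lambda>t. Y (m k) t - f t) \<le> (1/2)^k" by metis
  show ?thesis by (rule that[OF L2_fast_AE[OF assms(1) assms(2) m]])
qed

lemma H2_limit:
  assumes "\<And>n. Y n \<in> H2" "L2 f" "(\<lambda>n. l2norm (\<lambda>t. Y n t - f t)) \<longlonglongrightarrow> 0"
  shows "f \<in> H2"
proof -
  have "fcoeff f k = 0" if "k < 0" for k
  proof -
    have "(\<lambda>n. l2inner (Y n) (zpow k)) \<longlonglongrightarrow> l2inner f (zpow k)"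
      by (intro tendsto_l2inner_left assms H2_L2 L2_zpow)
    moreover have "l2inner (Y n) (zpow k) = 0" for n
      using assms(1)[of n] that by (simp add: H2_def fcoeff_eq_inner)
    ultimately show ?thesis by (simp add: LIMSEQ_const_iff fcoeff_eq_inner)
  qed
  then show ?thesis using assms(2) by (simp add: H2_def)
qed

section \<open>Convergence of a Blaschke product and of its boundary values\<close>

locale blaschke_data =
  fixes \<gamma> :: real and b :: "nat \<Rightarrow> complex" and S :: "nat set"
  assumes b: "\<And>j. j \<in> S \<Longrightarrow> cmod (b j) < 1"
    and summ: "summable (\<lambda>j. if j \<in> S then 1 - cmod (b j) else 0)"
begin

definition fac :: "nat \<Rightarrow> complex \<Rightarrow> complex" where
  "fac j z = (if j \<in> S then blf (b j) z else 1)"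

definition full_product :: "complex \<Rightarrow> complex" where
  "full_product z = cis \<gamma> * (\<Prod>j. fac j z)"

definition X :: "nat \<Rightarrow> real \<Rightarrow> complex" where
  "X N t = cis \<gamma> * (\<Prod>j<N. fac j (cis t))"

lemma hol_fac: "hol_closed_disc (fac j)"
  unfolding fac_def[abs_def] by (cases "j \<in> S") (auto intro: hol_closed_disc_blf b hol_closed_disc_const)

lemma norm_fac: "cmod (fac j (cis t)) = 1"
  by (simp add: fac_def norm_blf b)

lemma hol_part: "hol_closed_disc (\<lambda>z. c * (\<Prod>j\<in>F. fac j z))"
  by (intro hol_closed_disc_mult hol_closed_disc_const hol_closed_disc_prod hol_fac)

lemma X_H2: "X N \<in> H2"
  unfolding X_def[abs_def] using hol_closed_disc_boundary(1)[OF hol_part[of "cis \<gamma>" "{..<N}"]] .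

lemma norm_X: "cmod (X N t) = 1"
  by (simp add: X_def norm_mult norm_fac flip: prod_norm)

lemma X_disc_value: "cmod z < 1 \<Longrightarrow> disc_value (X N) z = cis \<gamma> * (\<Prod>j<N. fac j z)"
  unfolding X_def[abs_def] using hol_closed_disc_boundary(2)[OF hol_part[of "cis \<gamma>" "{..<N}"]] .

lemma X_radial: "((\<lambda>r. disc_value (X N) (of_real r * cis t)) \<longlongrightarrow> X N t) (at_left 1)"
proof -
  have "((\<lambda>r. cis \<gamma> * (\<Prod>j<N. fac j (of_real r * cis t))) \<longlongrightarrow> X N t) (at_left 1)"
    unfolding X_def using hol_closed_disc_boundary(4)[OF hol_part[of "cis \<gamma>" "{..<N}"]] .
  moreover have "eventually (\<lambda>r. cis \<gamma> * (\<Prod>j<N. fac j (of_real r * cis t)) = disc_value (X N) (of_real r * cis t)) (at_left 1)"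
  proof -
    have "eventually (\<lambda>r::real. r \<in> {0<..<1}) (at_left 1)" by (rule eventually_at_left_real) simp
    then show ?thesis by eventually_elim (simp add: X_disc_value norm_mult)
  qed
  ultimately show ?thesis by (rule Lim_transform_eventually)
qed

lemma full_product_tendsto: assumes "cmod z < 1" shows "(\<lambda>N. cis \<gamma> * (\<Prod>j<N. fac j z)) \<longlonglongrightarrow> full_product z"
proof -
  have "summable (\<lambda>j. norm (fac j z - 1))"
  proof (rule summable_comparison_test')
    show "summable (\<lambda>j. (if j \<in> S then 1 - cmod (b j) else 0) * (2 / (1 - cmod z)))"
      by (rule summable_mult2[OF summ])
    show "norm (norm (fac j z - 1)) \<le> (if j \<in> S then 1 - cmod (b j) else 0) * (2 / (1 - cmod z))" if "j \<ge> 0" for j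
      using blf_minus_1[OF b assms] by (auto simp: fac_def)
  qed
  then have "convergent_prod (\<lambda>j. fac j z)"
    by (intro abs_convergent_prod_imp_convergent_prod summable_imp_abs_convergent_prod)
  then have "(\<lambda>N. \<Prod>j\<le>N. fac j z) \<longlonglongrightarrow> (\<Prod>j. fac j z)"
    by (rule convergent_prod_LIMSEQ)
  then have "(\<lambda>N. \<Prod>j<Suc N. fac j z) \<longlonglongrightarrow> (\<Prod>j. fac j z)"
    by (simp add: lessThan_Suc_atMost)
  then have "(\<lambda>N. \<Prod>j<N. fac j z) \<longlonglongrightarrow> (\<Prod>j. fac j z)" by (rule LIMSEQ_imp_Suc)
  then show ?thesis unfolding full_product_def by (intro tendsto_intros)
qed

text \<open>\<open>X N\<close> is unimodular, so the distance is that of the tail \<open>T\<close>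
  from 1, whose square is 2 (1 - Re T(0)). The normalisation makes T(0) the product of the |b_j|,
  which is at least 1 minus the sum of the 1 - |b_j|.\<close>

lemma X_dist:
  assumes "N \<le> M"
  shows "(l2norm (\<lambda>t. X M t - X N t))\<^sup>2 \<le> 2 * (\<Sum>j\<in>{N..<M}. if j \<in> S then 1 - cmod (b j) else 0)"
proof -
  define T where "T = (\<lambda>t. 1 * (\<Prod>j\<in>{N..<M}. fac j (cis t)))"
  have T: "T \<in> H2" unfolding T_def by (rule hol_closed_disc_boundary(1)[OF hol_part])
  have T0: "fcoeff T 0 = (\<Prod>j\<in>{N..<M}. fac j 0)"
    unfolding T_def using hol_closed_disc_boundary(3)[OF hol_part[of 1 "{N..<M}"]] by simp
  have nT: "cmod (T t) = 1" for t by (simp add: T_def norm_fac flip: prod_norm)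
  have "X M t - X N t = X N t * (T t + (-1) * 1)" for t
  proof -
    have "{..<M} = {..<N} \<union> {N..<M}" using assms by auto
    then have "(\<Prod>j<M. fac j (cis t)) = (\<Prod>j<N. fac j (cis t)) * (\<Prod>j\<in>{N..<M}. fac j (cis t))"
      by (simp add: prod.union_disjoint ivl_disj_int)
    then show ?thesis by (simp add: X_def T_def algebra_simps)
  qed
  then have "l2norm (\<lambda>t. X M t - X N t) = l2norm (\<lambda>t. T t + (-1) * 1)"
    using l2norm_unimodular_mult[of "X N" "\<lambda>t. T t + (-1) * 1"] norm_X L2_measurable[OF H2_L2[OF X_H2]]
      L2_diff[OF H2_L2[OF T] L2_const[of 1]] by simp
  also have "\<dots>\<^sup>2 = (l2norm T)\<^sup>2 + 2 * Re (l2inner T (\<lambda>t. (-1) * 1)) + (l2norm (\<lambda>t. (-1) * 1))\<^sup>2"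
    by (rule l2norm_sq_expand[OF H2_L2[OF T] L2_const])
  also have "l2inner T (\<lambda>t. (-1) * 1) = - fcoeff T 0"
    unfolding fcoeff_eq_inner zpow_0_fun by (subst l2inner_cmult_right) simp
  also have "l2norm T = 1" unfolding l2norm_def nT by (simp add: measure_restrict_space)
  also have "l2norm (\<lambda>t. (-1) * 1) = 1" by (simp add: l2norm_def measure_restrict_space)
  also have "1\<^sup>2 + 2 * Re (- fcoeff T 0) + 1\<^sup>2 = 2 * (1 - Re (fcoeff T 0))" by simp
  also have "fcoeff T 0 = of_real (\<Prod>j\<in>{N..<M}. 1 - (if j \<in> S then 1 - cmod (b j) else 0))"
    unfolding T0 of_real_prod by (intro prod.cong) (auto simp: fac_def blf_0)
  finally have "(l2norm (\<lambda>t. X M t - X N t))\<^sup>2 = 2 * (1 - (\<Prod>j\<in>{N..<M}. 1 - (if j \<in> S then 1 - cmod (b j) else 0)))"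
    by (simp only: Re_complex_of_real)
  moreover have "1 - (\<Sum>j\<in>{N..<M}. if j \<in> S then 1 - cmod (b j) else 0) \<le> (\<Prod>j\<in>{N..<M}. 1 - (if j \<in> S then 1 - cmod (b j) else 0))"
    by (rule Weierstrass_prod_ineq) (use b in \<open>auto intro: less_imp_le\<close>)
  moreover have "x \<le> 2 * s" if "x = 2 * (1 - p)" "1 - s \<le> p" for x s p :: real
    using that by (simp add: algebra_simps)
  ultimately show ?thesis by blast
qed

lemma X_Cauchy:
  assumes "e > 0" shows "\<exists>M. \<forall>m\<ge>M. \<forall>n\<ge>M. l2norm (\<lambda>t. X m t - X n t) < e"
proof -
  define s where "s = (\<lambda>j. if j \<in> S then 1 - cmod (b j) else 0)"
  have "summable s" unfolding s_def by (rule summ)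
  then obtain K where K: "\<And>m n. m \<ge> K \<Longrightarrow> norm (sum s {m..<n}) < e\<^sup>2 / 2"
    using assms unfolding summable_Cauchy by (metis half_gt_zero zero_less_power)
  have *: "l2norm (\<lambda>t. X m t - X n t) < e" if "n \<ge> K" "n \<le> m" for m n
  proof (rule power2_less_imp_less)
    have "(l2norm (\<lambda>t. X m t - X n t))\<^sup>2 \<le> 2 * sum s {n..<m}"
      using X_dist[OF that(2)] by (simp add: s_def)
    also have "\<dots> < e\<^sup>2" using K[OF that(1), of m] unfolding real_norm_def by linarith
    finally show "(l2norm (\<lambda>t. X m t - X n t))\<^sup>2 < e\<^sup>2" .
  qed (use assms in simp)
  have "l2norm (\<lambda>t. X m t - X n t) < e" if "m \<ge> K" "n \<ge> K" for m n
    using *[of n m] *[of m n] that l2norm_minus_commute[of "X m" "X n"] by (cases "n \<le> m") auto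
  then show ?thesis by blast
qed

text \<open>The L2 limit f of the partial products is unimodular by an a.e. convergent subsequence.
  Inside the disc its extension is the infinite product, both being limits of the same values. Hence
  the radial limits of the product are those of f, which exist and equal f a.e. by
  \<open>Fatou_radial\<close>.\<close>

lemma bv_full_product:
  shows "inner_fn (bv full_product)" "(\<lambda>N. l2norm (\<lambda>t. X N t - bv full_product t)) \<longlonglongrightarrow> 0"
proof -
  have XL: "L2 (X N)" for N using X_H2 H2_L2 by blast
  obtain f where f: "L2 f" "(\<lambda>N. l2norm (\<lambda>t. X N t - f t)) \<longlonglongrightarrow> 0"
    by (rule L2_complete[OF XL X_Cauchy])
  have fH: "f \<in> H2" by (rule H2_limit[OF X_H2 f])
  obtain m where "AE t in circ. (\<lambda>k. X (m k) t) \<longlonglongrightarrow> f t"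
    by (rule L2_tendsto_subseq_AE[OF XL f])
  then have uni: "AE t in circ. cmod (f t) = 1"
  proof eventually_elim
    case (elim t)
    then have "(\<lambda>k. cmod (X (m k) t)) \<longlonglongrightarrow> cmod (f t)" by (rule tendsto_norm)
    then show ?case by (simp add: norm_X LIMSEQ_const_iff)
  qed
  have val: "disc_value f z = full_product z" if "cmod z < 1" for z
  proof -
    have "(\<lambda>N. disc_value (X N) z) \<longlonglongrightarrow> full_product z"
      using full_product_tendsto[OF that] unfolding X_disc_value[OF that] .
    with disc_value_tendsto[OF XL f that] show ?thesis by (rule LIMSEQ_unique)
  qed
  have "AE t in circ. ((\<lambda>r. disc_value f (of_real r * cis t)) \<longlongrightarrow> f t) (at_left 1)"
    by (rule Fatou_radial[OF fH X_H2 f(2) X_radial])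
  then have ae: "aeq f (bv full_product)"
    unfolding aeq_def
  proof eventually_elim
    case (elim t)
    have "eventually (\<lambda>r::real. r \<in> {0<..<1}) (at_left 1)" by (rule eventually_at_left_real) simp
    then have "eventually (\<lambda>r. disc_value f (of_real r * cis t) = full_product (of_real r * cis t)) (at_left 1)"
      by eventually_elim (auto intro!: val simp: norm_mult)
    then have "((\<lambda>r. full_product (of_real r * cis t)) \<longlongrightarrow> f t) (at_left 1)"
      by (rule Lim_transform_eventually[OF elim])
    then show ?case unfolding bv_def by (subst tendsto_Lim[of _ _ "f t"]) auto
  qed
  have L: "L2 (bv full_product)" using f ae L2_aeq by blast
  show "inner_fn (bv full_product)"
    unfolding inner_fn_def
  proof (intro conjI allI impI)
    show "bv full_product \<in> borel_measurable circ" using L by (rule L2_measurable)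
    show "AE t in circ. cmod (bv full_product t) = 1"
      using uni ae unfolding aeq_def by eventually_elim auto
    show "fcoeff (bv full_product) n = 0" if "n < 0" for n
      using fH that fcoeff_cong_AE[OF ae f(1), of n] by (simp add: H2_def)
  qed
  have "l2norm (\<lambda>t. X N t - f t) = l2norm (\<lambda>t. X N t - bv full_product t)" for N
  proof (rule l2norm_cong_AE)
    show "aeq (\<lambda>t. X N t - f t) (\<lambda>t. X N t - bv full_product t)"
      using ae unfolding aeq_def by eventually_elim simp
  qed (intro L2_diff XL f)
  then show "(\<lambda>N. l2norm (\<lambda>t. X N t - bv full_product t)) \<longlonglongrightarrow> 0" using f(2) by simp
qed

end

lemma is_blaschke_inner: assumes "is_blaschke \<beta>" shows "inner_fn (bv \<beta>)"
proof -
  obtain \<gamma> b S where \<beta>: "\<forall>j\<in>S. cmod (b j) < 1" "summable (\<lambda>j. if j \<in> S then 1 - cmod (b j) else 0)"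
     "\<beta> = (\<lambda>z. cis \<gamma> * (\<Prod>j. if j \<in> S then blf (b j) z else 1))"
    using assms unfolding is_blaschke_def by blast
  interpret blaschke_data \<gamma> b S by standard (use \<beta> in auto)
  have "\<beta> = full_product" unfolding \<beta>(3) full_product_def[abs_def] fac_def ..
  then show ?thesis using bv_full_product(1) by simp
qed

section \<open>Inner functions and the partial products of B\<close>

lemma inner_fn_H2: "inner_fn \<theta> \<Longrightarrow> \<theta> \<in> H2"
  unfolding inner_fn_def H2_def by (auto intro!: L2_bdd[where M=1] elim!: eventually_mono)

lemma inner_fn_measurable: "inner_fn \<theta> \<Longrightarrow> \<theta> \<in> borel_measurable circ"
  by (simp add: inner_fn_def)

lemma inner_fn_norm: "inner_fn \<theta> \<Longrightarrow> AE t in circ. cmod (\<theta> t) = 1"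
  by (simp add: inner_fn_def)

text \<open>\<open>Bpart\<close> omits the normalising factors, so it agrees with the normalised
  product only up to this constant, which need not converge with n.\<close>

definition unimod_part :: "(nat \<Rightarrow> complex) \<Rightarrow> nat \<Rightarrow> complex" where
  "unimod_part a n = (\<Prod>j<n. cnj (blf_unit (a j)))"

lemma norm_unimod_part: "cmod (unimod_part a n) = 1"
  by (simp add: unimod_part_def norm_blf_unit flip: prod_norm)

lemma Bpart_blf: "Bpart a n z = unimod_part a n * (\<Prod>j<n. blf (a j) z)"
proof -
  have "cnj (blf_unit (a j)) * blf_unit (a j) = 1" for j
    using complex_norm_square[of "blf_unit (a j)"] by (simp add: norm_blf_unit mult.commute)
  then have "cnj (blf_unit (a j)) * blf (a j) z = (z - a j) / (1 - cnj (a j) * z)" for j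
    unfolding blf_blf_unit by (simp flip: mult.assoc)
  then show ?thesis unfolding Bpart_def unimod_part_def by (simp flip: prod.distrib)
qed

lemma hol_Bpart: "\<forall>j. cmod (a j) < 1 \<Longrightarrow> hol_closed_disc (Bpart a n)"
  unfolding Bpart_def[abs_def] by (intro hol_closed_disc_prod hol_closed_disc_moebius) auto

lemma bv_Bpart: "\<forall>j. cmod (a j) < 1 \<Longrightarrow> bv (Bpart a n) = (\<lambda>t. Bpart a n (cis t))"
  using bv_hol_closed_disc[OF hol_Bpart] by auto

lemma norm_Bpart: "\<forall>j. cmod (a j) < 1 \<Longrightarrow> cmod (Bpart a n (cis t)) = 1"
  unfolding Bpart_def by (simp add: norm_moebius flip: prod_norm)

lemma is_blaschke_Bpart:
  assumes "\<forall>j. cmod (a j) < 1" shows "is_blaschke (Bpart a n)"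
proof -
  obtain \<gamma> where \<gamma>: "unimod_part a n = cis \<gamma>"
    using norm_unimod_part[of a n] by (metis complex_norm_eq_1_exp cis_conv_exp)
  have "summable (\<lambda>j. if j \<in> {..<n} then 1 - cmod (a j) else 0)"
    by (rule summable_finite[of "{..<n}"]) auto
  moreover have "Bpart a n = (\<lambda>z. cis \<gamma> * (\<Prod>j. if j \<in> {..<n} then blf (a j) z else 1))"
  proof
    fix z
    have "(\<Prod>j. if j \<in> {..<n} then blf (a j) z else 1) = (\<Prod>j<n. if j \<in> {..<n} then blf (a j) z else 1)"
      by (rule prodinf_finite) auto
    then show "Bpart a n z = cis \<gamma> * (\<Prod>j. if j \<in> {..<n} then blf (a j) z else 1)"
      by (simp add: Bpart_blf \<gamma>)
  qed
  ultimately show ?thesis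
    unfolding is_blaschke_def using assms by (intro exI[of _ \<gamma>] exI[of _ a] exI[of _ "{..<n}"]) auto
qed

text \<open>There is a zero at \<open>a 0\<close>, since n is positive, but the infinite disc cannot
  consist of the n zeros only.\<close>

lemma nonconstant_Bpart:
  assumes "\<forall>j. cmod (a j) < 1" "n \<ge> 1" shows "nonconstant_disc (Bpart a n)"
  unfolding nonconstant_disc_def
proof
  assume "\<exists>c. \<forall>z\<in>ball 0 1. Bpart a n z = c"
  then obtain c where c: "\<And>z. cmod z < 1 \<Longrightarrow> Bpart a n z = c" by auto
  have "Bpart a n (a 0) = 0" unfolding Bpart_def using assms(2) by (intro prod_zero) auto
  then have c0: "c = 0" using c[of "a 0"] assms(1) by simp
  have "infinite (ball (0::complex) 1)" using uncountable_ball[of 1 "0::complex"] uncountable_infinite by auto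
  then have "\<not> ball (0::complex) 1 \<subseteq> a ` {..<n}" using finite_subset by blast
  then obtain z where "z \<in> ball 0 1" and z': "z \<notin> a ` {..<n}" by blast
  then have z: "cmod z < 1" "z \<notin> a ` {..<n}" by auto
  have "Bpart a n z \<noteq> 0"
    unfolding Bpart_def using z assms(1) one_minus_mult_nz[of _ z] by auto
  then show False using c[OF z(1)] c0 by simp
qed

context
  fixes a :: "nat \<Rightarrow> complex" and \<gamma> :: real
  assumes a: "\<forall>j. cmod (a j) < 1" and summ: "summable (\<lambda>j. 1 - cmod (a j))"
begin

interpretation blaschke_data \<gamma> a UNIV
  by standard (use a summ in auto)

lemma full_product_blaschke: "full_product = blaschke \<gamma> a"
  by (simp add: full_product_def[abs_def] blaschke_def fac_def)

lemma inner_blaschke: "inner_fn (bv (blaschke \<gamma> a))"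
  using bv_full_product(1) unfolding full_product_blaschke .

lemma Bpart_partial: "Bpart a n (cis t) = unimod_part a n * cis (-\<gamma>) * X n t"
  unfolding Bpart_blf X_def fac_def by (simp add: cis_mult mult.assoc[symmetric])

lemma Bpart_approx:
  "(\<lambda>n. l2norm (\<lambda>t. cis \<gamma> * cnj (unimod_part a n) * Bpart a n (cis t) - bv (blaschke \<gamma> a) t)) \<longlonglongrightarrow> 0"
proof -
  have "cis \<gamma> * cnj (unimod_part a n) * Bpart a n (cis t) = X n t" for n t
  proof -
    have "cnj (unimod_part a n) * unimod_part a n = 1"
      using complex_norm_square[of "unimod_part a n"] by (simp add: norm_unimod_part mult.commute)
    moreover have "cis \<gamma> * cis (-\<gamma>) = 1" by (simp add: cis_mult)
    ultimately show ?thesis unfolding Bpart_partial by algebra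
  qed
  then show ?thesis using bv_full_product(2) unfolding full_product_blaschke by simp
qed

text \<open>Dividing a later partial product by \<open>Bpart a n\<close> leaves the factors from n
  on, times a constant. These finite products lie in \<open>H2\<close>, and \<open>H2\<close> is
  closed under L2 limits.\<close>

lemma Bpart_divides: "divides_inner (bv (Bpart a n)) (bv (blaschke \<gamma> a))"
proof -
  define B where "B = bv (blaschke \<gamma> a)"
  define P where "P = (\<lambda>t. cnj (Bpart a n (cis t)))"
  have B: "inner_fn B" unfolding B_def by (rule inner_blaschke)
  have Pm: "P \<in> borel_measurable circ"
    unfolding P_def by (intro L2_measurable L2_cnj H2_L2 hol_closed_disc_boundary(1) hol_Bpart a)
  have Pn: "cmod (P t) = 1" for t unfolding P_def using norm_Bpart[OF a] by simp
  have L: "L2 f \<Longrightarrow> L2 (\<lambda>t. P t * f t)" for f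
    by (rule L2_bdd_mult[OF Pm, of 1]) (auto simp: Pn)
  have XL: "L2 (X N)" for N using X_H2 H2_L2 by blast
  have BL: "L2 B" using inner_fn_H2[OF B] H2_L2 by blast
  have "(\<lambda>t. P t * B t) \<in> H2"
  proof (rule H2_limit)
    show "(\<lambda>t. P t * X (N + n) t) \<in> H2" for N
    proof -
      define c where "c = cnj (unimod_part a n * cis (-\<gamma>))"
      have "P t * X (N + n) t = c * (\<Prod>j\<in>{n..<N+n}. fac j (cis t))" for t
      proof -
        have "{..<N+n} = {..<n} \<union> {n..<N+n}" by auto
        then have "X (N + n) t = X n t * (\<Prod>j\<in>{n..<N+n}. fac j (cis t))"
          unfolding X_def by (simp add: prod.union_disjoint ivl_disj_int)
        moreover have "cnj (X n t) * X n t = 1"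
          using complex_norm_square[of "X n t"] by (simp add: norm_X mult.commute)
        ultimately show ?thesis unfolding P_def Bpart_partial c_def complex_cnj_mult by algebra
      qed
      then show ?thesis using hol_closed_disc_boundary(1)[OF hol_part[of c "{n..<N+n}"]] by simp
    qed
    show "L2 (\<lambda>t. P t * B t)" by (rule L[OF BL])
    have "l2norm (\<lambda>t. P t * X (N + n) t - P t * B t) = l2norm (\<lambda>t. X (N + n) t - B t)" for N
      using l2norm_unimodular_mult[of P "\<lambda>t. X (N + n) t - B t"] Pm Pn L2_diff[OF XL BL] by (simp add: right_diff_distrib)
    moreover have "(\<lambda>N. l2norm (\<lambda>t. X (N + n) t - B t)) \<longlonglongrightarrow> 0"
      using LIMSEQ_ignore_initial_segment[OF bv_full_product(2), of n] unfolding full_product_blaschke B_def .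
    ultimately show "(\<lambda>N. l2norm (\<lambda>t. P t * X (N + n) t - P t * B t)) \<longlonglongrightarrow> 0" by simp
  qed
  moreover have "AE t in circ. cmod (P t * B t) = 1"
    using inner_fn_norm[OF B] by eventually_elim (simp add: norm_mult Pn)
  ultimately have "inner_fn (\<lambda>t. P t * B t)"
    unfolding inner_fn_def H2_def using L2_measurable by blast
  then show ?thesis
    unfolding divides_inner_def P_def B_def bv_Bpart[OF a] .
qed

end

section \<open>Model spaces\<close>

lemma l2inner_tendsto:
  assumes X: "\<And>n. L2 (X n)" "L2 f" "(\<lambda>n. l2norm (\<lambda>t. X n t - f t)) \<longlonglongrightarrow> 0"
    and Y: "\<And>n. L2 (Y n)" "L2 g" "(\<lambda>n. l2norm (\<lambda>t. Y n t - g t)) \<longlonglongrightarrow> 0"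
  shows "(\<lambda>n. l2inner (X n) (Y n)) \<longlonglongrightarrow> l2inner f g"
proof -
  have XL: "L2 (\<lambda>t. X n t - f t)" and YL: "L2 (\<lambda>t. Y n t - g t)" for n
    using X Y by (auto intro: L2_diff)
  have "(\<lambda>n. l2inner (\<lambda>t. X n t - f t) (\<lambda>t. Y n t - g t)) \<longlonglongrightarrow> 0"
  proof (rule Lim_null_comparison[OF always_eventually[OF allI]])
    show "norm (l2inner (\<lambda>t. X n t - f t) (\<lambda>t. Y n t - g t)) \<le> l2norm (\<lambda>t. X n t - f t) * l2norm (\<lambda>t. Y n t - g t)" for n
      by (rule l2_Cauchy_Schwarz[OF XL YL])
    show "(\<lambda>n. l2norm (\<lambda>t. X n t - f t) * l2norm (\<lambda>t. Y n t - g t)) \<longlonglongrightarrow> 0"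
      using tendsto_mult[OF X(3) Y(3)] by simp
  qed
  from tendsto_add[OF tendsto_add[OF this tendsto_l2inner_left[OF X(1,2) Y(2) X(3)]] tendsto_l2inner_right[OF Y(1,2) X(2) Y(3)]]
  have "(\<lambda>n. l2inner (\<lambda>t. X n t - f t) (\<lambda>t. Y n t - g t) + l2inner (X n) g + l2inner f (Y n)) \<longlonglongrightarrow> 0 + l2inner f g + l2inner f g" .
  moreover have "l2inner (\<lambda>t. X n t - f t) (\<lambda>t. Y n t - g t) + l2inner (X n) g + l2inner f (Y n) = l2inner (X n) (Y n) + l2inner f g" for n
    unfolding l2inner_diff_left[OF X(1,2) YL] l2inner_diff_right[OF Y(1,2) X(1)] l2inner_diff_right[OF Y(1,2) X(2)] by simp
  ultimately have "(\<lambda>n. l2inner (X n) (Y n) + l2inner f g) \<longlonglongrightarrow> l2inner f g + l2inner f g" by simp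
  from tendsto_diff[OF this tendsto_const[of "l2inner f g"]] show ?thesis by simp
qed

lemma l2inner_unimodular_mult:
  assumes \<theta>: "\<theta> \<in> borel_measurable circ" "AE t in circ. cmod (\<theta> t) = 1" and "L2 f" "L2 g"
  shows "l2inner (\<lambda>t. \<theta> t * f t) (\<lambda>t. \<theta> t * g t) = l2inner f g"
proof -
  have "AE t in circ. cmod (\<theta> t) \<le> 1" using \<theta>(2) by eventually_elim simp
  then have L: "L2 (\<lambda>t. \<theta> t * f t)" "L2 (\<lambda>t. \<theta> t * g t)"
    using L2_bdd_mult[OF \<theta>(1)] assms by blast+
  have "(LINT t|circ. \<theta> t * f t * cnj (\<theta> t * g t)) = (LINT t|circ. f t * cnj (g t))"
  proof (rule integral_cong_AE)
    show "AE t in circ. \<theta> t * f t * cnj (\<theta> t * g t) = f t * cnj (g t)"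
      using \<theta>(2)
    proof eventually_elim
      case (elim t)
      then have "\<theta> t * cnj (\<theta> t) = 1" using complex_norm_square[of "\<theta> t"] by simp
      then show ?case by (simp add: algebra_simps)
    qed
  qed (intro borel_measurable_integrable L2_inner_integrable L assms)+
  then show ?thesis by (simp only: l2inner_def)
qed

lemma inner_fn_L2_mult: "inner_fn \<theta> \<Longrightarrow> L2 f \<Longrightarrow> L2 (\<lambda>t. \<theta> t * f t)"
  by (rule L2_bdd_mult[OF inner_fn_measurable, of _ 1]) (auto dest!: inner_fn_norm elim!: eventually_mono)

lemma inner_fn_cnj_L2_mult: "inner_fn \<theta> \<Longrightarrow> L2 f \<Longrightarrow> L2 (\<lambda>t. cnj (\<theta> t) * f t)"
  by (rule L2_bdd_mult[OF L2_measurable[OF L2_cnj[OF H2_L2[OF inner_fn_H2]]], of _ 1])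
     (auto dest!: inner_fn_norm elim!: eventually_mono)

lemma inner_fn_cnj_mult: "inner_fn \<theta> \<Longrightarrow> AE t in circ. cnj (\<theta> t) * \<theta> t = 1"
proof -
  assume "inner_fn \<theta>"
  from inner_fn_norm[OF this] show ?thesis
  proof eventually_elim
    case (elim t)
    then show ?case using complex_norm_square[of "\<theta> t"] by (simp add: mult.commute)
  qed
qed

text \<open>With \<theta> moved to the other side, the question concerns conj(\<theta>) z^n for n <
  0, which has only negative frequencies.\<close>

lemma inner_fn_H2_mult:
  assumes \<theta>: "inner_fn \<theta>" and g: "g \<in> H2" shows "(\<lambda>t. \<theta> t * g t) \<in> H2"
proof -
  have "fcoeff (\<lambda>t. \<theta> t * g t) n = 0" if n: "n < 0" for n
  proof -
    have "fcoeff (\<lambda>t. \<theta> t * g t) n = l2inner g (\<lambda>t. cnj (\<theta> t) * zpow n t)"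
      unfolding fcoeff_eq_inner by (rule l2inner_mult_swap)
    also have "\<dots> = 0"
    proof (rule H2_inner_zero(1)[OF g])
      show "L2 (\<lambda>t. cnj (\<theta> t) * zpow n t)" by (rule inner_fn_cnj_L2_mult[OF \<theta> L2_zpow])
      fix k :: int assume "k \<ge> 0"
      have "fcoeff (\<lambda>t. cnj (\<theta> t) * zpow n t) k = fcoeff (\<lambda>t. zpow n t * cnj (\<theta> t)) k"
        by (simp only: mult.commute)
      also have "\<dots> = cnj (fcoeff \<theta> (n - k))" by (simp add: fcoeff_zpow_mult fcoeff_cnj)
      also have "\<dots> = 0" using \<theta> n \<open>k \<ge> 0\<close> by (simp add: inner_fn_def)
      finally show "fcoeff (\<lambda>t. cnj (\<theta> t) * zpow n t) k = 0" .
    qed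
    finally show ?thesis .
  qed
  then show ?thesis using inner_fn_L2_mult[OF \<theta> H2_L2[OF g]] by (simp add: H2_def)
qed

section \<open>The model space and its projection\<close>

lemma K_H2: "f \<in> Kspace \<theta> \<Longrightarrow> f \<in> H2"
  by (simp add: Kspace_def)

lemma K_L2: "f \<in> Kspace \<theta> \<Longrightarrow> L2 f"
  by (simp add: Kspace_def H2_def)

lemma K_orth: "f \<in> Kspace \<theta> \<Longrightarrow> g \<in> H2 \<Longrightarrow> l2inner f (\<lambda>t. \<theta> t * g t) = 0"
  by (simp add: Kspace_def)

lemma K_orth': "f \<in> Kspace \<theta> \<Longrightarrow> g \<in> H2 \<Longrightarrow> l2inner (\<lambda>t. \<theta> t * g t) f = 0"
  by (metis K_orth l2inner_cnj complex_cnj_zero)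

lemma K_lincomb:
  assumes "inner_fn \<theta>" "f \<in> Kspace \<theta>" "g \<in> Kspace \<theta>" shows "(\<lambda>t. f t + c * g t) \<in> Kspace \<theta>"
  using assms unfolding Kspace_def
  by (auto intro!: H2_add H2_cmult simp: l2inner_add_left l2inner_cmult_left H2_L2 L2_cmult inner_fn_L2_mult)

lemma K_zero: "(\<lambda>t. 0) \<in> Kspace \<theta>"
  by (simp add: Kspace_def H2_zero)

lemma K_cmult: "f \<in> Kspace \<theta> \<Longrightarrow> (\<lambda>t. c * f t) \<in> Kspace \<theta>"
  by (simp add: Kspace_def H2_cmult l2inner_cmult_left)

lemma K_add: "inner_fn \<theta> \<Longrightarrow> f \<in> Kspace \<theta> \<Longrightarrow> g \<in> Kspace \<theta> \<Longrightarrow> (\<lambda>t. f t + g t) \<in> Kspace \<theta>"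
  using K_lincomb[of \<theta> f g 1] by simp

lemma K_diff: "inner_fn \<theta> \<Longrightarrow> f \<in> Kspace \<theta> \<Longrightarrow> g \<in> Kspace \<theta> \<Longrightarrow> (\<lambda>t. f t - g t) \<in> Kspace \<theta>"
  using K_lincomb[of \<theta> f g "-1"] by simp

lemma K_sum: "inner_fn \<theta> \<Longrightarrow> (\<And>i. i \<in> I \<Longrightarrow> f i \<in> Kspace \<theta>) \<Longrightarrow> (\<lambda>t. \<Sum>i\<in>I. f i t) \<in> Kspace \<theta>"
  by (induction I rule: infinite_finite_induct) (auto intro: K_add K_zero)

text \<open>With P the Riesz projection, the projection onto the model space is P f - \<theta>
  P(conj(\<theta>) f): the second term removes exactly the part of P f in \<theta> H2.\<close>

lemma K_projection_exists:
  assumes \<theta>: "inner_fn \<theta>" and f: "L2 f"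
  shows "\<exists>g. g \<in> Kspace \<theta> \<and> (\<forall>h\<in>Kspace \<theta>. l2inner (\<lambda>t. f t - g t) h = 0)"
proof -
  obtain p where p: "p \<in> H2" "\<And>h. h \<in> H2 \<Longrightarrow> l2inner p h = l2inner f h"
    by (rule Riesz_projection[OF f]) blast
  have cf: "L2 (\<lambda>t. cnj (\<theta> t) * f t)" by (rule inner_fn_cnj_L2_mult[OF \<theta> f])
  obtain q where q: "q \<in> H2" "\<And>h. h \<in> H2 \<Longrightarrow> l2inner q h = l2inner (\<lambda>t. cnj (\<theta> t) * f t) h"
    by (rule Riesz_projection[OF cf]) blast
  define g where "g = (\<lambda>t. p t - \<theta> t * q t)"
  have qL: "L2 q" and pL: "L2 p" and qt: "(\<lambda>t. \<theta> t * q t) \<in> H2"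
    using p q \<theta> by (auto intro: H2_L2 inner_fn_H2_mult)
  have qtL: "L2 (\<lambda>t. \<theta> t * q t)" using qt by (rule H2_L2)
  have gH: "g \<in> H2" unfolding g_def by (rule H2_diff[OF p(1) qt])
  have "l2inner g (\<lambda>t. \<theta> t * h t) = 0" if h: "h \<in> H2" for h
  proof -
    have th: "(\<lambda>t. \<theta> t * h t) \<in> H2" by (rule inner_fn_H2_mult[OF \<theta> h])
    have "l2inner g (\<lambda>t. \<theta> t * h t) = l2inner p (\<lambda>t. \<theta> t * h t) - l2inner (\<lambda>t. \<theta> t * q t) (\<lambda>t. \<theta> t * h t)"
      unfolding g_def by (rule l2inner_diff_left[OF pL qtL H2_L2[OF th]])
    also have "l2inner (\<lambda>t. \<theta> t * q t) (\<lambda>t. \<theta> t * h t) = l2inner q h"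
      by (rule l2inner_unimodular_mult[OF inner_fn_measurable[OF \<theta>] inner_fn_norm[OF \<theta>] qL H2_L2[OF h]])
    also have "l2inner q h = l2inner (\<lambda>t. cnj (\<theta> t) * f t) h" by (rule q(2)[OF h])
    also have "\<dots> = l2inner f (\<lambda>t. \<theta> t * h t)" by (subst l2inner_mult_swap) simp
    also have "l2inner p (\<lambda>t. \<theta> t * h t) = l2inner f (\<lambda>t. \<theta> t * h t)" by (rule p(2)[OF th])
    finally show ?thesis by simp
  qed
  then have "g \<in> Kspace \<theta>" using gH by (simp add: Kspace_def)
  moreover have "l2inner (\<lambda>t. f t - g t) h = 0" if h: "h \<in> Kspace \<theta>" for h
  proof -
    have hL: "L2 h" using h by (rule K_L2)
    have "l2inner (\<lambda>t. f t - g t) h = l2inner f h - (l2inner p h - l2inner (\<lambda>t. \<theta> t * q t) h)"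
      unfolding l2inner_diff_left[OF f H2_L2[OF gH] hL] unfolding g_def l2inner_diff_left[OF pL qtL hL] ..
    then show ?thesis using p(2)[OF K_H2[OF h]] K_orth'[OF h q(1)] by simp
  qed
  ultimately show ?thesis by blast
qed

lemma proj_K:
  assumes "inner_fn \<theta>" "L2 f"
  shows "proj (Kspace \<theta>) f \<in> Kspace \<theta>"
    "h \<in> Kspace \<theta> \<Longrightarrow> l2inner (proj (Kspace \<theta>) f) h = l2inner f h"
    "h \<in> Kspace \<theta> \<Longrightarrow> l2inner h (proj (Kspace \<theta>) f) = l2inner h f"
proof -
  have *: "proj (Kspace \<theta>) f \<in> Kspace \<theta> \<and> (\<forall>h\<in>Kspace \<theta>. l2inner (\<lambda>t. f t - proj (Kspace \<theta>) f t) h = 0)"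
    unfolding proj_def by (rule someI_ex[OF K_projection_exists[OF assms]])
  then show p: "proj (Kspace \<theta>) f \<in> Kspace \<theta>" by blast
  show q: "l2inner (proj (Kspace \<theta>) f) h = l2inner f h" if "h \<in> Kspace \<theta>" for h
    using * that l2inner_diff_left[OF assms(2) K_L2[OF p] K_L2[OF that]] by simp
  show "l2inner h (proj (Kspace \<theta>) f) = l2inner h f" if "h \<in> Kspace \<theta>"
    using q[OF that] by (metis l2inner_cnj)
qed

lemma K_eq_of_inner:
  assumes "inner_fn \<theta>" "f \<in> Kspace \<theta>" "g \<in> Kspace \<theta>" "\<And>h. h \<in> Kspace \<theta> \<Longrightarrow> l2inner f h = l2inner g h"
  shows "aeq f g"
proof -
  let ?d = "\<lambda>t. f t - g t"
  have d: "?d \<in> Kspace \<theta>" by (rule K_diff[OF assms(1-3)])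
  have "l2inner ?d ?d = l2inner f ?d - l2inner g ?d"
    by (rule l2inner_diff_left[OF K_L2[OF assms(2)] K_L2[OF assms(3)] K_L2[OF d]])
  also have "\<dots> = 0" using assms(4)[OF d] by simp
  finally have "complex_of_real ((l2norm ?d)\<^sup>2) = 0" unfolding l2inner_self .
  then have "l2norm ?d = 0" by simp
  then have "aeq ?d (\<lambda>t. 0)" using l2norm_eq_0_iff[OF K_L2[OF d]] by blast
  then show ?thesis unfolding aeq_def by eventually_elim simp
qed

section \<open>The conjugation and symmetric compressions\<close>

lemma Cconj_alt: "Cconj \<theta> f = (\<lambda>t. \<theta> t * cnj (zpow 1 t * f t))"
  by (simp add: Cconj_def zpow_1)

lemma L2_Cconj: "inner_fn \<theta> \<Longrightarrow> L2 f \<Longrightarrow> L2 (Cconj \<theta> f)"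
  unfolding Cconj_alt by (intro inner_fn_L2_mult L2_cnj L2_zpow_mult)

text \<open>The conjugation exchanges the two conditions defining the space: orthogonality to
  \<theta> H2 becomes absence of negative frequencies, and conversely.\<close>

lemma Cconj_K:
  assumes \<theta>: "inner_fn \<theta>" and f: "f \<in> Kspace \<theta>" shows "Cconj \<theta> f \<in> Kspace \<theta>"
proof -
  have fL: "L2 f" using f by (rule K_L2)
  have "fcoeff (Cconj \<theta> f) n = 0" if n: "n < 0" for n
  proof -
    have "fcoeff (Cconj \<theta> f) n = l2inner (\<lambda>t. \<theta> t * zpow (- n - 1) t) f"
      unfolding fcoeff_eq_inner l2inner_def Cconj_alt
      by (intro arg_cong2[where f = "(/)"] Bochner_Integration.integral_cong refl)
         (simp add: zpow_diff cnj_zpow[of n] mult_ac)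
    also have "\<dots> = 0" using K_orth'[OF f H2_zpow[of "- n - 1"]] n by simp
    finally show ?thesis .
  qed
  then have H: "Cconj \<theta> f \<in> H2" using L2_Cconj[OF \<theta> fL] by (simp add: H2_def)
  have "l2inner (Cconj \<theta> f) (\<lambda>t. \<theta> t * g t) = 0" if g: "g \<in> H2" for g
  proof -
    have "l2inner (Cconj \<theta> f) (\<lambda>t. \<theta> t * g t) = l2inner (\<lambda>t. cnj (zpow 1 t * f t)) g"
      unfolding Cconj_alt
      by (rule l2inner_unimodular_mult[OF inner_fn_measurable[OF \<theta>] inner_fn_norm[OF \<theta>]])
         (intro L2_cnj L2_zpow_mult fL, rule H2_L2[OF g])
    also have "\<dots> = 0"
    proof (rule H2_inner_zero(2)[OF g])
      show "L2 (\<lambda>t. cnj (zpow 1 t * f t))" by (intro L2_cnj L2_zpow_mult fL)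
      show "fcoeff (\<lambda>t. cnj (zpow 1 t * f t)) n = 0" if "n \<ge> 0" for n
        unfolding fcoeff_cnj fcoeff_zpow_mult using K_H2[OF f] that by (simp add: H2_def)
    qed
    finally show ?thesis .
  qed
  then show ?thesis using H by (simp add: Kspace_def)
qed

lemma l2inner_Cconj_swap: "l2inner (Cconj \<theta> u) g = l2inner (Cconj \<theta> g) u"
  unfolding l2inner_def Cconj_def
  by (intro arg_cong2[where f = "(/)"] Bochner_Integration.integral_cong refl) (simp add: mult_ac)

lemma l2norm_Cconj_diff:
  assumes "inner_fn \<theta>" "L2 f" "L2 g"
  shows "l2norm (\<lambda>t. Cconj \<theta> f t - Cconj \<theta> g t) = l2norm (\<lambda>t. f t - g t)"
proof -
  let ?d = "\<lambda>t. f t - g t"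
  have d: "L2 ?d" using assms by (intro L2_diff)
  have "l2norm (\<lambda>t. Cconj \<theta> f t - Cconj \<theta> g t) = l2norm (\<lambda>t. \<theta> t * cnj (zpow 1 t * ?d t))"
    unfolding Cconj_alt by (simp add: algebra_simps)
  also have "\<dots> = l2norm (\<lambda>t. cnj (zpow 1 t * ?d t))"
    by (rule l2norm_unimodular_mult[OF inner_fn_norm[OF assms(1)] inner_fn_measurable[OF assms(1)]])
       (intro L2_cnj L2_zpow_mult d)
  also have "\<dots> = l2norm ?d" unfolding l2norm_cnj by (rule l2norm_zpow_mult[OF d])
  finally show ?thesis .
qed

text \<open>Pairing with vectors of the space absorbs the projection, and
  \<open>l2inner_Cconj_swap\<close> removes the outer conjugation. \<open>A\<close> need only take
  values in L2, because it usually maps the small space into a larger one.\<close>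

lemma C_symmetric_iff:
  assumes \<theta>: "inner_fn \<theta>" and A: "\<And>f. f \<in> Kspace \<theta> \<Longrightarrow> L2 (A f)"
  shows "C_symmetric \<theta> (compress (Kspace \<theta>) A) \<longleftrightarrow>
    (\<forall>f\<in>Kspace \<theta>. \<forall>g\<in>Kspace \<theta>. l2inner (A (Cconj \<theta> f)) (Cconj \<theta> g) = l2inner (A g) f)"
proof -
  have "l2inner (Cconj \<theta> (compress (Kspace \<theta>) A (Cconj \<theta> f))) g = l2inner f (compress (Kspace \<theta>) A g)
    \<longleftrightarrow> l2inner (A (Cconj \<theta> f)) (Cconj \<theta> g) = l2inner (A g) f"
    if f: "f \<in> Kspace \<theta>" and g: "g \<in> Kspace \<theta>" for f g
  proof -
    have "l2inner (Cconj \<theta> (compress (Kspace \<theta>) A (Cconj \<theta> f))) g = l2inner (Cconj \<theta> g) (A (Cconj \<theta> f))"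
      unfolding l2inner_Cconj_swap[of \<theta> _ g] compress_def
      by (rule proj_K(3)[OF \<theta> A[OF Cconj_K[OF \<theta> f]] Cconj_K[OF \<theta> g]])
    moreover have "l2inner f (compress (Kspace \<theta>) A g) = l2inner f (A g)"
      unfolding compress_def by (rule proj_K(3)[OF \<theta> A[OF g] f])
    ultimately show ?thesis by (metis l2inner_cnj)
  qed
  then show ?thesis unfolding C_symmetric_def by simp
qed

lemma K_subset:
  assumes "inner_fn \<beta>" "divides_inner \<beta> \<theta>"
  shows "Kspace \<beta> \<subseteq> Kspace \<theta>"
proof
  fix f assume f: "f \<in> Kspace \<beta>"
  have \<eta>: "inner_fn (\<lambda>t. cnj (\<beta> t) * \<theta> t)" using assms(2) by (simp add: divides_inner_def)
  have "l2inner f (\<lambda>t. \<theta> t * g t) = 0" if g: "g \<in> H2" for g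
  proof -
    have h: "(\<lambda>t. (cnj (\<beta> t) * \<theta> t) * g t) \<in> H2" by (rule inner_fn_H2_mult[OF \<eta> g])
    have "l2inner f (\<lambda>t. \<beta> t * ((cnj (\<beta> t) * \<theta> t) * g t)) = l2inner f (\<lambda>t. \<theta> t * g t)"
    proof (rule l2inner_cong_AE[OF aeq_refl])
      show "aeq (\<lambda>t. \<beta> t * ((cnj (\<beta> t) * \<theta> t) * g t)) (\<lambda>t. \<theta> t * g t)"
        unfolding aeq_def using inner_fn_cnj_mult[OF assms(1)]
        by eventually_elim (metis mult.assoc mult.commute mult_1)
      show "L2 f" using f by (rule K_L2)
      show "L2 (\<lambda>t. \<beta> t * ((cnj (\<beta> t) * \<theta> t) * g t))" by (rule inner_fn_L2_mult[OF assms(1) H2_L2[OF h]])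
    qed
    then show ?thesis using K_orth[OF f h] by simp
  qed
  then show "f \<in> Kspace \<theta>" using K_H2[OF f] by (simp add: Kspace_def)
qed

section \<open>Bounded vectors and Riesz representation in a model space\<close>

definition ae_bounded :: "(real \<Rightarrow> complex) \<Rightarrow> bool" where
  "ae_bounded f \<longleftrightarrow> f \<in> borel_measurable circ \<and> (\<exists>M. AE t in circ. cmod (f t) \<le> M)"

lemma ae_bounded_L2_mult: "ae_bounded h \<Longrightarrow> L2 f \<Longrightarrow> L2 (\<lambda>t. h t * f t)"
  unfolding ae_bounded_def using L2_bdd_mult by blast

lemma ae_bounded_add: assumes "ae_bounded f" "ae_bounded g" shows "ae_bounded (\<lambda>t. f t + g t)"
proof -
  obtain M N where "AE t in circ. cmod (f t) \<le> M" "AE t in circ. cmod (g t) \<le> N"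
    using assms unfolding ae_bounded_def by blast
  then have "AE t in circ. cmod (f t + g t) \<le> M + N"
    by eventually_elim (metis norm_triangle_mono)
  then show ?thesis using assms unfolding ae_bounded_def by (auto intro: borel_measurable_add)
qed

lemma ae_bounded_mult: assumes "ae_bounded f" "ae_bounded g" shows "ae_bounded (\<lambda>t. f t * g t)"
proof -
  obtain M N where "AE t in circ. cmod (f t) \<le> M" "AE t in circ. cmod (g t) \<le> N"
    using assms unfolding ae_bounded_def by blast
  then have "AE t in circ. cmod (f t * g t) \<le> \<bar>M\<bar> * \<bar>N\<bar>"
    unfolding norm_mult by eventually_elim (intro mult_mono, auto)
  then show ?thesis using assms unfolding ae_bounded_def by (auto intro: borel_measurable_times)
qed

lemma ae_bounded_const: "ae_bounded (\<lambda>t. c)"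
  unfolding ae_bounded_def by auto

lemma ae_bounded_zpow: "ae_bounded (zpow n)"
  unfolding ae_bounded_def by (auto intro!: exI[of _ 1])

lemma ae_bounded_inner: "inner_fn \<theta> \<Longrightarrow> ae_bounded \<theta>"
proof -
  assume \<theta>: "inner_fn \<theta>"
  have "AE t in circ. cmod (\<theta> t) \<le> 1" using inner_fn_norm[OF \<theta>] by eventually_elim simp
  then show ?thesis using inner_fn_measurable[OF \<theta>] unfolding ae_bounded_def by blast
qed

lemma ae_bounded_cnj: "ae_bounded f \<Longrightarrow> ae_bounded (\<lambda>t. cnj (f t))"
  unfolding ae_bounded_def complex_mod_cnj
  using measurable_compose[OF _ borel_measurable_continuous_onI[OF continuous_on_cnj[OF continuous_on_id]]] by blast

lemma ae_bounded_sum: "(\<And>i. i \<in> I \<Longrightarrow> ae_bounded (f i)) \<Longrightarrow> ae_bounded (\<lambda>t. \<Sum>i\<in>I. f i t)"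
  by (induction I rule: infinite_finite_induct) (auto intro: ae_bounded_const ae_bounded_add)

lemma ae_bounded_Cconj: "inner_fn \<theta> \<Longrightarrow> ae_bounded f \<Longrightarrow> ae_bounded (Cconj \<theta> f)"
  unfolding Cconj_alt by (rule ae_bounded_mult[OF ae_bounded_inner ae_bounded_cnj[OF ae_bounded_mult[OF ae_bounded_zpow]]])

text \<open>The projection of \<open>z\<^sup>m\<close> onto the model space, which is bounded.\<close>

definition K_monomial :: "(real \<Rightarrow> complex) \<Rightarrow> nat \<Rightarrow> real \<Rightarrow> complex" where
  "K_monomial \<theta> m t = zpow (int m) t - \<theta> t * (\<Sum>k\<le>m. cnj (fcoeff \<theta> (int m - int k)) * zpow (int k) t)"

lemma K_monomial_poly_H2: "(\<lambda>t. \<Sum>k\<le>m. c k * zpow (int k) t) \<in> H2"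
  by (intro H2_sum H2_cmult H2_zpow) auto

text \<open>Write the function as \<theta> \<open>d\<close>, where \<open>d\<close> is
  conj(\<theta>) z^m minus its analytic part; the latter has degree at most m because \<theta> is
  analytic. So \<open>d\<close> has only negative frequencies, and \<theta> \<open>d\<close> is
  orthogonal to \<theta> H2.\<close>

lemma K_monomial_K:
  assumes \<theta>: "inner_fn \<theta>" shows "K_monomial \<theta> m \<in> Kspace \<theta>"
proof -
  define p where "p = (\<lambda>t. \<Sum>k\<le>m. cnj (fcoeff \<theta> (int m - int k)) * zpow (int k) t)"
  have p: "p \<in> H2" unfolding p_def by (rule K_monomial_poly_H2)
  have km: "K_monomial \<theta> m = (\<lambda>t. zpow (int m) t - \<theta> t * p t)" by (simp add: K_monomial_def[abs_def] p_def)
  have cz: "L2 (\<lambda>t. cnj (\<theta> t) * zpow (int m) t)" by (rule inner_fn_cnj_L2_mult[OF \<theta> L2_zpow])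
  define d where "d = (\<lambda>t. cnj (\<theta> t) * zpow (int m) t - p t)"
  have d: "L2 d" unfolding d_def by (rule L2_diff[OF cz H2_L2[OF p]])
  have dz: "fcoeff d n = 0" if "n \<ge> 0" for n
  proof -
    have "fcoeff (\<lambda>t. cnj (\<theta> t) * zpow (int m) t) n = fcoeff (\<lambda>t. zpow (int m) t * cnj (\<theta> t)) n"
      by (simp only: mult.commute)
    also have "\<dots> = cnj (fcoeff \<theta> (int m - n))" by (simp add: fcoeff_zpow_mult fcoeff_cnj)
    finally have 1: "fcoeff (\<lambda>t. cnj (\<theta> t) * zpow (int m) t) n = cnj (fcoeff \<theta> (int m - n))" .
    have "p = (\<lambda>t. \<Sum>k\<in>int ` {..m}. cnj (fcoeff \<theta> (int m - k)) * zpow k t)"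
      unfolding p_def by (subst sum.reindex) auto
    then have 2: "fcoeff p n = (if n \<in> int ` {..m} then cnj (fcoeff \<theta> (int m - n)) else 0)"
      by (simp add: fcoeff_trig_sum)
    have "fcoeff \<theta> (int m - n) = 0" if "n \<notin> int ` {..m}"
    proof -
      have "n > int m"
      proof (rule ccontr)
        assume "\<not> n > int m"
        then have "n = int (nat n)" "nat n \<le> m" using \<open>n \<ge> 0\<close> by auto
        then show False using that by blast
      qed
      then show ?thesis using \<theta> by (simp add: inner_fn_def)
    qed
    then show ?thesis unfolding d_def fcoeff_diff[OF cz H2_L2[OF p]] 1 2 by simp
  qed
  have "l2inner (K_monomial \<theta> m) (\<lambda>t. \<theta> t * g t) = 0" if g: "g \<in> H2" for g
  proof -
    have "l2inner (\<lambda>t. \<theta> t * d t) (\<lambda>t. \<theta> t * g t) = l2inner (K_monomial \<theta> m) (\<lambda>t. \<theta> t * g t)"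
    proof (rule l2inner_cong_AE[OF _ aeq_refl])
      show "aeq (\<lambda>t. \<theta> t * d t) (K_monomial \<theta> m)"
        unfolding aeq_def km d_def using inner_fn_cnj_mult[OF \<theta>]
        by eventually_elim (simp add: right_diff_distrib, metis mult.assoc mult.commute mult_1)
    qed (intro inner_fn_L2_mult \<theta> d H2_L2[OF g])+
    also have "l2inner (\<lambda>t. \<theta> t * d t) (\<lambda>t. \<theta> t * g t) = l2inner d g"
      by (rule l2inner_unimodular_mult[OF inner_fn_measurable[OF \<theta>] inner_fn_norm[OF \<theta>] d H2_L2[OF g]])
    also have "l2inner d g = 0" by (rule H2_inner_zero(2)[OF g d dz])
    finally show ?thesis by simp
  qed
  moreover have "K_monomial \<theta> m \<in> H2" unfolding km by (rule H2_diff[OF H2_zpow inner_fn_H2_mult[OF \<theta> p]]) simp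
  ultimately show ?thesis by (simp add: Kspace_def)
qed

lemma K_monomial_bdd: "inner_fn \<theta> \<Longrightarrow> ae_bounded (K_monomial \<theta> m)"
proof -
  assume \<theta>: "inner_fn \<theta>"
  have "ae_bounded (\<lambda>t. zpow (int m) t + \<theta> t * (\<Sum>k\<le>m. (- cnj (fcoeff \<theta> (int m - int k))) * zpow (int k) t))"
    by (intro ae_bounded_add ae_bounded_mult ae_bounded_zpow ae_bounded_inner \<theta> ae_bounded_sum ae_bounded_const)
  then show ?thesis by (simp add: K_monomial_def[abs_def] sum_negf)
qed

lemma K_monomial_orth:
  assumes \<theta>: "inner_fn \<theta>" and f: "f \<in> Kspace \<theta>"
  shows "l2inner f (\<lambda>t. K_monomial \<theta> m t - zpow (int m) t) = 0"
proof -
  define p where "p = (\<lambda>t. \<Sum>k\<le>m. (- cnj (fcoeff \<theta> (int m - int k))) * zpow (int k) t)"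
  have p: "p \<in> H2" unfolding p_def by (rule K_monomial_poly_H2)
  have "(\<lambda>t. K_monomial \<theta> m t - zpow (int m) t) = (\<lambda>t. \<theta> t * p t)"
    by (simp add: K_monomial_def p_def sum_negf)
  then show ?thesis using K_orth[OF f p] by simp
qed

text \<open>The right-hand vector is the left-hand one plus a multiple of \<theta> by an element of
  H2, and the left-hand one lies in the model space. So approximation by polynomials turns into
  approximation by bounded vectors at no loss.\<close>

lemma K_monomial_contraction:
  assumes \<theta>: "inner_fn \<theta>" and f: "f \<in> Kspace \<theta>" and F: "finite F"
  shows "l2norm (\<lambda>t. f t - (\<Sum>m\<in>F. c m * K_monomial \<theta> m t)) \<le> l2norm (\<lambda>t. f t - (\<Sum>m\<in>F. c m * zpow (int m) t))"
proof -
  define h where "h = (\<lambda>t. f t - (\<Sum>m\<in>F. c m * K_monomial \<theta> m t))"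
  define e where "e = (\<lambda>t. \<Sum>m\<in>F. c m * (K_monomial \<theta> m t - zpow (int m) t))"
  have h: "h \<in> Kspace \<theta>" unfolding h_def by (intro K_diff K_sum \<theta> f K_cmult K_monomial_K)
  have eL': "L2 (\<lambda>t. K_monomial \<theta> m t - zpow (int m) t)" for m
    by (intro L2_diff L2_zpow K_L2[OF K_monomial_K[OF \<theta>]])
  have eL: "L2 e" unfolding e_def by (intro L2_sum L2_cmult eL')
  have "l2inner h e = (\<Sum>m\<in>F. l2inner h (\<lambda>t. c m * (K_monomial \<theta> m t - zpow (int m) t)))"
    unfolding e_def by (rule l2inner_sum_right) (intro L2_cmult eL', rule K_L2[OF h])
  also have "\<dots> = 0" unfolding l2inner_cmult_right K_monomial_orth[OF \<theta> h] by simp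
  finally have z: "l2inner h e = 0" .
  have "(l2norm (\<lambda>t. h t + e t))\<^sup>2 = (l2norm h)\<^sup>2 + (l2norm e)\<^sup>2"
    unfolding l2norm_sq_expand[OF K_L2[OF h] eL] z by simp
  moreover have "(\<lambda>t. h t + e t) = (\<lambda>t. f t - (\<Sum>m\<in>F. c m * zpow (int m) t))"
    unfolding h_def e_def by (simp add: right_diff_distrib sum_subtractf)
  ultimately have "(l2norm h)\<^sup>2 \<le> (l2norm (\<lambda>t. f t - (\<Sum>m\<in>F. c m * zpow (int m) t)))\<^sup>2" by simp
  then show ?thesis unfolding h_def by (rule power2_le_imp_le) simp
qed

definition K_approx :: "(real \<Rightarrow> complex) \<Rightarrow> (real \<Rightarrow> complex) \<Rightarrow> nat \<Rightarrow> real \<Rightarrow> complex" where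
  "K_approx \<theta> f N t = (\<Sum>m<N. fcoeff f (int m) * K_monomial \<theta> m t)"

lemma K_approx_K: "inner_fn \<theta> \<Longrightarrow> K_approx \<theta> f N \<in> Kspace \<theta>"
  unfolding K_approx_def[abs_def] by (intro K_sum K_cmult K_monomial_K)

lemma K_approx_bdd: "inner_fn \<theta> \<Longrightarrow> ae_bounded (K_approx \<theta> f N)"
  unfolding K_approx_def[abs_def] by (intro ae_bounded_sum ae_bounded_mult ae_bounded_const K_monomial_bdd)

lemma K_approx_tendsto:
  assumes \<theta>: "inner_fn \<theta>" and f: "f \<in> Kspace \<theta>"
  shows "(\<lambda>N. l2norm (\<lambda>t. K_approx \<theta> f N t - f t)) \<longlonglongrightarrow> 0"
proof (rule Lim_null_comparison[OF always_eventually[OF allI]])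
  show "norm (l2norm (\<lambda>t. K_approx \<theta> f N t - f t)) \<le> l2norm (\<lambda>t. hsum f N t - f t)" for N
    using K_monomial_contraction[OF \<theta> f finite_lessThan[of N], of "\<lambda>m. fcoeff f (int m)"]
    unfolding K_approx_def hsum_def l2norm_minus_commute[of _ f] by simp
  show "(\<lambda>N. l2norm (\<lambda>t. hsum f N t - f t)) \<longlonglongrightarrow> 0" by (rule hsum_L2_tendsto[OF K_H2[OF f]])
qed

text \<open>The representing vector should have coefficients conj(L(P z^n)), with P the projection.
  Testing L on the projected polynomial with these very coefficients gives s at most M sqrt(s) for
  their partial square sum s, so they are square summable.\<close>

lemma K_Riesz:
  fixes L :: "(real \<Rightarrow> complex) \<Rightarrow> complex"
  assumes \<theta>: "inner_fn \<theta>"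
    and lin: "\<And>f g c. f \<in> Kspace \<theta> \<Longrightarrow> g \<in> Kspace \<theta> \<Longrightarrow> L (\<lambda>t. f t + c * g t) = L f + c * L g"
    and bd: "\<And>f. f \<in> Kspace \<theta> \<Longrightarrow> cmod (L f) \<le> M * l2norm f"
  obtains \<xi> where "\<xi> \<in> Kspace \<theta>" "\<And>f. f \<in> Kspace \<theta> \<Longrightarrow> L f = l2inner f \<xi>"
proof -
  have L0: "L (\<lambda>t. 0) = 0" using bd[OF K_zero] by simp
  have Lsum: "L (\<lambda>t. \<Sum>m\<in>F. c m * K_monomial \<theta> m t) = (\<Sum>m\<in>F. c m * L (K_monomial \<theta> m))" if "finite F" for F c
    using that
  proof (induction F)
    case empty then show ?case using L0 by simp
  next
    case (insert x F)
    have "L (\<lambda>t. (\<Sum>m\<in>F. c m * K_monomial \<theta> m t) + c x * K_monomial \<theta> x t) = L (\<lambda>t. \<Sum>m\<in>F. c m * K_monomial \<theta> m t) + c x * L (K_monomial \<theta> x)"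
      by (rule lin) (intro K_sum K_cmult K_monomial_K \<theta>)+
    then show ?case using insert by (simp add: add.commute)
  qed
  define c where "c = (\<lambda>n::int. if n < 0 then 0 else cnj (L (K_monomial \<theta> (nat n))))"
  have bnd: "(\<Sum>k\<in>F. (cmod (c k))\<^sup>2) \<le> M\<^sup>2" if F: "finite F" for F
  proof -
    define G where "G = nat ` (F \<inter> {0..})"
    have G: "finite G" using F by (simp add: G_def)
    have FG: "F \<inter> {0..} = int ` G" unfolding G_def by (auto simp: image_image)
    define s where "s = (\<Sum>m\<in>G. (cmod (c (int m)))\<^sup>2)"
    have s0: "s \<ge> 0" unfolding s_def by (rule sum_nonneg) simp
    have "(\<Sum>k\<in>F. (cmod (c k))\<^sup>2) = (\<Sum>k\<in>F \<inter> {0..}. (cmod (c k))\<^sup>2)"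
      by (rule sum.mono_neutral_right) (use F in \<open>auto simp: c_def\<close>)
    also have "\<dots> = s" unfolding FG s_def by (subst sum.reindex) auto
    finally have Fs: "(\<Sum>k\<in>F. (cmod (c k))\<^sup>2) = s" .
    have "complex_of_real s = (\<Sum>m\<in>G. c (int m) * L (K_monomial \<theta> m))"
      unfolding s_def of_real_sum complex_norm_square by (rule sum.cong) (auto simp: c_def)
    also have "\<dots> = L (\<lambda>t. \<Sum>m\<in>G. c (int m) * K_monomial \<theta> m t)" by (rule Lsum[OF G, symmetric])
    finally have "cmod (complex_of_real s) \<le> M * l2norm (\<lambda>t. \<Sum>m\<in>G. c (int m) * K_monomial \<theta> m t)"
      by (simp only:) (rule bd[OF K_sum[OF \<theta> K_cmult[OF K_monomial_K[OF \<theta>]]]])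
    then have le: "s \<le> M * l2norm (\<lambda>t. \<Sum>m\<in>G. c (int m) * K_monomial \<theta> m t)" using s0 by simp
    have "l2norm (\<lambda>t. \<Sum>m\<in>G. c (int m) * K_monomial \<theta> m t) \<le> l2norm (\<lambda>t. \<Sum>m\<in>G. c (int m) * zpow (int m) t)"
      using K_monomial_contraction[OF \<theta> K_zero G, of "\<lambda>m. c (int m)"] by (simp add: l2norm_uminus)
    also have "\<dots> = sqrt s"
    proof -
      have "(\<lambda>t. \<Sum>m\<in>G. c (int m) * zpow (int m) t) = (\<lambda>t. \<Sum>k\<in>int ` G. c k * zpow k t)"
        by (subst sum.reindex) auto
      moreover have "(\<Sum>k\<in>int ` G. (cmod (c k))\<^sup>2) = s" unfolding s_def by (subst sum.reindex) auto
      ultimately have "(l2norm (\<lambda>t. \<Sum>m\<in>G. c (int m) * zpow (int m) t))\<^sup>2 = s"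
        using l2norm_trig_sum[of "int ` G" c] G by simp
      then show ?thesis by (metis l2norm_nonneg real_sqrt_abs abs_of_nonneg)
    qed
    finally have le2: "l2norm (\<lambda>t. \<Sum>m\<in>G. c (int m) * K_monomial \<theta> m t) \<le> sqrt s" .
    show ?thesis
    proof (cases "s = 0")
      case True then show ?thesis using Fs by simp
    next
      case False
      then have spos: "s > 0" using s0 by simp
      have M0: "M > 0"
      proof (rule ccontr)
        assume "\<not> M > 0"
        then have "M * l2norm (\<lambda>t. \<Sum>m\<in>G. c (int m) * K_monomial \<theta> m t) \<le> 0" by (simp add: mult_nonpos_nonneg)
        then show False using le spos by simp
      qed
      have "s \<le> M * sqrt s" using le le2 M0 by (meson mult_left_mono less_imp_le order_trans)
      then have "sqrt s * sqrt s \<le> M * sqrt s" using s0 by simp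
      moreover have "sqrt s > 0" using spos by simp
      ultimately have "sqrt s \<le> M" by (rule mult_right_le_imp_le)
      then have "(sqrt s)\<^sup>2 \<le> M\<^sup>2" by (rule power_mono) (use s0 in simp)
      then show ?thesis using Fs s0 by simp
    qed
  qed
  obtain \<xi>0 where \<xi>0: "L2 \<xi>0" "\<And>n. fcoeff \<xi>0 n = c n"
    by (rule Riesz_Fischer[OF bnd]) blast+
  have rep: "L f = l2inner f \<xi>0" if f: "f \<in> Kspace \<theta>" for f
  proof (rule LIMSEQ_unique)
    show "(\<lambda>N. l2inner (hsum f N) \<xi>0) \<longlonglongrightarrow> l2inner f \<xi>0"
      by (rule tendsto_l2inner_left[OF H2_L2[OF H2_hsum] K_L2[OF f] \<xi>0(1) hsum_L2_tendsto[OF K_H2[OF f]]])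
    have eq: "l2inner (hsum f N) \<xi>0 = L (K_approx \<theta> f N)" for N
    proof -
      have "l2inner (hsum f N) \<xi>0 = (\<Sum>k<N. fcoeff f (int k) * cnj (fcoeff \<xi>0 (int k)))"
        unfolding hsum_def[abs_def]
        using \<xi>0(1) by (simp add: l2inner_sum_left L2_cmult l2inner_cmult_left fcoeff_eq_inner l2inner_cnj)
      also have "\<dots> = (\<Sum>k<N. fcoeff f (int k) * L (K_monomial \<theta> k))" by (simp add: \<xi>0(2) c_def)
      also have "\<dots> = L (K_approx \<theta> f N)" unfolding K_approx_def[abs_def] by (rule Lsum[symmetric]) simp
      finally show ?thesis .
    qed
    have "(\<lambda>N. L (K_approx \<theta> f N) - L f) \<longlonglongrightarrow> 0"
    proof (rule Lim_null_comparison[OF always_eventually[OF allI]])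
      show "norm (L (K_approx \<theta> f N) - L f) \<le> M * l2norm (\<lambda>t. K_approx \<theta> f N t - f t)" for N
        using lin[OF K_approx_K[OF \<theta>] f, of f N "-1"] bd[OF K_diff[OF \<theta> K_approx_K[OF \<theta>] f], of f N] by simp
      show "(\<lambda>N. M * l2norm (\<lambda>t. K_approx \<theta> f N t - f t)) \<longlonglongrightarrow> 0"
        using tendsto_mult_left[OF K_approx_tendsto[OF \<theta> f], of M] by simp
    qed
    then show "(\<lambda>N. l2inner (hsum f N) \<xi>0) \<longlonglongrightarrow> L f" unfolding eq by (simp add: LIM_zero_iff)
  qed
  show ?thesis
  proof (rule that)
    show "proj (Kspace \<theta>) \<xi>0 \<in> Kspace \<theta>" by (rule proj_K(1)[OF \<theta> \<xi>0(1)])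
    show "L f = l2inner f (proj (Kspace \<theta>) \<xi>0)" if "f \<in> Kspace \<theta>" for f
      using proj_K(3)[OF \<theta> \<xi>0(1) that] rep[OF that] by simp
  qed
qed

section \<open>Truncated Toeplitz operators and shift invariance\<close>

text \<open>The backward shift (f - f(0))/z, adjoint to multiplication by z on H2. Unlike
  multiplication by z, it leaves every model space invariant.\<close>

definition bshift :: "(real \<Rightarrow> complex) \<Rightarrow> real \<Rightarrow> complex" where
  "bshift f t = zpow (- 1) t * (f t - fcoeff f 0)"

lemma L2_minus_const: "L2 f \<Longrightarrow> L2 (\<lambda>t. f t - c)"
  by (rule L2_diff[OF _ L2_const])

lemma L2_bshiftift: "L2 f \<Longrightarrow> L2 (bshift f)"
  unfolding bshift_def[abs_def] by (rule L2_zpow_mult[OF L2_minus_const])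

lemma fcoeff_const: "fcoeff (\<lambda>t. c) n = (if n = 0 then c else 0)"
  using fcoeff_cmult[of c "zpow 0" n] by (auto simp: fcoeff_zpow)

lemma fcoeff_bshiftift: "L2 f \<Longrightarrow> fcoeff (bshift f) n = fcoeff f (n + 1) - (if n + 1 = 0 then fcoeff f 0 else 0)"
  unfolding bshift_def[abs_def] fcoeff_zpow_mult by (simp add: fcoeff_diff L2_const fcoeff_const)

lemma l2norm_bshiftift: assumes "L2 f" shows "l2norm (bshift f) \<le> l2norm f"
proof -
  have "l2norm (bshift f) = l2norm (\<lambda>t. f t - fcoeff f 0)"
    unfolding bshift_def[abs_def] by (rule l2norm_zpow_mult[OF L2_minus_const[OF assms]])
  moreover have "(l2norm f)\<^sup>2 = (l2norm (\<lambda>t. f t - fcoeff f 0))\<^sup>2 + (cmod (fcoeff f 0))\<^sup>2"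
    using Bessel_decomp[OF assms, of "{0}"] by simp
  ultimately have "(l2norm (bshift f))\<^sup>2 \<le> (l2norm f)\<^sup>2" by simp
  then show ?thesis by (rule power2_le_imp_le) simp
qed

lemma bshift_H2: assumes "f \<in> H2" shows "bshift f \<in> H2"
proof -
  have "fcoeff (bshift f) n = 0" if "n < 0" for n
  proof (cases "n + 1 = 0")
    case True
    then show ?thesis by (simp add: fcoeff_bshiftift[OF H2_L2[OF assms]])
  next
    case False
    then have "n + 1 < 0" using that by simp
    then show ?thesis using assms by (simp add: fcoeff_bshiftift[OF H2_L2[OF assms]] H2_def)
  qed
  then show ?thesis using L2_bshiftift[OF H2_L2[OF assms]] by (simp add: H2_def)
qed

text \<open>The adjoint relation; the subtracted constant does not contribute, as z u has mean value
  0.\<close>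

lemma l2inner_bshiftift:
  assumes u: "u \<in> H2" and g: "L2 g" shows "l2inner u (bshift g) = l2inner (\<lambda>t. zpow 1 t * u t) g"
proof -
  have "l2inner u (bshift g) = l2inner (\<lambda>t. zpow 1 t * u t) (\<lambda>t. g t - fcoeff g 0)"
    unfolding bshift_def[abs_def] l2inner_mult_swap cnj_zpow ..
  also have "\<dots> = l2inner (\<lambda>t. zpow 1 t * u t) g - l2inner (\<lambda>t. zpow 1 t * u t) (\<lambda>t. fcoeff g 0 * zpow 0 t)"
    using l2inner_diff_right[OF g L2_const[of "fcoeff g 0"] L2_zpow_mult[OF H2_L2[OF u], of 1]] by simp
  also have "l2inner (\<lambda>t. zpow 1 t * u t) (\<lambda>t. fcoeff g 0 * zpow 0 t) = cnj (fcoeff g 0) * fcoeff u (- 1)"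
    unfolding l2inner_cmult_right fcoeff_eq_inner[symmetric] fcoeff_zpow_mult by simp
  also have "fcoeff u (- 1) = 0" using u by (simp add: H2_def)
  finally show ?thesis by simp
qed

text \<open>Multiplication by z preserves \<theta> H2, so its adjoint preserves the orthogonal
  complement.\<close>

lemma bshift_K: assumes \<theta>: "inner_fn \<theta>" and f: "f \<in> Kspace \<theta>" shows "bshift f \<in> Kspace \<theta>"
proof -
  have "l2inner (bshift f) (\<lambda>t. \<theta> t * g t) = 0" if g: "g \<in> H2" for g
  proof -
    have "l2inner (\<lambda>t. \<theta> t * g t) (bshift f) = l2inner (\<lambda>t. \<theta> t * (zpow 1 t * g t)) f"
      unfolding l2inner_bshiftift[OF inner_fn_H2_mult[OF \<theta> g] K_L2[OF f]] by (simp only: mult.left_commute)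
    also have "\<dots> = 0" by (rule K_orth'[OF f H2_zpow_mult[OF _ g]]) simp
    finally show ?thesis by (metis l2inner_cnj complex_cnj_zero)
  qed
  then show ?thesis using bshift_H2[OF K_H2[OF f]] by (simp add: Kspace_def)
qed

lemma bshift_lin: assumes "L2 f" "L2 g" shows "bshift (\<lambda>t. f t + c * g t) = (\<lambda>t. bshift f t + c * bshift g t)"
  unfolding bshift_def[abs_def] using assms by (simp add: fcoeff_add L2_cmult fcoeff_cmult algebra_simps)

section \<open>Bounded operators on a model space and their forms\<close>

locale model_op =
  fixes \<theta> :: "real \<Rightarrow> complex" and A :: "(real \<Rightarrow> complex) \<Rightarrow> (real \<Rightarrow> complex)"
  assumes \<theta>: "inner_fn \<theta>" and bop: "bounded_op_on (Kspace \<theta>) A"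
begin

abbreviation K where "K \<equiv> Kspace \<theta>"

lemma A_K: "f \<in> K \<Longrightarrow> A f \<in> K"
  using bop by (simp add: bounded_op_on_def)

lemma A_L2: "f \<in> K \<Longrightarrow> L2 (A f)"
  by (rule K_L2[OF A_K])

lemma A_bound: obtains M where "M \<ge> 0" "\<And>f. f \<in> K \<Longrightarrow> l2norm (A f) \<le> M * l2norm f"
proof -
  obtain M where M: "\<And>f. f \<in> K \<Longrightarrow> l2norm (A f) \<le> M * l2norm f"
    using bop unfolding bounded_op_on_def by blast
  have "l2norm (A f) \<le> \<bar>M\<bar> * l2norm f" if "f \<in> K" for f
    by (rule order_trans[OF M[OF that]]) (simp add: mult_right_mono)
  then show ?thesis using that[of "\<bar>M\<bar>"] by simp
qed

lemma A_lin: "f \<in> K \<Longrightarrow> g \<in> K \<Longrightarrow> aeq (A (\<lambda>t. f t + c * g t)) (\<lambda>t. A f t + c * A g t)"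
  using bop unfolding bounded_op_on_def by blast

text \<open>\<open>A\<close> is linear only up to a.e. equality, so the arguments run through the
  numbers \<open>l2inner (A f) g\<close>, which do not see null sets.\<close>

lemma form_lin:
  assumes "f \<in> K" "g \<in> K" "L2 h"
  shows "l2inner (A (\<lambda>t. f t + c * g t)) h = l2inner (A f) h + c * l2inner (A g) h"
proof -
  have "l2inner (A (\<lambda>t. f t + c * g t)) h = l2inner (\<lambda>t. A f t + c * A g t) h"
    by (rule l2inner_cong_AE[OF A_lin[OF assms(1,2)] aeq_refl A_L2[OF K_lincomb[OF \<theta> assms(1,2)]] assms(3)])
  then show ?thesis
    using l2inner_add_left[OF A_L2[OF assms(1)] L2_cmult[OF A_L2[OF assms(2)]] assms(3)] by (simp add: l2inner_cmult_left)
qed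

lemma A_tendsto:
  assumes "\<And>n. X n \<in> K" "f \<in> K" "(\<lambda>n. l2norm (\<lambda>t. X n t - f t)) \<longlonglongrightarrow> 0"
  shows "(\<lambda>n. l2norm (\<lambda>t. A (X n) t - A f t)) \<longlonglongrightarrow> 0"
proof -
  obtain M where M: "\<And>f. f \<in> K \<Longrightarrow> l2norm (A f) \<le> M * l2norm f" by (rule A_bound) blast
  show ?thesis
  proof (rule Lim_null_comparison[OF always_eventually[OF allI]])
    fix n
    have "aeq (A (\<lambda>t. X n t + (-1) * f t)) (\<lambda>t. A (X n) t + (-1) * A f t)"
      by (rule A_lin[OF assms(1,2)])
    then have "l2norm (A (\<lambda>t. X n t + (-1) * f t)) = l2norm (\<lambda>t. A (X n) t + (-1) * A f t)"
      by (rule l2norm_cong_AE[OF _ A_L2[OF K_lincomb[OF \<theta> assms(1,2)]]])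
    then show "norm (l2norm (\<lambda>t. A (X n) t - A f t)) \<le> M * l2norm (\<lambda>t. X n t - f t)"
      using M[OF K_diff[OF \<theta> assms(1,2)], of n] by simp
    show "(\<lambda>n. M * l2norm (\<lambda>t. X n t - f t)) \<longlonglongrightarrow> 0"
      using tendsto_mult_left[OF assms(3), of M] by simp
  qed
qed

lemma form_tendsto:
  assumes "\<And>n. X n \<in> K" "f \<in> K" "(\<lambda>n. l2norm (\<lambda>t. X n t - f t)) \<longlonglongrightarrow> 0"
    and "\<And>n. L2 (Y n)" "L2 g" "(\<lambda>n. l2norm (\<lambda>t. Y n t - g t)) \<longlonglongrightarrow> 0"
  shows "(\<lambda>n. l2inner (A (X n)) (Y n)) \<longlonglongrightarrow> l2inner (A f) g"
  by (rule l2inner_tendsto[OF A_L2[OF assms(1)] A_L2[OF assms(2)] A_tendsto[OF assms(1-3)] assms(4-6)])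

lemma TTO_imp_C_symmetric:
  assumes T: "A \<in> TTO \<theta>" and \<beta>: "inner_fn \<beta>" "divides_inner \<beta> \<theta>"
  shows "C_symmetric \<beta> (compress (Kspace \<beta>) A)"
proof -
  have sub: "f \<in> K" if "f \<in> Kspace \<beta>" for f using K_subset[OF \<beta>] that by blast
  obtain \<phi> where \<phi>: "L2 \<phi>" "\<And>f. f \<in> K \<Longrightarrow> L2 (\<lambda>t. \<phi> t * f t) \<Longrightarrow> aeq (A f) (proj K (\<lambda>t. \<phi> t * f t))"
    using T unfolding TTO_def by blast
  \<comment> \<open>Bounded vectors belong to the domain of the operator with symbol \<phi>, though
    \<phi> is only in L2.\<close>
  have \<phi>b: "L2 (\<lambda>t. \<phi> t * f t)" if "ae_bounded f" for f
    using ae_bounded_L2_mult[OF that \<phi>(1)] by (simp only: mult.commute)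
  have form: "l2inner (A f) g = l2inner (\<lambda>t. \<phi> t * f t) g" if f: "f \<in> K" "ae_bounded f" and g: "g \<in> K" for f g
  proof -
    have "l2inner (A f) g = l2inner (proj K (\<lambda>t. \<phi> t * f t)) g"
      by (rule l2inner_cong_AE[OF \<phi>(2)[OF f(1) \<phi>b[OF f(2)]] aeq_refl A_L2[OF f(1)] K_L2[OF g]])
    then show ?thesis using proj_K(2)[OF \<theta> \<phi>b[OF f(2)] g] by simp
  qed
  have bd: "l2inner (A (Cconj \<beta> f)) (Cconj \<beta> g) = l2inner (A g) f"
    if f: "f \<in> Kspace \<beta>" "ae_bounded f" and g: "g \<in> Kspace \<beta>" "ae_bounded g" for f g
  proof -
    have Cf: "Cconj \<beta> f \<in> K" "Cconj \<beta> g \<in> K" using sub Cconj_K[OF \<beta>(1)] f g by blast+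
    \<comment> \<open>Pointwise, \<beta> and z each meet their own conjugate and cancel, leaving f
      and g exchanged.\<close>
    have "l2inner (\<lambda>t. \<phi> t * Cconj \<beta> f t) (Cconj \<beta> g) = l2inner (\<lambda>t. \<phi> t * g t) f"
      unfolding l2inner_def
    proof (intro arg_cong2[where f = "(/)"] integral_cong_AE refl)
      show "AE t in circ. \<phi> t * Cconj \<beta> f t * cnj (Cconj \<beta> g t) = \<phi> t * g t * cnj (f t)"
        using inner_fn_cnj_mult[OF \<beta>(1)]
      proof eventually_elim
        case (elim t)
        have z: "cnj (zpow 1 t) * zpow 1 t = 1" by simp
        show ?case using elim z unfolding Cconj_alt complex_cnj_mult complex_cnj_cnj by algebra
      qed
      show "(\<lambda>t. \<phi> t * Cconj \<beta> f t * cnj (Cconj \<beta> g t)) \<in> borel_measurable circ"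
        by (intro borel_measurable_integrable L2_inner_integrable \<phi>b ae_bounded_Cconj \<beta> f K_L2[OF Cf(2)])
      show "(\<lambda>t. \<phi> t * g t * cnj (f t)) \<in> borel_measurable circ"
        by (intro borel_measurable_integrable L2_inner_integrable \<phi>b g K_L2[OF f(1)])
    qed
    then show ?thesis
      unfolding form[OF Cf(1) ae_bounded_Cconj[OF \<beta>(1) f(2)] Cf(2)] form[OF sub[OF g(1)] g(2) sub[OF f(1)]] .
  qed
  have iff: "C_symmetric \<beta> (compress (Kspace \<beta>) A) \<longleftrightarrow>
    (\<forall>f\<in>Kspace \<beta>. \<forall>g\<in>Kspace \<beta>. l2inner (A (Cconj \<beta> f)) (Cconj \<beta> g) = l2inner (A g) f)"
    by (rule C_symmetric_iff[OF \<beta>(1)]) (rule A_L2[OF sub])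
  show ?thesis
    unfolding iff
  proof (intro ballI)
    fix f g assume f: "f \<in> Kspace \<beta>" and g: "g \<in> Kspace \<beta>"
    let ?f = "K_approx \<beta> f" and ?g = "K_approx \<beta> g"
    note kf = K_approx_K[OF \<beta>(1), of f] and kg = K_approx_K[OF \<beta>(1), of g]
    have C: "(\<lambda>N. l2norm (\<lambda>t. Cconj \<beta> (K_approx \<beta> h N) t - Cconj \<beta> h t)) \<longlonglongrightarrow> 0" if h: "h \<in> Kspace \<beta>" for h
      unfolding l2norm_Cconj_diff[OF \<beta>(1) K_L2[OF K_approx_K[OF \<beta>(1)]] K_L2[OF h]] by (rule K_approx_tendsto[OF \<beta>(1) h])
    have "(\<lambda>N. l2inner (A (Cconj \<beta> (?f N))) (Cconj \<beta> (?g N))) \<longlonglongrightarrow> l2inner (A (Cconj \<beta> f)) (Cconj \<beta> g)"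
      by (rule form_tendsto[OF sub[OF Cconj_K[OF \<beta>(1) kf]] sub[OF Cconj_K[OF \<beta>(1) f]] C[OF f]
            K_L2[OF Cconj_K[OF \<beta>(1) kg]] K_L2[OF Cconj_K[OF \<beta>(1) g]] C[OF g]])
    moreover have "(\<lambda>N. l2inner (A (?g N)) (?f N)) \<longlonglongrightarrow> l2inner (A g) f"
      by (rule form_tendsto[OF sub[OF kg] sub[OF g] K_approx_tendsto[OF \<beta>(1) g] K_L2[OF kf] K_L2[OF f] K_approx_tendsto[OF \<beta>(1) f]])
    moreover have "l2inner (A (Cconj \<beta> (?f N))) (Cconj \<beta> (?g N)) = l2inner (A (?g N)) (?f N)" for N
      by (rule bd[OF kf K_approx_bdd[OF \<beta>(1)] kg K_approx_bdd[OF \<beta>(1)]])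
    ultimately show "l2inner (A (Cconj \<beta> f)) (Cconj \<beta> g) = l2inner (A g) f"
      using LIMSEQ_unique by simp
  qed
qed

lemma bshift_pow_K: "f \<in> K \<Longrightarrow> (bshift ^^ n) f \<in> K"
  by (induction n) (auto intro: bshift_K[OF \<theta>])

lemma fcoeff_bshiftift_pow: "f \<in> K \<Longrightarrow> k \<ge> 0 \<Longrightarrow> fcoeff ((bshift ^^ n) f) k = fcoeff f (k + int n)"
proof (induction n arbitrary: k)
  case (Suc n)
  then show ?case by (simp add: fcoeff_bshiftift[OF K_L2[OF bshift_pow_K]] add_ac)
qed simp

lemma l2inner_bshiftift_pow:
  assumes g: "g \<in> K" and u: "u \<in> H2"
  shows "l2inner u ((bshift ^^ n) g) = l2inner (\<lambda>t. zpow (int n) t * u t) g"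
  using u
proof (induction n arbitrary: u)
  case (Suc n)
  have "l2inner u ((bshift ^^ Suc n) g) = l2inner (\<lambda>t. zpow 1 t * u t) ((bshift ^^ n) g)"
    using l2inner_bshiftift[OF Suc.prems K_L2[OF bshift_pow_K[OF g]]] by simp
  also have "\<dots> = l2inner (\<lambda>t. zpow (int n) t * (zpow 1 t * u t)) g"
    by (rule Suc.IH) (rule H2_zpow_mult[OF _ Suc.prems], simp)
  finally show ?case by (simp add: zpow_add mult_ac)
qed simp

lemma bshift_pow_eq: "f \<in> K \<Longrightarrow> zpow (int n) t * (bshift ^^ n) f t = f t - hsum f n t"
proof (induction n)
  case (Suc n)
  have z: "zpow 1 t * zpow (-1) t = 1" by (simp flip: zpow_add)
  have "zpow (int (Suc n)) t = zpow (int n) t * zpow 1 t" by (simp flip: zpow_add add: add.commute)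
  moreover have "(bshift ^^ Suc n) f t = zpow (-1) t * ((bshift ^^ n) f t - fcoeff f (int n))"
    using fcoeff_bshiftift_pow[OF Suc.prems, of 0 n] by (simp add: bshift_def)
  ultimately have "zpow (int (Suc n)) t * (bshift ^^ Suc n) f t = zpow (int n) t * (bshift ^^ n) f t - fcoeff f (int n) * zpow (int n) t"
    using z by algebra
  then show ?case using Suc by (simp add: hsum_def)
qed (simp add: hsum_def)

text \<open>Up to the unimodular factor z^n, the iterate is the remainder of the Taylor series after
  n terms.\<close>

lemma bshift_pow_tendsto: assumes "f \<in> K" shows "(\<lambda>n. l2norm ((bshift ^^ n) f)) \<longlonglongrightarrow> 0"
proof -
  have "l2norm ((bshift ^^ n) f) = l2norm (\<lambda>t. hsum f n t - f t)" for n
  proof -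
    have "l2norm ((bshift ^^ n) f) = l2norm (\<lambda>t. zpow (int n) t * (bshift ^^ n) f t)"
      by (rule l2norm_zpow_mult[OF K_L2[OF bshift_pow_K[OF assms]], symmetric])
    then show ?thesis unfolding bshift_pow_eq[OF assms] by (simp add: l2norm_minus_commute)
  qed
  then show ?thesis using hsum_L2_tendsto[OF K_H2[OF assms]] by simp
qed

text \<open>By shift invariance, \<open>\<langle>A f, g\<rangle> - \<langle>A S f, S g\<rangle>\<close> with the backward shift \<open>S\<close> only involves \<open>f(0)\<close> and
  \<open>g(0)\<close> times bounded functionals of \<open>g\<close> and \<open>f\<close>. Summing over the powers of \<open>S\<close>, which tend to \<open>0\<close>
  strongly, yields the symbol \<open>\<psi> + \<xi>\<^sup>*\<close>.\<close>

lemma shift_invariant_imp_TTO: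
  assumes SI: "\<And>f g. f \<in> K \<Longrightarrow> g \<in> K \<Longrightarrow> fcoeff f 0 = 0 \<Longrightarrow> fcoeff g 0 = 0 \<Longrightarrow>
      l2inner (A f) g = l2inner (A (bshift f)) (bshift g)"
    and w: "w \<in> K" "fcoeff w 0 = 1"
  shows "A \<in> TTO \<theta>"
proof -
  obtain M where M: "M \<ge> 0" "\<And>f. f \<in> K \<Longrightarrow> l2norm (A f) \<le> M * l2norm f" by (rule A_bound) blast
  have form_le: "cmod (l2inner (A f) g) \<le> M * l2norm f * l2norm g" if "f \<in> K" "g \<in> K" for f g
    by (rule order_trans[OF l2_Cauchy_Schwarz[OF A_L2[OF that(1)] K_L2[OF that(2)]]])
       (intro mult_right_mono M that, simp)
  define \<Psi> where "\<Psi> = (\<lambda>f g. l2inner (A f) g - l2inner (A (bshift f)) (bshift g))"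
  note bK = bshift_K[OF \<theta>]
  have \<Psi>l: "\<Psi> (\<lambda>t. f t + c * g t) h = \<Psi> f h + c * \<Psi> g h" if "f \<in> K" "g \<in> K" "h \<in> K" for f g h c
    unfolding \<Psi>_def bshift_lin[OF K_L2[OF that(1)] K_L2[OF that(2)]] form_lin[OF that(1,2) K_L2[OF that(3)]]
      form_lin[OF bK[OF that(1)] bK[OF that(2)] K_L2[OF bK[OF that(3)]]] by (simp add: algebra_simps)
  have \<Psi>r: "\<Psi> h (\<lambda>t. f t + c * g t) = \<Psi> h f + cnj c * \<Psi> h g" if "f \<in> K" "g \<in> K" "h \<in> K" for f g h c
    unfolding \<Psi>_def bshift_lin[OF K_L2[OF that(1)] K_L2[OF that(2)]]
      l2inner_add_right[OF K_L2[OF that(1)] L2_cmult[OF K_L2[OF that(2)]] A_L2[OF that(3)]]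
      l2inner_add_right[OF K_L2[OF bK[OF that(1)]] L2_cmult[OF K_L2[OF bK[OF that(2)]]] A_L2[OF bK[OF that(3)]]]
      l2inner_cmult_right by (simp add: algebra_simps)
  have \<Psi>b: "cmod (\<Psi> f g) \<le> 2 * M * l2norm f * l2norm g" if "f \<in> K" "g \<in> K" for f g
  proof -
    have "M * l2norm (bshift f) * l2norm (bshift g) \<le> M * l2norm f * l2norm g"
      by (intro mult_mono mult_nonneg_nonneg M l2norm_bshiftift K_L2[OF that(1)] K_L2[OF that(2)] order_refl) auto
    then have "cmod (l2inner (A (bshift f)) (bshift g)) \<le> M * l2norm f * l2norm g"
      using form_le[OF bK[OF that(1)] bK[OF that(2)]] by simp
    then show ?thesis unfolding \<Psi>_def
      using form_le[OF that] norm_triangle_ineq4[of "l2inner (A f) g" "l2inner (A (bshift f)) (bshift g)"] by simp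
  qed
  \<comment> \<open>Since w(0) = 1, this subtracts the value at the origin and leaves a vector to
    which shift invariance applies.\<close>
  define red where "red = (\<lambda>f t. f t + (- fcoeff f 0) * w t)"
  have redK: "red f \<in> K" if "f \<in> K" for f unfolding red_def by (rule K_lincomb[OF \<theta> that w(1)])
  have red0: "fcoeff (red f) 0 = 0" if "f \<in> K" for f
    unfolding red_def fcoeff_add[OF K_L2[OF that] L2_cmult[OF K_L2[OF w(1)]]] fcoeff_cmult w(2) by simp
  have redeq: "f = (\<lambda>t. red f t + fcoeff f 0 * w t)" for f by (simp add: red_def)
  have \<Psi>0: "\<Psi> f g = 0" if "f \<in> K" "g \<in> K" "fcoeff f 0 = 0" "fcoeff g 0 = 0" for f g
    unfolding \<Psi>_def using SI[OF that] by simp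
  have \<Psi>eq: "\<Psi> f g = fcoeff f 0 * \<Psi> w g + cnj (fcoeff g 0) * \<Psi> (red f) w" if f: "f \<in> K" and g: "g \<in> K" for f g
  proof -
    have "\<Psi> f g = \<Psi> (red f) g + fcoeff f 0 * \<Psi> w g"
      by (subst redeq[of f], rule \<Psi>l[OF redK[OF f] w(1) g])
    also have "\<Psi> (red f) g = \<Psi> (red f) (red g) + cnj (fcoeff g 0) * \<Psi> (red f) w"
      by (subst redeq[of g], rule \<Psi>r[OF redK[OF g] w(1) redK[OF f]])
    also have "\<Psi> (red f) (red g) = 0"
      by (rule \<Psi>0[OF redK[OF f] redK[OF g] red0[OF f] red0[OF g]])
    finally show ?thesis by simp
  qed
  \<comment> \<open>\<Psi> is conjugate linear in its second argument, so the conjugate is what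
    \<open>K_Riesz\<close> can represent.\<close>
  obtain \<psi> where \<psi>: "\<psi> \<in> K" "\<And>g. g \<in> K \<Longrightarrow> cnj (\<Psi> w g) = l2inner g \<psi>"
  proof (rule K_Riesz[OF \<theta>, of "\<lambda>g. cnj (\<Psi> w g)" "2 * M * l2norm w"])
    show "cnj (\<Psi> w (\<lambda>t. f t + c * g t)) = cnj (\<Psi> w f) + c * cnj (\<Psi> w g)" if "f \<in> K" "g \<in> K" for f g c
      unfolding \<Psi>r[OF that w(1)] by simp
    show "cmod (cnj (\<Psi> w f)) \<le> 2 * M * l2norm w * l2norm f" if "f \<in> K" for f
      using \<Psi>b[OF w(1) that] by simp
  qed blast
  have \<psi>': "\<Psi> w g = l2inner \<psi> g" if "g \<in> K" for g using \<psi>(2)[OF that] by (metis complex_cnj_cnj l2inner_cnj)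
  \<comment> \<open>Using \<open>red f\<close> instead of f counts the term f(0) conj(g(0))
    \<Psi>(w, w) once only; the other functional already contains it.\<close>
  obtain \<xi> where \<xi>: "\<xi> \<in> K" "\<And>f. f \<in> K \<Longrightarrow> \<Psi> (red f) w = l2inner f \<xi>"
  proof (rule K_Riesz[OF \<theta>, of "\<lambda>f. \<Psi> (red f) w" "2 * M * l2norm w * (1 + l2norm w)"])
    fix f g c assume f: "f \<in> K" and g: "g \<in> K"
    have "red (\<lambda>t. f t + c * g t) = (\<lambda>t. red f t + c * red g t)"
      unfolding red_def fcoeff_add[OF K_L2[OF f] L2_cmult[OF K_L2[OF g]]] fcoeff_cmult by (simp add: algebra_simps)
    then show "\<Psi> (red (\<lambda>t. f t + c * g t)) w = \<Psi> (red f) w + c * \<Psi> (red g) w"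
      using \<Psi>l[OF redK[OF f] redK[OF g] w(1)] by simp
  next
    fix f assume f: "f \<in> K"
    have "l2norm (red f) \<le> l2norm f + l2norm (\<lambda>t. (- fcoeff f 0) * w t)"
      unfolding red_def by (rule l2norm_triangle[OF K_L2[OF f] L2_cmult[OF K_L2[OF w(1)]]])
    also have "\<dots> \<le> l2norm f + l2norm f * l2norm w"
      unfolding l2norm_cmult using cmod_fcoeff_le[OF K_L2[OF f], of 0] by (simp add: mult_right_mono)
    also have "\<dots> = (1 + l2norm w) * l2norm f" by (simp add: algebra_simps)
    finally have "2 * M * l2norm w * l2norm (red f) \<le> 2 * M * l2norm w * ((1 + l2norm w) * l2norm f)"
      using M(1) by (intro mult_left_mono) auto
    then show "cmod (\<Psi> (red f) w) \<le> 2 * M * l2norm w * (1 + l2norm w) * l2norm f"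
      using \<Psi>b[OF redK[OF f] w(1)] by (simp add: mult_ac)
  qed blast
  have step: "l2inner (A f) g = fcoeff f 0 * l2inner \<psi> g + cnj (fcoeff g 0) * l2inner f \<xi> + l2inner (A (bshift f)) (bshift g)"
    if f: "f \<in> K" and g: "g \<in> K" for f g
    using \<Psi>eq[OF f g] unfolding \<psi>'[OF g] \<xi>(2)[OF f] unfolding \<Psi>_def by (simp add: algebra_simps)
  have iter: "l2inner (A f) g = l2inner (\<lambda>t. hsum f N t * \<psi> t) g + l2inner f (\<lambda>t. hsum g N t * \<xi> t)
      + l2inner (A ((bshift ^^ N) f)) ((bshift ^^ N) g)" if f: "f \<in> K" and g: "g \<in> K" for f g N
  proof -
    have "l2inner (A f) g = (\<Sum>n<N. fcoeff f (int n) * l2inner (\<lambda>t. zpow (int n) t * \<psi> t) g)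
      + (\<Sum>n<N. cnj (fcoeff g (int n)) * l2inner f (\<lambda>t. zpow (int n) t * \<xi> t))
      + l2inner (A ((bshift ^^ N) f)) ((bshift ^^ N) g)"
    proof (induction N)
      case (Suc N)
      have "l2inner (A ((bshift ^^ N) f)) ((bshift ^^ N) g) = fcoeff f (int N) * l2inner \<psi> ((bshift ^^ N) g)
          + cnj (fcoeff g (int N)) * l2inner ((bshift ^^ N) f) \<xi> + l2inner (A ((bshift ^^ Suc N) f)) ((bshift ^^ Suc N) g)"
        using step[OF bshift_pow_K[OF f, of N] bshift_pow_K[OF g, of N]] fcoeff_bshiftift_pow[OF f, of 0 N] fcoeff_bshiftift_pow[OF g, of 0 N] by simp
      moreover have "l2inner ((bshift ^^ N) f) \<xi> = l2inner f (\<lambda>t. zpow (int N) t * \<xi> t)"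
        using l2inner_bshiftift_pow[OF f K_H2[OF \<xi>(1)], of N] by (metis l2inner_cnj)
      ultimately show ?case unfolding Suc using l2inner_bshiftift_pow[OF g K_H2[OF \<psi>(1)], of N] by (simp add: algebra_simps)
    qed simp
    moreover have "l2inner (\<lambda>t. hsum f N t * \<psi> t) g = (\<Sum>n<N. fcoeff f (int n) * l2inner (\<lambda>t. zpow (int n) t * \<psi> t) g)"
    proof -
      have "(\<lambda>t. hsum f N t * \<psi> t) = (\<lambda>t. \<Sum>n<N. fcoeff f (int n) * (zpow (int n) t * \<psi> t))"
        by (simp add: hsum_def sum_distrib_right mult.assoc)
      then show ?thesis
        using l2inner_sum_left[of "{..<N}" "\<lambda>n t. fcoeff f (int n) * (zpow (int n) t * \<psi> t)" g]
          L2_cmult[OF L2_zpow_mult[OF K_L2[OF \<psi>(1)]]] K_L2[OF g] by (simp add: l2inner_cmult_left)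
    qed
    moreover have "l2inner f (\<lambda>t. hsum g N t * \<xi> t) = (\<Sum>n<N. cnj (fcoeff g (int n)) * l2inner f (\<lambda>t. zpow (int n) t * \<xi> t))"
    proof -
      have "(\<lambda>t. hsum g N t * \<xi> t) = (\<lambda>t. \<Sum>n<N. fcoeff g (int n) * (zpow (int n) t * \<xi> t))"
        by (simp add: hsum_def sum_distrib_right mult.assoc)
      then show ?thesis
        using l2inner_sum_right[of "{..<N}" "\<lambda>n t. fcoeff g (int n) * (zpow (int n) t * \<xi> t)" f]
          L2_cmult[OF L2_zpow_mult[OF K_L2[OF \<xi>(1)]]] K_L2[OF f] by (simp add: l2inner_cmult_right)
    qed
    ultimately show ?thesis by simp
  qed
  \<comment> \<open>In \<open>iter\<close> the Taylor sums of f multiply \<psi>, and those of g,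
    conjugated, multiply conj(\<xi>); in the limit both act as multiplication of f by this
    sum.\<close>
  define \<phi> where "\<phi> = (\<lambda>t. \<psi> t + cnj (\<xi> t))"
  have \<phi>L: "L2 \<phi>" unfolding \<phi>_def by (rule L2_add[OF K_L2[OF \<psi>(1)] L2_cnj[OF K_L2[OF \<xi>(1)]]])
  have bform: "l2inner (A f) g = l2inner (\<lambda>t. \<phi> t * f t) g" if f: "f \<in> K" "ae_bounded f" and g: "g \<in> K" "ae_bounded g" for f g
  proof -
    have pg: "L2 (\<lambda>t. cnj (\<psi> t) * g t)"
      using ae_bounded_L2_mult[OF g(2) L2_cnj[OF K_L2[OF \<psi>(1)]]] by (simp only: mult.commute)
    have cf: "L2 (\<lambda>t. cnj (\<xi> t) * f t)"
      using ae_bounded_L2_mult[OF f(2) L2_cnj[OF K_L2[OF \<xi>(1)]]] by (simp only: mult.commute)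
    have pf: "L2 (\<lambda>t. \<psi> t * f t)"
      using ae_bounded_L2_mult[OF f(2) K_L2[OF \<psi>(1)]] by (simp only: mult.commute)
    have 1: "(\<lambda>N. l2inner (\<lambda>t. hsum f N t * \<psi> t) g) \<longlonglongrightarrow> l2inner (\<lambda>t. \<psi> t * f t) g"
    proof -
      have "l2inner (\<lambda>t. hsum f N t * \<psi> t) g = l2inner (hsum f N) (\<lambda>t. cnj (\<psi> t) * g t)" for N
        using l2inner_mult_swap[of \<psi> "hsum f N" g] by (simp only: mult.commute)
      moreover have "l2inner (\<lambda>t. \<psi> t * f t) g = l2inner f (\<lambda>t. cnj (\<psi> t) * g t)" by (rule l2inner_mult_swap)
      ultimately show ?thesis
        using tendsto_l2inner_left[OF H2_L2[OF H2_hsum] K_L2[OF f(1)] pg hsum_L2_tendsto[OF K_H2[OF f(1)]]] by simp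
    qed
    have 2: "(\<lambda>N. l2inner f (\<lambda>t. hsum g N t * \<xi> t)) \<longlonglongrightarrow> l2inner (\<lambda>t. cnj (\<xi> t) * f t) g"
    proof -
      have "l2inner f (\<lambda>t. hsum g N t * \<xi> t) = l2inner (\<lambda>t. cnj (\<xi> t) * f t) (hsum g N)" for N
        using l2inner_mult_swap[of "\<lambda>t. cnj (\<xi> t)" f "hsum g N"] by (simp only: complex_cnj_cnj mult.commute)
      then show ?thesis
        using tendsto_l2inner_right[OF H2_L2[OF H2_hsum] K_L2[OF g(1)] cf hsum_L2_tendsto[OF K_H2[OF g(1)]]] by simp
    qed
    have 3: "(\<lambda>N. l2inner (A ((bshift ^^ N) f)) ((bshift ^^ N) g)) \<longlonglongrightarrow> 0"
    proof (rule Lim_null_comparison[OF always_eventually[OF allI]])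
      show "norm (l2inner (A ((bshift ^^ N) f)) ((bshift ^^ N) g)) \<le> M * l2norm ((bshift ^^ N) f) * l2norm ((bshift ^^ N) g)" for N
        by (rule form_le[OF bshift_pow_K[OF f(1)] bshift_pow_K[OF g(1)]])
      show "(\<lambda>N. M * l2norm ((bshift ^^ N) f) * l2norm ((bshift ^^ N) g)) \<longlonglongrightarrow> 0"
        using tendsto_mult[OF tendsto_mult_left[OF bshift_pow_tendsto[OF f(1)], of M] bshift_pow_tendsto[OF g(1)]] by simp
    qed
    from tendsto_add[OF tendsto_add[OF 1 2] 3]
    have "(\<lambda>N. l2inner (A f) g) \<longlonglongrightarrow> l2inner (\<lambda>t. \<psi> t * f t) g + l2inner (\<lambda>t. cnj (\<xi> t) * f t) g + 0"
      unfolding iter[OF f(1) g(1), symmetric] .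
    then have "l2inner (A f) g = l2inner (\<lambda>t. \<psi> t * f t) g + l2inner (\<lambda>t. cnj (\<xi> t) * f t) g"
      by (simp add: LIMSEQ_const_iff)
    also have "\<dots> = l2inner (\<lambda>t. \<phi> t * f t) g"
      using l2inner_add_left[OF pf cf K_L2[OF g(1)]] by (simp add: \<phi>_def distrib_right)
    finally show ?thesis .
  qed
  \<comment> \<open>One factor at a time: while g stays bounded, conj(\<phi>) g is in L2 and f may
    be arbitrary.\<close>
  have hform: "l2inner (A f) g = l2inner (\<lambda>t. \<phi> t * f t) g" if f: "f \<in> K" and g: "g \<in> K" "ae_bounded g" for f g
  proof -
    have pg: "L2 (\<lambda>t. cnj (\<phi> t) * g t)"
      using ae_bounded_L2_mult[OF g(2) L2_cnj[OF \<phi>L]] by (simp only: mult.commute)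
    note ka = K_approx_K[OF \<theta>, of f] and kt = K_approx_tendsto[OF \<theta> f]
    have "(\<lambda>N. l2inner (A (K_approx \<theta> f N)) g) \<longlonglongrightarrow> l2inner (A f) g"
      by (rule tendsto_l2inner_left[OF A_L2[OF ka] A_L2[OF f] K_L2[OF g(1)] A_tendsto[OF ka f kt]])
    moreover have "(\<lambda>N. l2inner (K_approx \<theta> f N) (\<lambda>t. cnj (\<phi> t) * g t)) \<longlonglongrightarrow> l2inner f (\<lambda>t. cnj (\<phi> t) * g t)"
      by (rule tendsto_l2inner_left[OF K_L2[OF ka] K_L2[OF f] pg kt])
    moreover have "l2inner (A (K_approx \<theta> f N)) g = l2inner (K_approx \<theta> f N) (\<lambda>t. cnj (\<phi> t) * g t)" for N
      unfolding bform[OF ka K_approx_bdd[OF \<theta>] g] by (rule l2inner_mult_swap)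
    ultimately have "l2inner (A f) g = l2inner f (\<lambda>t. cnj (\<phi> t) * g t)" using LIMSEQ_unique by simp
    then show ?thesis by (simp only: l2inner_mult_swap)
  qed
  \<comment> \<open>Now f is fixed with \<phi> f in L2, so the bounded second argument can be
    replaced by an arbitrary vector of the space.\<close>
  have "aeq (A f) (proj K (\<lambda>t. \<phi> t * f t))" if f: "f \<in> K" and pL: "L2 (\<lambda>t. \<phi> t * f t)" for f
  proof (rule K_eq_of_inner[OF \<theta> A_K[OF f] proj_K(1)[OF \<theta> pL]])
    fix h assume h: "h \<in> K"
    note ka = K_approx_K[OF \<theta>, of h] and kt = K_approx_tendsto[OF \<theta> h]
    have "(\<lambda>N. l2inner (A f) (K_approx \<theta> h N)) \<longlonglongrightarrow> l2inner (A f) h"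
      by (rule tendsto_l2inner_right[OF K_L2[OF ka] K_L2[OF h] A_L2[OF f] kt])
    moreover have "(\<lambda>N. l2inner (\<lambda>t. \<phi> t * f t) (K_approx \<theta> h N)) \<longlonglongrightarrow> l2inner (\<lambda>t. \<phi> t * f t) h"
      by (rule tendsto_l2inner_right[OF K_L2[OF ka] K_L2[OF h] pL kt])
    ultimately have "l2inner (A f) h = l2inner (\<lambda>t. \<phi> t * f t) h"
      unfolding hform[OF f ka K_approx_bdd[OF \<theta>]] using LIMSEQ_unique by blast
    then show "l2inner (A f) h = l2inner (proj K (\<lambda>t. \<phi> t * f t)) h"
      using proj_K(2)[OF \<theta> pL h] by simp
  qed
  then show ?thesis unfolding TTO_def using \<phi>L by blast
qed

end

section \<open>Compressions to finite Blaschke products\<close>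

text \<open>The Toeplitz defect \<open>D l m\<close> of the matrix of size \<open>n + 1\<close> changes sign under reflection in the
  anti-diagonal, so it vanishes for \<open>l + m = n - 1\<close>. The recursion supplied by the Toeplitz matrix of
  size \<open>n\<close> then kills \<open>l + m = n - 2\<close>, as \<open>\<bar>a n\<bar> < 1\<close>, and descends to all smaller \<open>l + m\<close>.\<close>

lemma persymmetric_imp_Toeplitz:
  fixes T :: "nat \<Rightarrow> nat \<Rightarrow> nat \<Rightarrow> complex" and a :: "nat \<Rightarrow> complex"
  assumes a: "\<And>n. cmod (a n) < 1"
    and per: "\<And>n l m. l < n \<Longrightarrow> m < n \<Longrightarrow> T n (n - 1 - l) (n - 1 - m) = T n m l"
    and rel: "\<And>n l m. l < n \<Longrightarrow> m < n \<Longrightarrow> T n l m = T (Suc n) l m - cnj (a n) * T (Suc n) (Suc l) m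
        - a n * T (Suc n) l (Suc m) + cnj (a n) * a n * T (Suc n) (Suc l) (Suc m)"
  shows "Suc l < n \<Longrightarrow> Suc m < n \<Longrightarrow> T n (Suc l) (Suc m) = T n l m"
proof (induction n arbitrary: l m)
  case (Suc n)
  define D where "D = (\<lambda>l m. T (Suc n) (Suc l) (Suc m) - T (Suc n) l m)"
  have anti: "D (n - 1 - l) (n - 1 - m) = - D m l" if "l < n" "m < n" for l m
  proof -
    have "Suc (n - 1 - l) = Suc n - 1 - l" "Suc (n - 1 - m) = Suc n - 1 - m"
      "n - 1 - l = Suc n - 1 - Suc l" "n - 1 - m = Suc n - 1 - Suc m" using that by auto
    then show ?thesis
      unfolding D_def using per[of l "Suc n" m] per[of "Suc l" "Suc n" "Suc m"] that by simp
  qed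
  have rec: "D l m = cnj (a n) * D (Suc l) m + a n * D l (Suc m) - cnj (a n) * a n * D (Suc l) (Suc m)"
    if "Suc l < n" "Suc m < n" for l m
  proof -
    have "T n (Suc l) (Suc m) = T n l m" by (rule Suc.IH[OF that])
    then show ?thesis
      unfolding D_def using rel[of l n m] rel[of "Suc l" n "Suc m"] that by (simp add: algebra_simps)
  qed
  \<comment> \<open>Here \<open>k\<close> is the distance of l + m below the anti-diagonal n - 1;
    the induction moves away from it.\<close>
  have low: "D l m = 0" if "l + m + k = n - 1" "0 < n" for k l m
    using that
  proof (induction k arbitrary: l m rule: less_induct)
    case (less k)
    then have lm: "l < n" "m < n" by auto
    consider "k = 0" | "k = 1" | "k \<ge> 2" by linarith
    then show ?case
    proof cases
      case 1
      then have "n - 1 - m = l" "n - 1 - l = m" using less.prems by auto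
      then have "D l m = - D l m" using anti[OF lm(2,1)] by simp
      then show ?thesis by simp
    next
      case 2
      have S: "Suc l < n" "Suc m < n" using 2 less.prems by auto
      have z: "D (Suc l) m = 0" "D l (Suc m) = 0"
        using less.IH[of 0 "Suc l" m] less.IH[of 0 l "Suc m"] 2 less.prems by auto
      \<comment> \<open>The neighbour with both indices raised lies one above the anti-diagonal and
        reflects back to (l, m) with opposite sign. The recursion then reads (1 - |a_n|^2) D =
        0.\<close>
      have "n - 1 - m = Suc l" "n - 1 - l = Suc m" using 2 less.prems by auto
      then have "D (Suc l) (Suc m) = - D l m" using anti[OF lm(2,1)] by simp
      then have "D l m = cnj (a n) * a n * D l m" using rec[OF S] z by simp
      then have "(1 - cnj (a n) * a n) * D l m = 0" by (simp add: algebra_simps)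
      moreover have "1 - cnj (a n) * a n \<noteq> 0"
        by (rule one_minus_mult_nz[OF a less_imp_le[OF a]])
      ultimately show ?thesis by simp
    next
      case 3
      have S: "Suc l < n" "Suc m < n" using 3 less.prems by auto
      have "D (Suc l) m = 0" "D l (Suc m) = 0" "D (Suc l) (Suc m) = 0"
        using less.IH[of "k - 1" "Suc l" m] less.IH[of "k - 1" l "Suc m"] less.IH[of "k - 2" "Suc l" "Suc m"] 3 less.prems
        by auto
      then show ?thesis using rec[OF S] by simp
    qed
  qed
  have lm: "l < n" "m < n" using Suc.prems by auto
  have "D l m = 0"
  proof (cases "l + m \<le> n - 1")
    case True
    then show ?thesis using low[of l m "n - 1 - (l + m)"] lm by simp
  next
    case False
    \<comment> \<open>Above the anti-diagonal, reflection leads to an entry below it.\<close>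
    have "D (n - 1 - m) (n - 1 - l) = 0"
      using low[of "n - 1 - m" "n - 1 - l" "l + m - (n - 1)"] lm False by simp
    then show ?thesis using anti[OF lm(2,1)] by simp
  qed
  then show ?case by (simp add: D_def)
qed simp

lemma bdd_H2_mult:
  assumes h: "h \<in> H2" "ae_bounded h" and g: "g \<in> H2" shows "(\<lambda>t. h t * g t) \<in> H2"
proof -
  have "fcoeff (\<lambda>t. h t * g t) n = 0" if n: "n < 0" for n
  proof -
    have "fcoeff (\<lambda>t. h t * g t) n = l2inner g (\<lambda>t. zpow n t * cnj (h t))"
      unfolding fcoeff_eq_inner l2inner_mult_swap[of h] by (simp only: mult.commute)
    also have "\<dots> = 0"
    proof (rule H2_inner_zero(1)[OF g L2_zpow_mult[OF L2_cnj[OF H2_L2[OF h(1)]]]])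
      fix k :: int assume "k \<ge> 0"
      then show "fcoeff (\<lambda>t. zpow n t * cnj (h t)) k = 0"
        unfolding fcoeff_zpow_mult fcoeff_cnj using h(1) n by (simp add: H2_def)
    qed
    finally show ?thesis .
  qed
  then show ?thesis using ae_bounded_L2_mult[OF h(2) H2_L2[OF g]] by (simp add: H2_def)
qed

lemma hol_closed_disc_bdd:
  assumes "hol_closed_disc F" shows "ae_bounded (\<lambda>t. F (cis t))"
proof -
  have c: "continuous_on (sphere 0 1) F"
    using hol_closed_disc_isCont[OF assms] by (auto intro!: continuous_at_imp_continuous_on)
  obtain B where "\<And>z. z \<in> sphere 0 1 \<Longrightarrow> norm (F z) \<le> B"
    using compact_imp_bounded[OF compact_continuous_image[OF c compact_sphere]] unfolding bounded_iff by blast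
  then have "AE t in circ. cmod (F (cis t)) \<le> B" by simp
  then show ?thesis unfolding ae_bounded_def using measurable_comp_cis[OF c] by blast
qed

lemma proj_best:
  assumes \<theta>: "inner_fn \<theta>" and f: "L2 f" and h: "h \<in> Kspace \<theta>"
  shows "l2norm (\<lambda>t. proj (Kspace \<theta>) f t - f t) \<le> l2norm (\<lambda>t. h t - f t)"
proof -
  define p where "p = proj (Kspace \<theta>) f"
  have p: "p \<in> Kspace \<theta>" unfolding p_def by (rule proj_K(1)[OF \<theta> f])
  have d: "(\<lambda>t. h t - p t) \<in> Kspace \<theta>" by (rule K_diff[OF \<theta> h p])
  have pf: "L2 (\<lambda>t. p t - f t)" by (rule L2_diff[OF K_L2[OF p] f])
  have "l2inner (\<lambda>t. h t - p t) (\<lambda>t. p t - f t) = 0"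
    using l2inner_diff_right[OF K_L2[OF p] f K_L2[OF d]] proj_K(3)[OF \<theta> f d] by (simp add: p_def)
  then have "(l2norm (\<lambda>t. (h t - p t) + (p t - f t)))\<^sup>2 = (l2norm (\<lambda>t. h t - p t))\<^sup>2 + (l2norm (\<lambda>t. p t - f t))\<^sup>2"
    unfolding l2norm_sq_expand[OF K_L2[OF d] pf] by simp
  then have "(l2norm (\<lambda>t. p t - f t))\<^sup>2 \<le> (l2norm (\<lambda>t. h t - f t))\<^sup>2" by simp
  then show ?thesis unfolding p_def by (rule power2_le_imp_le) simp
qed

lemma l2norm_inner_fn: "inner_fn \<theta> \<Longrightarrow> l2norm \<theta> = 1"
  using l2norm_unimodular_mult[OF inner_fn_norm inner_fn_measurable L2_zpow[of 0], of \<theta>] by simp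

text \<open>\<theta> and its conjugated coefficients each carry the constant once, and c conj(c) =
  1. This disposes of the constants by which \<open>Bpart\<close> differs from the normalised
  products.\<close>

lemma K_monomial_cmult:
  assumes "cmod c = 1" shows "K_monomial (\<lambda>t. c * \<theta> t) m = K_monomial \<theta> m"
proof -
  have c: "c * cnj c = 1" using complex_norm_square[of c] assms by simp
  have eq: "c * \<theta> t * (\<Sum>k\<le>m. cnj (c * fcoeff \<theta> (int m - int k)) * zpow (int k) t)
      = (c * cnj c) * (\<theta> t * (\<Sum>k\<le>m. cnj (fcoeff \<theta> (int m - int k)) * zpow (int k) t))" for t
    by (simp add: sum_distrib_left mult_ac)
  show ?thesis unfolding K_monomial_def[abs_def] fcoeff_cmult by (intro ext) (simp only: eq c mult_1)
qed

text \<open>Each of the m + 1 summands is a coefficient times a function; changing one and then the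
  other costs at most the distance of the inner functions each, hence the 2.\<close>

lemma K_monomial_diff_le:
  assumes \<theta>: "inner_fn \<theta>" and \<eta>: "inner_fn \<eta>"
  shows "l2norm (\<lambda>t. K_monomial \<theta> m t - K_monomial \<eta> m t) \<le> 2 * real (Suc m) * l2norm (\<lambda>t. \<theta> t - \<eta> t)"
proof -
  let ?d = "l2norm (\<lambda>t. \<theta> t - \<eta> t)"
  have L: "L2 \<theta>" "L2 \<eta>" using H2_L2[OF inner_fn_H2] \<theta> \<eta> by auto
  have dL: "L2 (\<lambda>t. \<theta> t - \<eta> t)" by (rule L2_diff[OF L])
  define u where "u = (\<lambda>k. fcoeff \<theta> (int m - int k))"
  define v where "v = (\<lambda>k. fcoeff \<eta> (int m - int k))"
  define s where "s = (\<lambda>k t. zpow (int k) t * (cnj (v k) * (\<eta> t - \<theta> t) + cnj (v k - u k) * \<theta> t))"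
  have sL': "L2 (\<lambda>t. cnj (v k) * (\<eta> t - \<theta> t) + cnj (v k - u k) * \<theta> t)" for k
    by (intro L2_add L2_cmult L2_diff L)
  have sL: "L2 (s k)" for k unfolding s_def by (rule L2_zpow_mult[OF sL'])
  have "(\<lambda>t. K_monomial \<theta> m t - K_monomial \<eta> m t) = (\<lambda>t. \<Sum>k\<le>m. s k t)"
    unfolding K_monomial_def s_def u_def v_def
    by (simp add: sum_distrib_left algebra_simps flip: sum_subtractf)
  then have "l2norm (\<lambda>t. K_monomial \<theta> m t - K_monomial \<eta> m t) \<le> (\<Sum>k\<le>m. l2norm (s k))"
    using l2norm_sum_le[of "{..m}" s] sL by simp
  also have "\<dots> \<le> (\<Sum>k\<le>m. 2 * ?d)"
  proof (rule sum_mono)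
    fix k
    have "l2norm (s k) = l2norm (\<lambda>t. cnj (v k) * (\<eta> t - \<theta> t) + cnj (v k - u k) * \<theta> t)"
      unfolding s_def by (rule l2norm_zpow_mult[OF sL'])
    also have "\<dots> \<le> l2norm (\<lambda>t. cnj (v k) * (\<eta> t - \<theta> t)) + l2norm (\<lambda>t. cnj (v k - u k) * \<theta> t)"
      by (rule l2norm_triangle) (intro L2_cmult L2_diff L)+
    also have "l2norm (\<lambda>t. cnj (v k) * (\<eta> t - \<theta> t)) = cmod (v k) * ?d"
      unfolding l2norm_cmult l2norm_minus_commute[of \<eta>] by simp
    also have "cmod (v k) * ?d \<le> 1 * ?d"
      using cmod_fcoeff_le[OF L(2)] l2norm_inner_fn[OF \<eta>] unfolding v_def by (intro mult_right_mono) auto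
    also have "l2norm (\<lambda>t. cnj (v k - u k) * \<theta> t) = cmod (v k - u k)"
      unfolding l2norm_cmult complex_mod_cnj l2norm_inner_fn[OF \<theta>] by simp
    also have "v k - u k = fcoeff (\<lambda>t. \<eta> t - \<theta> t) (int m - int k)"
      unfolding u_def v_def by (rule fcoeff_diff[OF L(2,1), symmetric])
    also have "cmod \<dots> \<le> ?d"
      using cmod_fcoeff_le[OF L2_diff[OF L(2,1)]] l2norm_minus_commute[of \<eta>] by simp
    finally show "l2norm (s k) \<le> 2 * ?d" by simp
  qed
  also have "\<dots> = 2 * real (Suc m) * ?d" by simp
  finally show ?thesis .
qed

section \<open>The model space of a finite Blaschke product\<close>

locale zeros =
  fixes a :: "nat \<Rightarrow> complex"
  assumes a: "\<forall>j. cmod (a j) < 1"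
begin

definition Bn :: "nat \<Rightarrow> real \<Rightarrow> complex" where
  "Bn n t = Bpart a n (cis t)"

lemma bv_Bn: "bv (Bpart a n) = Bn n"
  unfolding Bn_def[abs_def] by (rule bv_Bpart[OF a])

lemma inner_Bn: "inner_fn (Bn n)"
  using is_blaschke_inner[OF is_blaschke_Bpart[OF a]] unfolding bv_Bn .

definition q :: "nat \<Rightarrow> real \<Rightarrow> complex" where
  "q n t = (\<Prod>j<n. 1 - cnj (a j) * cis t)"

definition rk :: "nat \<Rightarrow> real \<Rightarrow> complex" where
  "rk n t = (\<Prod>j<n. 1 / (1 - cnj (a j) * cis t))"

lemma q_nz: "q n t \<noteq> 0"
  unfolding q_def using a one_minus_mult_nz[of _ "cis t"] by auto

lemma rk_q: "rk n t = 1 / q n t"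
  unfolding rk_def q_def by (simp add: prod_dividef)

lemma Bn_Suc: "Bn (Suc n) t = Bn n t * ((cis t - a n) / (1 - cnj (a n) * cis t))"
  by (simp add: Bn_def Bpart_def)

text \<open>On the circle z - a = z (1 - a conj(z)), so the numerator of the Blaschke product is z^n
  times the conjugate of its denominator.\<close>

lemma Bn_q: "Bn n t * q n t = zpow (int n) t * cnj (q n t)"
proof (induction n)
  case 0
  then show ?case by (simp add: Bn_def Bpart_def q_def)
next
  case (Suc n)
  have nz: "1 - cnj (a n) * cis t \<noteq> 0" using a one_minus_mult_nz[of "a n" "cis t"] by auto
  have zz: "cis t * cnj (cis t) = 1" by (simp add: cis_cnj cis_mult)
  have q: "q (Suc n) t = q n t * (1 - cnj (a n) * cis t)" by (simp add: q_def)
  have "Bn (Suc n) t * q (Suc n) t = (Bn n t * q n t) * (cis t - a n)"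
    unfolding Bn_Suc q using nz by simp
  also have "\<dots> = zpow (int n) t * cnj (q n t) * (cis t * (1 - a n * cnj (cis t)))"
    unfolding Suc using zz by (simp add: algebra_simps)
  also have "\<dots> = zpow (int (Suc n)) t * cnj (q (Suc n) t)"
  proof -
    have "zpow (int (Suc n)) t = zpow (int n) t * cis t" by (simp add: zpow_of_nat del: of_nat_Suc)
    then show ?thesis unfolding q by (simp add: mult_ac del: of_nat_Suc)
  qed
  finally show ?case .
qed

lemma hol_rk: "hol_closed_disc (\<lambda>z. \<Prod>j<n. 1 / (1 - cnj (a j) * z))"
proof (intro hol_closed_disc_prod)
  fix j
  have aj: "cmod (a j) < 1" using a by simp
  show "hol_closed_disc (\<lambda>z. 1 / (1 - cnj (a j) * z))"
  proof (cases "a j = 0")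
    case True then show ?thesis by (simp add: hol_closed_disc_const)
  next
    case False
    have "1 - cnj (a j) * z \<noteq> 0" if "cmod z < 1 / cmod (a j)" for z
    proof
      assume "1 - cnj (a j) * z = 0"
      then have "cmod (cnj (a j) * z) = 1" by (metis eq_iff_diff_eq_0 norm_one)
      then show False using that False by (simp add: norm_mult field_simps)
    qed
    then show ?thesis unfolding hol_closed_disc_def using False aj
      by (intro exI[of _ "1 / cmod (a j)"]) (auto intro!: holomorphic_intros)
  qed
qed

lemma hol_q: "hol_closed_disc (\<lambda>z. \<Prod>j<n. 1 - cnj (a j) * z)"
proof (intro hol_closed_disc_prod)
  show "hol_closed_disc (\<lambda>z. 1 - cnj (a j) * z)" for j
    unfolding hol_closed_disc_def by (intro exI[of _ 2]) (auto intro!: holomorphic_intros)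
qed

lemma rk_H2: "rk n \<in> H2" and rk_bdd: "ae_bounded (rk n)" and rk_0: "fcoeff (rk n) 0 = 1"
  and q_H2: "q n \<in> H2" and q_bdd: "ae_bounded (q n)"
  using hol_closed_disc_boundary(1,3)[OF hol_rk] hol_closed_disc_bdd[OF hol_rk]
    hol_closed_disc_boundary(1)[OF hol_q] hol_closed_disc_bdd[OF hol_q]
  unfolding rk_def[abs_def] q_def[abs_def] by auto

definition E :: "nat \<Rightarrow> nat \<Rightarrow> real \<Rightarrow> complex" where
  "E n l t = zpow (int l) t * rk n t"

lemma E_H2: "E n l \<in> H2"
  unfolding E_def[abs_def] by (rule H2_zpow_mult[OF _ rk_H2]) simp

text \<open>By \<open>Bn_q\<close>, pairing with B_n g amounts to pairing z^(l - n) with g/q_n. The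
  exponent is negative exactly when l < n.\<close>

lemma E_K: assumes "l < n" shows "E n l \<in> Kspace (Bn n)"
proof -
  have "l2inner (E n l) (\<lambda>t. Bn n t * g t) = 0" if g: "g \<in> H2" for g
  proof -
    have rg: "(\<lambda>t. rk n t * g t) \<in> H2" by (rule bdd_H2_mult[OF rk_H2 rk_bdd g])
    have "E n l t * cnj (Bn n t * g t) = zpow (int l - int n) t * cnj (rk n t * g t)" for t
    proof -
      have "Bn n t = zpow (int n) t * cnj (q n t) * rk n t"
        using Bn_q[of n t] q_nz[of n t] by (simp add: rk_q field_simps)
      then show ?thesis using q_nz[of n t] by (simp add: E_def rk_q zpow_diff)
    qed
    then have "l2inner (E n l) (\<lambda>t. Bn n t * g t) = l2inner (zpow (int l - int n)) (\<lambda>t. rk n t * g t)"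
      by (simp only: l2inner_def)
    also have "\<dots> = 0"
      by (rule H2_inner_zero(2)[OF rg L2_zpow]) (use assms in \<open>auto simp: fcoeff_zpow\<close>)
    finally show ?thesis .
  qed
  then show ?thesis using E_H2 by (simp add: Kspace_def)
qed

lemma Cconj_E: assumes "l < n" shows "Cconj (Bn n) (E n l) = E n (n - 1 - l)"
proof
  fix t
  have "Bn n t = zpow (int n) t * cnj (q n t) * rk n t"
    using Bn_q[of n t] q_nz[of n t] by (simp add: rk_q field_simps)
  moreover have "zpow (int (n - 1 - l)) t = zpow (int n) t * cnj (zpow 1 t) * cnj (zpow (int l) t)"
    using assms by (simp add: of_nat_diff zpow_diff zpow_add)
  ultimately show "Cconj (Bn n) (E n l) t = E n (n - 1 - l) t"
    unfolding Cconj_alt E_def using q_nz[of n t] by (simp add: rk_q)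
qed

text \<open>Expands 1/q_n = (1 - conj(a_n) z)/q_{n+1}. This links consecutive sizes and is the
  source of the recursion for the matrices.\<close>

lemma E_Suc: "E n l = (\<lambda>t. E (Suc n) l t + (- cnj (a n)) * E (Suc n) (Suc l) t)"
proof
  fix t
  have nz: "1 - cnj (a n) * cis t \<noteq> 0" using a one_minus_mult_nz[of "a n" "cis t"] by auto
  have r: "rk n t = rk (Suc n) t * (1 - cnj (a n) * cis t)" using nz by (simp add: rk_def)
  show "E n l t = E (Suc n) l t + (- cnj (a n)) * E (Suc n) (Suc l) t"
    unfolding E_def r zpow_of_nat by (simp add: algebra_simps)
qed

lemma fcoeff_E_0: "fcoeff (E n l) 0 = (if l = 0 then 1 else 0)"
proof (cases "l = 0")
  case True
  then show ?thesis using rk_0[of n] by (simp add: E_def[abs_def])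
next
  case False
  then show ?thesis unfolding E_def[abs_def] fcoeff_zpow_mult using rk_H2[of n] by (simp add: H2_def)
qed

text \<open>q_n f is a polynomial of degree below n: conj(q_n) z^m = B_n q_n z^(m - n), so for m at
  least n its m-th coefficient is a pairing of f with an element of B_n H2.\<close>

lemma K_Bn_rep:
  assumes f: "f \<in> Kspace (Bn n)"
  obtains c where "aeq f (\<lambda>t. \<Sum>l<n. c l * E n l t)"
proof -
  define p where "p = (\<lambda>t. q n t * f t)"
  have p: "p \<in> H2" unfolding p_def by (rule bdd_H2_mult[OF q_H2 q_bdd K_H2[OF f]])
  have pz: "fcoeff p m = 0" if "m \<ge> int n" for m
  proof -
    have "fcoeff p m = l2inner f (\<lambda>t. cnj (q n t) * zpow m t)"
      unfolding p_def fcoeff_eq_inner by (rule l2inner_mult_swap)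
    also have "(\<lambda>t. cnj (q n t) * zpow m t) = (\<lambda>t. Bn n t * (q n t * zpow (m - int n) t))"
    proof
      fix t
      have "zpow m t = zpow (int n) t * zpow (m - int n) t" by (simp flip: zpow_add)
      then show "cnj (q n t) * zpow m t = Bn n t * (q n t * zpow (m - int n) t)"
        using Bn_q[of n t] by (simp add: mult_ac)
    qed
    also have "l2inner f \<dots> = 0"
      by (rule K_orth[OF f bdd_H2_mult[OF q_H2 q_bdd H2_zpow]]) (use that in simp)
    finally show ?thesis .
  qed
  define S where "S = (\<lambda>t. \<Sum>k\<in>int ` {..<n}. fcoeff p k * zpow k t)"
  have "aeq p S"
  proof (rule fcoeff_eq_imp_aeq[OF H2_L2[OF p]])
    show "L2 S" unfolding S_def by (intro L2_sum L2_cmult L2_zpow)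
    fix k
    have "fcoeff p k = 0" if "k \<notin> int ` {..<n}"
    proof (cases "k < 0")
      case True then show ?thesis using p by (simp add: H2_def)
    next
      case False
      have "k \<ge> int n"
      proof (rule ccontr)
        assume "\<not> k \<ge> int n"
        then have "k = int (nat k)" "nat k < n" using False by auto
        then show False using that by blast
      qed
      then show ?thesis by (rule pz)
    qed
    then show "fcoeff p k = fcoeff S k" unfolding S_def by (simp add: fcoeff_trig_sum)
  qed
  then have "aeq f (\<lambda>t. \<Sum>l<n. fcoeff p (int l) * E n l t)"
    unfolding aeq_def
  proof eventually_elim
    case (elim t)
    have "f t = rk n t * p t" using q_nz[of n t] by (simp add: p_def rk_q)
    also have "p t = (\<Sum>l<n. fcoeff p (int l) * zpow (int l) t)"
      unfolding elim S_def by (subst sum.reindex) auto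
    also have "rk n t * \<dots> = (\<Sum>l<n. fcoeff p (int l) * E n l t)"
      by (simp add: E_def sum_distrib_left mult_ac)
    finally show ?case .
  qed
  then show ?thesis by (rule that)
qed

lemma K_Bn_Suc: "Kspace (Bn n) \<subseteq> Kspace (Bn (Suc n))"
proof
  fix f assume f: "f \<in> Kspace (Bn n)"
  have aj: "cmod (a n) < 1" using a by simp
  have "l2inner f (\<lambda>t. Bn (Suc n) t * g t) = 0" if g: "g \<in> H2" for g
  proof -
    have "(\<lambda>t. (cis t - a n) / (1 - cnj (a n) * cis t) * g t) \<in> H2"
      by (rule bdd_H2_mult[OF hol_closed_disc_boundary(1)[OF hol_closed_disc_moebius[OF aj]]
            hol_closed_disc_bdd[OF hol_closed_disc_moebius[OF aj]] g])
    from K_orth[OF f this] show ?thesis unfolding Bn_Suc by (simp only: mult.assoc)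
  qed
  then show "f \<in> Kspace (Bn (Suc n))" using K_H2[OF f] by (simp add: Kspace_def)
qed

lemma K_Bn_mono: "m \<le> n \<Longrightarrow> Kspace (Bn m) \<subseteq> Kspace (Bn n)"
  by (induction n rule: dec_induct) (use K_Bn_Suc in blast)+

end

lemma (in model_op) form_sum_left:
  assumes "\<And>l. l \<in> I \<Longrightarrow> F l \<in> K" "L2 h"
  shows "l2inner (A (\<lambda>t. \<Sum>l\<in>I. c l * F l t)) h = (\<Sum>l\<in>I. c l * l2inner (A (F l)) h)"
  using assms(1)
proof (induction I rule: infinite_finite_induct)
  case (insert x I)
  have "l2inner (A (\<lambda>t. (\<Sum>l\<in>I. c l * F l t) + c x * F x t)) h = l2inner (A (\<lambda>t. \<Sum>l\<in>I. c l * F l t)) h + c x * l2inner (A (F x)) h"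
    by (rule form_lin[OF K_sum[OF \<theta> K_cmult] _ assms(2)]) (use insert.prems in auto)
  then show ?case using insert by (simp add: add.commute)
next
  case empty
  \<comment> \<open>Nothing says directly what \<open>A\<close> does to 0. Linearity at 0 = 0 + (-1)
    0 gives x = x - x, so the form vanishes.\<close>
  have "l2inner (A (\<lambda>t. 0 + (-1) * 0)) h = l2inner (A (\<lambda>t. 0)) h + (-1) * l2inner (A (\<lambda>t. 0)) h"
    by (rule form_lin[OF K_zero K_zero assms(2)])
  then show ?case by simp
next
  case (infinite I)
  have "l2inner (A (\<lambda>t. 0 + (-1) * 0)) h = l2inner (A (\<lambda>t. 0)) h + (-1) * l2inner (A (\<lambda>t. 0)) h"
    by (rule form_lin[OF K_zero K_zero assms(2)])
  then show ?case using infinite by simp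
qed

text \<open>\<open>A\<close> acts on functions rather than classes. That it respects a.e. equality
  follows from the norm bound at f - g, which has norm 0.\<close>

lemma (in model_op) A_cong: assumes "f \<in> K" "g \<in> K" "aeq f g" shows "aeq (A f) (A g)"
proof -
  obtain M where M: "\<And>f. f \<in> K \<Longrightarrow> l2norm (A f) \<le> M * l2norm f" by (rule A_bound) blast
  have d: "(\<lambda>t. f t - g t) \<in> K" by (rule K_diff[OF \<theta> assms(1,2)])
  have "aeq (\<lambda>t. f t - g t) (\<lambda>t. 0)" using assms(3) unfolding aeq_def by eventually_elim simp
  then have "l2norm (\<lambda>t. f t - g t) = 0" using l2norm_eq_0_iff[OF K_L2[OF d]] by simp
  then have "l2norm (A (\<lambda>t. f t - g t)) = 0" using M[OF d] by (simp add: order_antisym)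
  then have "aeq (A (\<lambda>t. f t - g t)) (\<lambda>t. 0)" using l2norm_eq_0_iff[OF A_L2[OF d]] by simp
  moreover have "aeq (A (\<lambda>t. g t + 1 * (f t - g t))) (\<lambda>t. A g t + 1 * A (\<lambda>t. f t - g t) t)"
    by (rule A_lin[OF assms(2) d])
  ultimately show ?thesis unfolding aeq_def by (simp, eventually_elim) simp
qed

lemma (in model_op) form_cong:
  assumes "f \<in> K" "f' \<in> K" "aeq f f'" "L2 g" "aeq g g'"
  shows "l2inner (A f) g = l2inner (A f') g'"
  by (rule l2inner_cong_AE[OF A_cong[OF assms(1-3)] assms(5) A_L2[OF assms(1)] assms(4)])

section \<open>From symmetric compressions to shift invariance\<close>

locale finite_sym = zeros a + model_op \<theta> A for a \<theta> A +
  assumes sub: "\<And>n. Kspace (Bn n) \<subseteq> Kspace \<theta>"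
    and sym: "\<And>n. n \<ge> 1 \<Longrightarrow> C_symmetric (Bn n) (compress (Kspace (Bn n)) A)"
begin

definition T :: "nat \<Rightarrow> nat \<Rightarrow> nat \<Rightarrow> complex" where
  "T n l m = l2inner (A (E n l)) (E n m)"

lemma EK: "l < n \<Longrightarrow> E n l \<in> K"
  using E_K sub by blast

lemma E_L2: "L2 (E n l)"
  using E_H2 by (rule H2_L2)

lemma T_persymmetric: assumes "l < n" "m < n" shows "T n (n - 1 - l) (n - 1 - m) = T n m l"
proof -
  have n: "n \<ge> 1" using assms by simp
  have iff: "C_symmetric (Bn n) (compress (Kspace (Bn n)) A) \<longleftrightarrow>
    (\<forall>f\<in>Kspace (Bn n). \<forall>g\<in>Kspace (Bn n). l2inner (A (Cconj (Bn n) f)) (Cconj (Bn n) g) = l2inner (A g) f)"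
    by (rule C_symmetric_iff[OF inner_Bn]) (use sub A_L2 in blast)
  have "l2inner (A (Cconj (Bn n) (E n l))) (Cconj (Bn n) (E n m)) = l2inner (A (E n m)) (E n l)"
    using sym[OF n] E_K[OF assms(1)] E_K[OF assms(2)] unfolding iff by blast
  then show ?thesis unfolding T_def Cconj_E[OF assms(1)] Cconj_E[OF assms(2)] .
qed

lemma T_rel:
  assumes "l < n" "m < n"
  shows "T n l m = T (Suc n) l m - cnj (a n) * T (Suc n) (Suc l) m
        - a n * T (Suc n) l (Suc m) + cnj (a n) * a n * T (Suc n) (Suc l) (Suc m)"
proof -
  have K: "E (Suc n) l \<in> K" "E (Suc n) (Suc l) \<in> K" using EK assms by auto
  have r: "l2inner h (E n m) = l2inner h (E (Suc n) m) - a n * l2inner h (E (Suc n) (Suc m))" if "L2 h" for h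
    unfolding E_Suc[of n m] l2inner_add_right[OF E_L2 L2_cmult[OF E_L2] that] l2inner_cmult_right by simp
  have l: "l2inner (A (E n l)) h = l2inner (A (E (Suc n) l)) h - cnj (a n) * l2inner (A (E (Suc n) (Suc l))) h" if "L2 h" for h
    unfolding E_Suc[of n l] form_lin[OF K that] by simp
  show ?thesis
    unfolding T_def l[OF E_L2] r[OF A_L2[OF K(1)]] r[OF A_L2[OF K(2)]] by (simp add: algebra_simps)
qed

lemma T_Toeplitz:
  assumes "Suc l < n" "Suc m < n" shows "T n (Suc l) (Suc m) = T n l m"
proof (rule persymmetric_imp_Toeplitz[where a = a and T = T and n = n and l = l and m = m])
  show "cmod (a n) < 1" for n using a by simp
  show "T n (n - 1 - l) (n - 1 - m) = T n m l" if "l < n" "m < n" for n l m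
    by (rule T_persymmetric[OF that])
  show "T n l m = T (Suc n) l m - cnj (a n) * T (Suc n) (Suc l) m
      - a n * T (Suc n) l (Suc m) + cnj (a n) * a n * T (Suc n) (Suc l) (Suc m)" if "l < n" "m < n" for n l m
    by (rule T_rel[OF that])
qed (rule assms)+

lemma bshift_zero: "fcoeff f 0 = 0 \<Longrightarrow> bshift f = (\<lambda>t. zpow (-1) t * f t)"
  by (simp add: bshift_def[abs_def])

text \<open>Only the system function of index 0 is nonzero at the origin, so its coefficient
  vanishes; dividing by z then lowers every remaining index by one.\<close>

lemma K_Bn_rep0:
  assumes f: "f \<in> Kspace (Bn (Suc n))" "fcoeff f 0 = 0"
  obtains c where "aeq f (\<lambda>t. \<Sum>l<n. c l * E (Suc n) (Suc l) t)" "aeq (bshift f) (\<lambda>t. \<Sum>l<n. c l * E (Suc n) l t)"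
proof -
  obtain d where d: "aeq f (\<lambda>t. \<Sum>l<Suc n. d l * E (Suc n) l t)" by (rule K_Bn_rep[OF f(1)])
  have "fcoeff f 0 = fcoeff (\<lambda>t. \<Sum>l<Suc n. d l * E (Suc n) l t) 0" by (rule fcoeff_cong_AE[OF d K_L2[OF f(1)]])
  also have "\<dots> = (\<Sum>l<Suc n. d l * fcoeff (E (Suc n) l) 0)"
    using fcoeff_sum[of "{..<Suc n}" "\<lambda>l t. d l * E (Suc n) l t" 0] L2_cmult[OF E_L2] by (simp add: fcoeff_cmult)
  also have "\<dots> = d 0" by (simp add: fcoeff_E_0 sum.lessThan_Suc_shift del: sum.lessThan_Suc)
  finally have d0: "d 0 = 0" using f(2) by simp
  have ae: "aeq f (\<lambda>t. \<Sum>l<n. d (Suc l) * E (Suc n) (Suc l) t)"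
    using d unfolding sum.lessThan_Suc_shift d0 by simp
  have z: "zpow (-1) t * E (Suc n) (Suc l) t = E (Suc n) l t" for l t
  proof -
    have "zpow (-1) t * zpow (int (Suc l)) t = zpow (int l) t" by (simp flip: zpow_add)
    then show ?thesis unfolding E_def by (simp only: mult.assoc[symmetric])
  qed
  have "aeq (bshift f) (\<lambda>t. \<Sum>l<n. d (Suc l) * E (Suc n) l t)"
    unfolding aeq_def bshift_zero[OF f(2)] using ae[unfolded aeq_def]
  proof eventually_elim
    case (elim t)
    have "zpow (-1) t * f t = (\<Sum>l<n. d (Suc l) * (zpow (-1) t * E (Suc n) (Suc l) t))"
      unfolding elim by (simp add: sum_distrib_left mult_ac)
    then show ?case unfolding z .
  qed
  with ae show ?thesis by (rule that)
qed

text \<open>In the coordinates of \<open>K_Bn_rep0\<close> the two sides differ by lowering both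
  indices of the matrix \<open>T (Suc n)\<close> by one, so this is its Toeplitz property.\<close>

lemma finite_shift:
  assumes f: "f \<in> Kspace (Bn (Suc n))" "fcoeff f 0 = 0" and g: "g \<in> Kspace (Bn (Suc n))" "fcoeff g 0 = 0"
  shows "l2inner (A f) g = l2inner (A (bshift f)) (bshift g)"
proof -
  obtain c where c: "aeq f (\<lambda>t. \<Sum>l<n. c l * E (Suc n) (Suc l) t)" "aeq (bshift f) (\<lambda>t. \<Sum>l<n. c l * E (Suc n) l t)"
    by (rule K_Bn_rep0[OF f])
  obtain d where d: "aeq g (\<lambda>t. \<Sum>l<n. d l * E (Suc n) (Suc l) t)" "aeq (bshift g) (\<lambda>t. \<Sum>l<n. d l * E (Suc n) l t)"
    by (rule K_Bn_rep0[OF g])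
  have fK: "f \<in> K" "g \<in> K" using f g sub by blast+
  have EK1: "E (Suc n) (Suc l) \<in> K" "E (Suc n) l \<in> K" if "l \<in> {..<n}" for l using EK that by auto
  have SK: "(\<lambda>t. \<Sum>l<n. c l * E (Suc n) (Suc l) t) \<in> K" "(\<lambda>t. \<Sum>l<n. c l * E (Suc n) l t) \<in> K"
    by (rule K_sum[OF \<theta> K_cmult[OF EK1(1)]], assumption, rule K_sum[OF \<theta> K_cmult[OF EK1(2)]], assumption)
  have exp: "l2inner (A (\<lambda>t. \<Sum>l<n. c l * E (Suc n) (s l) t)) (\<lambda>t. \<Sum>l<n. d l * E (Suc n) (s l) t)
      = (\<Sum>l<n. \<Sum>m<n. c l * (cnj (d m) * T (Suc n) (s l) (s m)))"
    if "\<And>l. l \<in> {..<n} \<Longrightarrow> E (Suc n) (s l) \<in> K" for s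
  proof -
    have L: "L2 (\<lambda>t. \<Sum>l<n. d l * E (Suc n) (s l) t)" by (intro L2_sum L2_cmult E_L2)
    have "l2inner (A (\<lambda>t. \<Sum>l<n. c l * E (Suc n) (s l) t)) (\<lambda>t. \<Sum>l<n. d l * E (Suc n) (s l) t)
       = (\<Sum>l<n. c l * l2inner (A (E (Suc n) (s l))) (\<lambda>t. \<Sum>l<n. d l * E (Suc n) (s l) t))"
      by (rule form_sum_left[OF that L])
    also have "\<dots> = (\<Sum>l<n. c l * (\<Sum>m<n. cnj (d m) * T (Suc n) (s l) (s m)))"
    proof (intro sum.cong refl arg_cong2[where f = "(*)"])
      fix l assume l: "l \<in> {..<n}"
      show "l2inner (A (E (Suc n) (s l))) (\<lambda>t. \<Sum>l<n. d l * E (Suc n) (s l) t) = (\<Sum>m<n. cnj (d m) * T (Suc n) (s l) (s m))"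
        using l2inner_sum_right[of "{..<n}" "\<lambda>m t. d m * E (Suc n) (s m) t", OF L2_cmult[OF E_L2] A_L2[OF that[OF l]]]
        by (simp add: l2inner_cmult_right T_def)
    qed
    finally show ?thesis by (simp add: sum_distrib_left)
  qed
  have "l2inner (A f) g = l2inner (A (\<lambda>t. \<Sum>l<n. c l * E (Suc n) (Suc l) t)) (\<lambda>t. \<Sum>l<n. d l * E (Suc n) (Suc l) t)"
    by (rule form_cong[OF fK(1) SK(1) c(1) K_L2[OF fK(2)] d(1)])
  also have "\<dots> = (\<Sum>l<n. \<Sum>m<n. c l * (cnj (d m) * T (Suc n) (Suc l) (Suc m)))"
    by (rule exp[of Suc, OF EK1(1)])
  also have "\<dots> = (\<Sum>l<n. \<Sum>m<n. c l * (cnj (d m) * T (Suc n) l m))"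
    by (intro sum.cong refl) (simp add: T_Toeplitz)
  also have "\<dots> = l2inner (A (\<lambda>t. \<Sum>l<n. c l * E (Suc n) l t)) (\<lambda>t. \<Sum>l<n. d l * E (Suc n) l t)"
    by (rule exp[of "\<lambda>l. l", OF EK1(2), symmetric])
  also have "\<dots> = l2inner (A (bshift f)) (bshift g)"
    by (rule form_cong[OF bshift_K[OF \<theta> fK(1)] SK(2) c(2) K_L2[OF bshift_K[OF \<theta> fK(2)]] d(2), symmetric])
  finally show ?thesis .
qed

lemma shift_invariant_limit:
  assumes approx: "\<And>f. f \<in> K \<Longrightarrow> (\<lambda>n. l2norm (\<lambda>t. proj (Kspace (Bn n)) f t - f t)) \<longlonglongrightarrow> 0"
    and f: "f \<in> K" "fcoeff f 0 = 0" and g: "g \<in> K" "fcoeff g 0 = 0"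
  shows "l2inner (A f) g = l2inner (A (bshift f)) (bshift g)"
proof -
  define w where "w = E 1 0"
  have w0: "fcoeff w 0 = 1" by (simp add: w_def fcoeff_E_0)
  have wL: "L2 w" unfolding w_def by (rule E_L2)
  have wK: "w \<in> Kspace (Bn (Suc n))" for n
    using E_K[of 0 1] K_Bn_mono[of 1 "Suc n"] unfolding w_def by auto
  define P where "P = (\<lambda>n f. proj (Kspace (Bn (Suc n))) f)"
  \<comment> \<open>The projection of f need not vanish at the origin even if f does. Subtracting
    its value times \<open>w\<close> repairs this, and the correction tends to 0.\<close>
  define Y where "Y = (\<lambda>n f t. P n f t + (- fcoeff (P n f) 0) * w t)"
  have PK: "P n f \<in> Kspace (Bn (Suc n))" if "f \<in> K" for f n
    unfolding P_def by (rule proj_K(1)[OF inner_Bn K_L2[OF that]])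
  have YK: "Y n f \<in> Kspace (Bn (Suc n))" if "f \<in> K" for f n
    unfolding Y_def by (rule K_lincomb[OF inner_Bn PK[OF that] wK])
  have Y0: "fcoeff (Y n f) 0 = 0" if "f \<in> K" for f n
    unfolding Y_def fcoeff_add[OF K_L2[OF PK[OF that]] L2_cmult[OF wL]] fcoeff_cmult w0 by simp
  have YK': "Y n f \<in> K" if "f \<in> K" for f n using YK[OF that] sub by blast
  have lim: "(\<lambda>n. l2norm (\<lambda>t. Y n f t - f t)) \<longlonglongrightarrow> 0" if f: "f \<in> K" "fcoeff f 0 = 0" for f
  proof (rule Lim_null_comparison[OF always_eventually[OF allI]])
    have Pl: "(\<lambda>n. l2norm (\<lambda>t. P n f t - f t)) \<longlonglongrightarrow> 0"
      unfolding P_def by (rule LIMSEQ_Suc[OF approx[OF f(1)]])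
    fix n
    have dL: "L2 (\<lambda>t. P n f t - f t)" by (rule L2_diff[OF K_L2[OF PK[OF f(1)]] K_L2[OF f(1)]])
    have "l2norm (\<lambda>t. Y n f t - f t) = l2norm (\<lambda>t. (P n f t - f t) + (- fcoeff (P n f) 0) * w t)"
      unfolding Y_def by (simp add: algebra_simps)
    also have "\<dots> \<le> l2norm (\<lambda>t. P n f t - f t) + l2norm (\<lambda>t. (- fcoeff (P n f) 0) * w t)"
      by (rule l2norm_triangle[OF dL L2_cmult[OF wL]])
    also have "l2norm (\<lambda>t. (- fcoeff (P n f) 0) * w t) = cmod (fcoeff (\<lambda>t. P n f t - f t) 0) * l2norm w"
      unfolding l2norm_cmult fcoeff_diff[OF K_L2[OF PK[OF f(1)]] K_L2[OF f(1)]] f(2) by simp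
    also have "\<dots> \<le> l2norm (\<lambda>t. P n f t - f t) * l2norm w"
      by (rule mult_right_mono[OF cmod_fcoeff_le[OF dL]]) simp
    finally show "norm (l2norm (\<lambda>t. Y n f t - f t)) \<le> l2norm (\<lambda>t. P n f t - f t) * (1 + l2norm w)"
      by (simp add: algebra_simps)
    show "(\<lambda>n. l2norm (\<lambda>t. P n f t - f t) * (1 + l2norm w)) \<longlonglongrightarrow> 0"
      using tendsto_mult_right[OF Pl, of "1 + l2norm w"] by simp
  qed
  have blim: "(\<lambda>n. l2norm (\<lambda>t. bshift (Y n f) t - bshift f t)) \<longlonglongrightarrow> 0" if f: "f \<in> K" "fcoeff f 0 = 0" for f
  proof (rule Lim_null_comparison[OF always_eventually[OF allI] lim[OF f]])
    fix n
    have "(\<lambda>t. bshift (Y n f) t - bshift f t) = bshift (\<lambda>t. Y n f t - f t)"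
      using bshift_lin[OF K_L2[OF YK'[OF f(1)]] K_L2[OF f(1)], of n "-1"] by simp
    then show "norm (l2norm (\<lambda>t. bshift (Y n f) t - bshift f t)) \<le> l2norm (\<lambda>t. Y n f t - f t)"
      using l2norm_bshiftift[OF L2_diff[OF K_L2[OF YK'[OF f(1)]] K_L2[OF f(1)]], of n] by simp
  qed
  have "(\<lambda>n. l2inner (A (Y n f)) (Y n g)) \<longlonglongrightarrow> l2inner (A f) g"
    by (rule form_tendsto[OF YK'[OF f(1)] f(1) lim[OF f] K_L2[OF YK'[OF g(1)]] K_L2[OF g(1)] lim[OF g]])
  moreover have "(\<lambda>n. l2inner (A (bshift (Y n f))) (bshift (Y n g))) \<longlonglongrightarrow> l2inner (A (bshift f)) (bshift g)"
    by (rule form_tendsto[OF bshift_K[OF \<theta> YK'[OF f(1)]] bshift_K[OF \<theta> f(1)] blim[OF f]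
          K_L2[OF bshift_K[OF \<theta> YK'[OF g(1)]]] K_L2[OF bshift_K[OF \<theta> g(1)]] blim[OF g]])
  moreover have "l2inner (A (Y n f)) (Y n g) = l2inner (A (bshift (Y n f))) (bshift (Y n g))" for n
    by (rule finite_shift[OF YK[OF f(1)] Y0[OF f(1)] YK[OF g(1)] Y0[OF g(1)]])
  ultimately show ?thesis using LIMSEQ_unique by simp
qed

end

text \<open>For a fixed number of terms, the bounded approximants in the spaces of the B_n converge
  to the one in the space of B, which is close to f; the unimodular constants drop out by
  \<open>K_monomial_cmult\<close>. The projection does no worse than any approximant in the same
  space.\<close>

lemma proj_Bpart_tendsto:
  fixes a :: "nat \<Rightarrow> complex"
  assumes a: "\<forall>j. cmod (a j) < 1" and summ: "summable (\<lambda>j. 1 - cmod (a j))"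
    and f: "f \<in> Kspace (bv (blaschke \<gamma> a))"
  shows "(\<lambda>n. l2norm (\<lambda>t. proj (Kspace (bv (Bpart a n))) f t - f t)) \<longlonglongrightarrow> 0"
proof -
  define B where "B = bv (blaschke \<gamma> a)"
  have B: "inner_fn B" unfolding B_def by (rule inner_blaschke[OF a summ])
  have fK: "f \<in> Kspace B" using f by (simp add: B_def)
  have Bi: "inner_fn (bv (Bpart a n))" for n by (rule is_blaschke_inner[OF is_blaschke_Bpart[OF a]])
  define c where "c = (\<lambda>n. cis \<gamma> * cnj (unimod_part a n))"
  have c: "cmod (c n) = 1" for n by (simp add: c_def norm_mult norm_unimod_part)
  define F where "F = (\<lambda>n t. c n * bv (Bpart a n) t)"
  have Fi: "inner_fn (F n)" for n
    using Bi[of n] unfolding F_def inner_fn_def fcoeff_cmult by (auto simp: norm_mult c)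
  have Flim: "(\<lambda>n. l2norm (\<lambda>t. F n t - B t)) \<longlonglongrightarrow> 0"
    using Bpart_approx[OF a summ, of \<gamma>] unfolding F_def B_def c_def bv_Bpart[OF a] .
  have kF: "K_monomial (F n) m = K_monomial (bv (Bpart a n)) m" for n m
    unfolding F_def by (rule K_monomial_cmult[OF c])
  have klim: "(\<lambda>n. l2norm (\<lambda>t. K_approx (bv (Bpart a n)) f N t - K_approx B f N t)) \<longlonglongrightarrow> 0" for N
  proof (rule Lim_null_comparison[OF always_eventually[OF allI]])
    fix n
    have L: "L2 (\<lambda>t. fcoeff f (int m) * (K_monomial (F n) m t - K_monomial B m t))" for m
      by (intro L2_cmult L2_diff K_L2[OF K_monomial_K[OF Fi]] K_L2[OF K_monomial_K[OF B]])
    have "(\<lambda>t. K_approx (bv (Bpart a n)) f N t - K_approx B f N t) = (\<lambda>t. \<Sum>m<N. fcoeff f (int m) * (K_monomial (F n) m t - K_monomial B m t))"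
      unfolding K_approx_def kF by (simp add: right_diff_distrib sum_subtractf)
    then have "l2norm (\<lambda>t. K_approx (bv (Bpart a n)) f N t - K_approx B f N t) \<le> (\<Sum>m<N. l2norm (\<lambda>t. fcoeff f (int m) * (K_monomial (F n) m t - K_monomial B m t)))"
      using l2norm_sum_le[of "{..<N}" "\<lambda>m t. fcoeff f (int m) * (K_monomial (F n) m t - K_monomial B m t)"] L by simp
    also have "\<dots> \<le> (\<Sum>m<N. cmod (fcoeff f (int m)) * (2 * real (Suc m) * l2norm (\<lambda>t. F n t - B t)))"
      unfolding l2norm_cmult by (intro sum_mono mult_left_mono K_monomial_diff_le Fi B) simp
    finally show "norm (l2norm (\<lambda>t. K_approx (bv (Bpart a n)) f N t - K_approx B f N t))
      \<le> (\<Sum>m<N. cmod (fcoeff f (int m)) * (2 * real (Suc m) * l2norm (\<lambda>t. F n t - B t)))" by simp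
    have "(\<lambda>n. \<Sum>m<N. cmod (fcoeff f (int m)) * (2 * real (Suc m) * l2norm (\<lambda>t. F n t - B t)))
       \<longlonglongrightarrow> (\<Sum>m<N. cmod (fcoeff f (int m)) * (2 * real (Suc m) * 0))"
      by (intro tendsto_sum tendsto_mult tendsto_const Flim)
    then show "(\<lambda>n. \<Sum>m<N. cmod (fcoeff f (int m)) * (2 * real (Suc m) * l2norm (\<lambda>t. F n t - B t))) \<longlonglongrightarrow> 0" by simp
  qed
  show ?thesis
  proof (rule LIMSEQ_I)
    fix e :: real assume e: "e > 0"
    have "eventually (\<lambda>N. l2norm (\<lambda>t. K_approx B f N t - f t) < e / 2) sequentially"
      by (rule order_tendstoD(2)[OF K_approx_tendsto[OF B fK]]) (use e in simp)
    then obtain N where N: "l2norm (\<lambda>t. K_approx B f N t - f t) < e / 2" by (auto simp: eventually_sequentially)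
    have "eventually (\<lambda>n. l2norm (\<lambda>t. K_approx (bv (Bpart a n)) f N t - K_approx B f N t) < e / 2) sequentially"
      by (rule order_tendstoD(2)[OF klim]) (use e in simp)
    then obtain n0 where n0: "\<And>n. n \<ge> n0 \<Longrightarrow> l2norm (\<lambda>t. K_approx (bv (Bpart a n)) f N t - K_approx B f N t) < e / 2"
      by (auto simp: eventually_sequentially)
    have "norm (l2norm (\<lambda>t. proj (Kspace (bv (Bpart a n))) f t - f t) - 0) < e" if "n \<ge> n0" for n
    proof -
      have "l2norm (\<lambda>t. proj (Kspace (bv (Bpart a n))) f t - f t) \<le> l2norm (\<lambda>t. K_approx (bv (Bpart a n)) f N t - f t)"
        by (rule proj_best[OF Bi K_L2[OF f] K_approx_K[OF Bi]])
      also have "\<dots> \<le> l2norm (\<lambda>t. K_approx (bv (Bpart a n)) f N t - K_approx B f N t) + l2norm (\<lambda>t. K_approx B f N t - f t)"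
        by (rule l2norm_triangle_diff[OF K_L2[OF K_approx_K[OF Bi]] K_L2[OF K_approx_K[OF B]] K_L2[OF f]])
      also have "\<dots> < e / 2 + e / 2" using n0[OF that] N by (rule add_strict_mono)
      finally show ?thesis by simp
    qed
    then show "\<exists>no. \<forall>n\<ge>no. norm (l2norm (\<lambda>t. proj (Kspace (bv (Bpart a n))) f t - f t) - 0) < e" by blast
  qed
qed

theorem theorem5p1:
  fixes a :: "nat \<Rightarrow> complex" and \<gamma> :: real
    and A :: "(real \<Rightarrow> complex) \<Rightarrow> (real \<Rightarrow> complex)"
  assumes "\<forall>j. cmod (a j) < 1"
    and "summable (\<lambda>j. 1 - cmod (a j))"
    and "uniformly_separated a"
    and "bounded_op_on (Kspace (bv (blaschke \<gamma> a))) A"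
  shows "(A \<in> TTO (bv (blaschke \<gamma> a)) \<longleftrightarrow>
           (\<forall>\<beta>. is_blaschke \<beta> \<and> nonconstant_disc \<beta> \<and> divides_inner (bv \<beta>) (bv (blaschke \<gamma> a))
                \<longrightarrow> C_symmetric (bv \<beta>) (compress (Kspace (bv \<beta>)) A)))
       \<and> (A \<in> TTO (bv (blaschke \<gamma> a)) \<longleftrightarrow>
           (\<forall>n\<ge>1. C_symmetric (bv (Bpart a n)) (compress (Kspace (bv (Bpart a n))) A)))"
proof -
  let ?P1 = "A \<in> TTO (bv (blaschke \<gamma> a))"
  let ?P2 = "\<forall>\<beta>. is_blaschke \<beta> \<and> nonconstant_disc \<beta> \<and> divides_inner (bv \<beta>) (bv (blaschke \<gamma> a))
      \<longrightarrow> C_symmetric (bv \<beta>) (compress (Kspace (bv \<beta>)) A)"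
  let ?P3 = "\<forall>n\<ge>1. C_symmetric (bv (Bpart a n)) (compress (Kspace (bv (Bpart a n))) A)"
  interpret model_op "bv (blaschke \<gamma> a)" A
    by standard (rule inner_blaschke[OF assms(1,2)], rule assms(4))
  have 12: ?P2 if ?P1
    using TTO_imp_C_symmetric[OF that is_blaschke_inner] by blast
  \<comment> \<open>For n at least 1, B_n is itself a nonconstant Blaschke product dividing
    B.\<close>
  have 23: ?P3 if ?P2
    using that is_blaschke_Bpart[OF assms(1)] nonconstant_Bpart[OF assms(1)] Bpart_divides[OF assms(1,2)] by blast
  have 31: ?P1 if P3: ?P3
  proof -
    interpret zeros a by standard (rule assms(1))
    interpret finite_sym a "bv (blaschke \<gamma> a)" A
    proof
      show "Kspace (Bn n) \<subseteq> K" for n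
        using K_subset[OF inner_Bn] Bpart_divides[OF assms(1,2), of n \<gamma>] unfolding bv_Bn by blast
      show "C_symmetric (Bn n) (compress (Kspace (Bn n)) A)" if "n \<ge> 1" for n
        using P3 that unfolding bv_Bn by blast
    qed
    have approx: "(\<lambda>n. l2norm (\<lambda>t. proj (Kspace (Bn n)) f t - f t)) \<longlonglongrightarrow> 0" if "f \<in> K" for f
      using proj_Bpart_tendsto[OF assms(1,2) that] unfolding bv_Bn .
    show ?P1
    proof (rule shift_invariant_imp_TTO)
      \<comment> \<open>The vector 1/(1 - conj(a_0) z) serves as the one with value 1 at the
        origin.\<close>
      show "E 1 0 \<in> K" by (rule EK) simp
      show "fcoeff (E 1 0) 0 = 1" by (simp add: fcoeff_E_0)
    qed (rule shift_invariant_limit[OF approx])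
  qed
  show ?thesis using 12 23 31 by blast
qed

end
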